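(* Suppose that $X$ is linearly ordered, $1<p<\infty$, and let $\chi\in X$, $\chi\ne\mathbf 1$. Consider $T_\chi$ on $H^p(G)$. Then: 1) the spectrum $\sigma(T_\chi)$ coincides with the closed unit disc $\overline{\mathbb D}$; 2) if $\chi\in X^i$, the Fredholm essential spectrum is $\sigma_e(T_\chi)=\chi(G)=\mathbb T$; 3) if $\chi\notin X^i$, the Fredholm essential spectrum is $\sigma_e(T_\chi)=\overline{\mathbb D}$.
   Context: $G$ is a nontrivial connected compact abelian group with normalized Haar measure $m$; $X$ is its (discrete) character group, written multiplicatively, with unit character $\mathbf 1$. $T\subset X$ is a fixed subsemigroup (positive cone) with $\mathbf 1\in T$, $T\cap T^{-1}=\{\mathbf 1\}$, $X=T^{-1}T$; it defines an order on $X$ by $\xi\le\chi$ iff $\chi\xi^{-1}\in T$. $X$ is linearly ordered means $T\cup T^{-1}=X$. $\mathbb T$ is the unit circle and $\mathbb D$ the open unit disc in $\mathbb C$. Fourier transform: $\widehat f(\chi)=\int_G f\overline{\chi}\,dm$. $H^p(G)=\{f\in L^p(G):\widehat f(\chi)=0 \text{ for all }\chi\in X\setminus T\}$ with the $L^p$ norm. $Pol(G)$ and $Pol_T(G)$ are the linear spans of $X$ and of $T$. The Riesz projection $P_T:Pol(G)\to Pol_T(G)$ is $P_T(\sum_{\chi\in M}c_\chi\chi)=\sum_{\chi\in M\cap T}c_\chi\chi$; for linearly ordered $X$ and $1<p<\infty$ it extends to a bounded projection $P_T:L^p(G)\to H^p(G)$ (Bochner–Helson). For $\varphi\in L^\infty(G)$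 the Toeplitz operator is $T_\varphi f=P_T(\varphi f)$, $f\in H^p(G)$. $X^i$ is the set of characters having an index, i.e. the set of $\chi\in X$ of the form $\chi=\chi_1\chi_2^{-1}$ with $\chi_j\in T$ and both sets $T\setminus\chi_jT$ finite ($j=1,2$). $\sigma_e(A)$ is the set of $\lambda\in\mathbb C$ such that $A-\lambda I$ is not Fredholm. *)

theory Defs
  imports "HOL-Analysis.Analysis" "HOL-Library.Function_Division"
begin

text \<open>
  Functions carry the pointwise operations from \<^theory>\<open>HOL-Library.Function_Algebras\<close> and
  \<^theory>\<open>HOL-Library.Function_Division\<close>; in particular \<^term>\<open>\<psi> * \<xi>\<close>, \<^term>\<open>inverse \<psi>\<close> and
  \<^term>\<open>1\<close> are the operations of the character group. The group \<open>G\<close> itself is a type,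
  written additively.
\<close>

section \<open>Haar measure and characters\<close>

definition normalized_haar :: "'g::topological_ab_group_add measure \<Rightarrow> bool" where
  "normalized_haar m \<longleftrightarrow>
     sets m = sets borel \<and>
     emeasure m UNIV = 1 \<and>
     (\<forall>a. \<forall>A\<in>sets borel. emeasure m ((\<lambda>x. a + x) ` A) = emeasure m A) \<and>
     (\<forall>A\<in>sets borel. emeasure m A = (INF U\<in>{U. A \<subseteq> U \<and> open U}. emeasure m U)) \<and>
     (\<forall>U. open U \<longrightarrow> emeasure m U = (SUP K\<in>{K. K \<subseteq> U \<and> compact K}. emeasure m K))"

definition characters :: "('g::topological_ab_group_add \<Rightarrow> complex) set" where
  "characters = {\<psi>. continuous_on UNIV \<psi> \<and> (\<forall>x. cmod (\<psi> x) = 1) \<and> (\<forall>x y. \<psi> (x + y) = \<psi> x * \<psi> y)}"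

definition positive_cone :: "('g::topological_ab_group_add \<Rightarrow> complex) set \<Rightarrow> bool" where
  "positive_cone T \<longleftrightarrow>
     T \<subseteq> characters \<and> 1 \<in> T \<and> (\<forall>\<xi>\<in>T. \<forall>\<eta>\<in>T. \<xi> * \<eta> \<in> T) \<and>
     T \<inter> inverse ` T = {1} \<and>
     characters = {inverse \<xi> * \<eta> | \<xi> \<eta>. \<xi> \<in> T \<and> \<eta> \<in> T}"

definition linearly_ordered_by :: "('g::topological_ab_group_add \<Rightarrow> complex) set \<Rightarrow> bool" where
  "linearly_ordered_by T \<longleftrightarrow> T \<union> inverse ` T = characters"

definition indexed_characters ::
    "('g::topological_ab_group_add \<Rightarrow> complex) set \<Rightarrow> ('g \<Rightarrow> complex) set" where
  "indexed_characters T =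
     {\<psi>\<^sub>1 * inverse \<psi>\<^sub>2 | \<psi>\<^sub>1 \<psi>\<^sub>2.
        \<psi>\<^sub>1 \<in> T \<and> \<psi>\<^sub>2 \<in> T \<and> finite (T - (\<lambda>\<xi>. \<psi>\<^sub>1 * \<xi>) ` T) \<and> finite (T - (\<lambda>\<xi>. \<psi>\<^sub>2 * \<xi>) ` T)}"

section \<open>Lebesgue and Hardy spaces\<close>

text \<open>
  Elements of \<open>L\<^sup>p\<close> are represented by functions. No quotient is formed: \<^term>\<open>f\<close> and \<^term>\<open>g\<close>
  represent the same element iff the seminorm of \<^term>\<open>f - g\<close> vanishes, i.e. iff they agree
  almost everywhere, and all notions for operators below are taken modulo this relation.
\<close>

definition Lp :: "'g measure \<Rightarrow> real \<Rightarrow> ('g \<Rightarrow> complex) set" where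
  "Lp m p = {f \<in> borel_measurable m. integrable m (\<lambda>x. cmod (f x) powr p)}"

definition Lp_norm :: "'g measure \<Rightarrow> real \<Rightarrow> ('g \<Rightarrow> complex) \<Rightarrow> real" where
  "Lp_norm m p f = (\<integral>x. cmod (f x) powr p \<partial>m) powr (1 / p)"

lemma Lp_norm_eq_0_iff:
  assumes "f \<in> Lp m p"
  shows "Lp_norm m p f = 0 \<longleftrightarrow> (AE x in m. f x = 0)"
  using assms by (simp add: Lp_def Lp_norm_def integral_nonneg_eq_0_iff_AE)

definition fourier :: "'g measure \<Rightarrow> ('g \<Rightarrow> complex) \<Rightarrow> ('g \<Rightarrow> complex) \<Rightarrow> complex" where
  "fourier m f \<psi> = (\<integral>x. f x * cnj (\<psi> x) \<partial>m)"

definition Hp ::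
    "'g::topological_ab_group_add measure \<Rightarrow> ('g \<Rightarrow> complex) set \<Rightarrow> real \<Rightarrow> ('g \<Rightarrow> complex) set" where
  "Hp m T p = {f \<in> Lp m p. \<forall>\<psi>\<in>characters - T. fourier m f \<psi> = 0}"

section \<open>Operators on seminormed function spaces\<close>

definition cscale :: "complex \<Rightarrow> ('g \<Rightarrow> complex) \<Rightarrow> 'g \<Rightarrow> complex" where
  "cscale c f = (\<lambda>x. c * f x)"

text \<open>
  In the following, \<^term>\<open>N\<close> is a seminorm on the complex function spaces \<^term>\<open>V\<close> and \<^term>\<open>W\<close>;
  the Banach spaces in question are the quotients by the null space of \<^term>\<open>N\<close>. Since linearity
  is only required modulo this null space, boundedness ensures that an operator is well-defined
  on the quotient.
\<close>

definition bounded_operator ::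
    "(('g \<Rightarrow> complex) \<Rightarrow> real) \<Rightarrow> ('g \<Rightarrow> complex) set \<Rightarrow> ('g \<Rightarrow> complex) set \<Rightarrow>
     (('g \<Rightarrow> complex) \<Rightarrow> 'g \<Rightarrow> complex) \<Rightarrow> bool" where
  "bounded_operator N V W A \<longleftrightarrow>
     (\<forall>f\<in>V. A f \<in> W) \<and>
     (\<forall>f\<in>V. \<forall>g\<in>V. N (A (f + g) - (A f + A g)) = 0) \<and>
     (\<forall>c. \<forall>f\<in>V. N (A (cscale c f) - cscale c (A f)) = 0) \<and>
     (\<exists>C. \<forall>f\<in>V. N (A f) \<le> C * N f)"

definition invertible_operator ::
    "(('g \<Rightarrow> complex) \<Rightarrow> real) \<Rightarrow> ('g \<Rightarrow> complex) set \<Rightarrow>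
     (('g \<Rightarrow> complex) \<Rightarrow> 'g \<Rightarrow> complex) \<Rightarrow> bool" where
  "invertible_operator N V A \<longleftrightarrow>
     bounded_operator N V V A \<and>
     (\<exists>B. bounded_operator N V V B \<and>
        (\<forall>f\<in>V. N (A (B f) - f) = 0) \<and> (\<forall>f\<in>V. N (B (A f) - f) = 0))"

text \<open>Closed range, finite-dimensional kernel and finite-dimensional cokernel.\<close>

definition fredholm_operator ::
    "(('g \<Rightarrow> complex) \<Rightarrow> real) \<Rightarrow> ('g \<Rightarrow> complex) set \<Rightarrow>
     (('g \<Rightarrow> complex) \<Rightarrow> 'g \<Rightarrow> complex) \<Rightarrow> bool" where
  "fredholm_operator N V A \<longleftrightarrow>
     bounded_operator N V V A \<and>
     (\<forall>f\<in>V. (\<forall>\<epsilon>>0. \<exists>g\<in>V. N (f - A g) < \<epsilon>) \<longrightarrow> (\<exists>g\<in>V. N (f - A g) = 0)) \<and>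
     (\<exists>F. finite F \<and> F \<subseteq> V \<and>
        (\<forall>f\<in>V. N (A f) = 0 \<longrightarrow> (\<exists>c. N (f - (\<Sum>h\<in>F. cscale (c h) h)) = 0))) \<and>
     (\<exists>F. finite F \<and> F \<subseteq> V \<and>
        (\<forall>f\<in>V. \<exists>g\<in>V. \<exists>c. N (f - (A g + (\<Sum>h\<in>F. cscale (c h) h))) = 0))"

definition operator_spectrum ::
    "(('g \<Rightarrow> complex) \<Rightarrow> real) \<Rightarrow> ('g \<Rightarrow> complex) set \<Rightarrow>
     (('g \<Rightarrow> complex) \<Rightarrow> 'g \<Rightarrow> complex) \<Rightarrow> complex set" where
  "operator_spectrum N V A = {z. \<not> invertible_operator N V (\<lambda>f. A f - cscale z f)}"

definition essential_spectrum ::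
    "(('g \<Rightarrow> complex) \<Rightarrow> real) \<Rightarrow> ('g \<Rightarrow> complex) set \<Rightarrow>
     (('g \<Rightarrow> complex) \<Rightarrow> 'g \<Rightarrow> complex) \<Rightarrow> complex set" where
  "essential_spectrum N V A = {z. \<not> fredholm_operator N V (\<lambda>f. A f - cscale z f)}"

section \<open>Riesz projection and Toeplitz operators\<close>

text \<open>
  \<^term>\<open>P\<close> is the bounded projection of \<open>L\<^sup>p\<close> onto \<open>H\<^sup>p\<close> that extends the Riesz projection
  of trigonometric polynomials. By density of the latter in \<open>L\<^sup>p\<close> it is determined up to null
  functions; it exists whenever the characters are linearly ordered and \<open>1 < p < \<infinity>\<close>
  (Bochner, Helson).
\<close>

definition riesz_projection ::
    "'g::topological_ab_group_add measure \<Rightarrow> ('g \<Rightarrow> complex) set \<Rightarrow> real \<Rightarrow>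
     (('g \<Rightarrow> complex) \<Rightarrow> 'g \<Rightarrow> complex) \<Rightarrow> bool" where
  "riesz_projection m T p P \<longleftrightarrow>
     bounded_operator (Lp_norm m p) (Lp m p) (Hp m T p) P \<and>
     (\<forall>f\<in>Hp m T p. Lp_norm m p (P f - f) = 0) \<and>
     (\<forall>M c. finite M \<and> M \<subseteq> characters \<longrightarrow>
        Lp_norm m p (P (\<Sum>\<psi>\<in>M. cscale (c \<psi>) \<psi>) - (\<Sum>\<psi>\<in>M \<inter> T. cscale (c \<psi>) \<psi>)) = 0)"

definition toeplitz ::
    "(('g \<Rightarrow> complex) \<Rightarrow> 'g \<Rightarrow> complex) \<Rightarrow> ('g \<Rightarrow> complex) \<Rightarrow> ('g \<Rightarrow> complex) \<Rightarrow> 'g \<Rightarrow> complex" where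
  "toeplitz P \<phi> f = P (\<phi> * f)"

end

theory Submission
  imports Defs "HOL-Probability.Probability"
begin

text \<open>
  For a positive symbol \<open>\<phi>\<close> the operator \<open>T\<^sub>\<phi> - z\<close> is multiplication by \<open>\<phi> - z\<close>, and
  \<open>T\<^bsub>1/\<phi>\<^esub>\<close> is a left inverse of \<open>T\<^sub>\<phi>\<close>. For \<open>\<bar>z\<bar> < 1\<close> the cokernel of
  \<open>T\<^sub>\<phi> - z\<close> and the kernel of \<open>T\<^bsub>1/\<phi>\<^esub> - z\<close> both have as dimension the cardinality of \<open>T - \<phi>T\<close>: the relevant
  functionals and vectors are read off from the Fourier coefficients of \<open>\<eta> / (\<phi> - z)\<close> and from
  \<open>\<eta> / (1 - z\<phi>)\<close>, for \<open>\<eta>\<close> in \<open>T - \<phi>T\<close>. This set is finite iff the symbol has an index.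

  For \<open>\<bar>z\<bar> = 1\<close> the range is dense but misses the Riesz projection of
  \<open>Im (Ln (1 - z\<phi>))\<close>: comparing coefficients on the powers of \<open>\<phi>\<close>, a preimage would have
  unbounded Fourier coefficients because the harmonic series diverges. Hence the range is not closed.

  Identities for the Riesz projection extend from characters to all of \<open>L\<^sup>p\<close> without the density of
  trigonometric polynomials (Peter-Weyl): conditioning on the sets whose indicator functions are
  limits of trigonometric polynomials splits a bounded function into such a limit and a function all
  of whose Fourier coefficients vanish. The latter belongs to \<open>H\<^sup>p\<close>, so the projection fixes it.
\<close>

section \<open>Lebesgue spaces over the group\<close>

text \<open>The order on the characters need not be archimedean: multiplying by \<phi> again and
  again from outside T may never reach T, so coefficients cannot be found by walking until something
  is known. Every vanishing claim instead combines two facts. The Fourier coefficients of one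
  function are uniformly bounded, and division by \<open>\<phi> - z\<close> becomes a one-step
  recursion along \<phi> with ratio z or 1/z. A bounded family that shrinks by a fixed factor below
  1 at each step is zero. For |z| < 1 the recursion outside T can break only where a step enters T,
  that is at an \<eta> with 1 \<le> \<eta> < \<phi>; these \<eta> form T - \<phi>T, hence the
  dimension count. The projection P is bounded by some constant K but not known to be a contraction,
  so a Neumann series does not reach all |z| > 1. For negative symbols injectivity comes from the
  bound K shared by all Toeplitz operators with symbol \<phi>^(-n). On the circle the test function
  is the bounded imaginary part of a logarithm, so that membership in L^p is immediate and P
  supplies the analytic half.\<close>

locale haar_Lp =
  fixes m :: "'g::topological_ab_group_add measure" and p :: real
  assumes haar: "normalized_haar m" and p_gt_1: "1 < p"
begin

abbreviation "L \<equiv> Lp m p"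
abbreviation "N \<equiv> Lp_norm m p"
abbreviation "F \<equiv> fourier m"

lemma sets_m [measurable_cong]: "sets m = sets borel"
  using haar by (simp add: normalized_haar_def)

lemma space_m [simp]: "space m = UNIV"
  using sets_eq_imp_space_eq[OF sets_m] by simp

sublocale prob_space m
  by standard (use haar in \<open>simp add: normalized_haar_def\<close>)

lemma prob_UNIV [simp]: "measure m UNIV = 1"
  using prob_space by simp

lemma p_pos: "0 < p"
  using p_gt_1 by simp

lemma Lp_measurable [measurable_dest]: "f \<in> L \<Longrightarrow> f \<in> borel_measurable m"
  by (simp add: Lp_def)

lemma Lp_integrable_powr: "f \<in> L \<Longrightarrow> integrable m (\<lambda>x. cmod (f x) powr p)"
  by (simp add: Lp_def)

lemma Lp_norm_nonneg [simp]: "0 \<le> N f"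
  by (simp add: Lp_norm_def)

lemma Lp_norm_powr: "N f powr p = (\<integral>x. cmod (f x) powr p \<partial>m)"
proof -
  have "(\<integral>x. cmod (f x) powr p \<partial>m) \<ge> 0"
    by (rule integral_nonneg_AE) simp
  then show ?thesis
    using p_pos by (simp add: Lp_norm_def powr_powr)
qed

lemma Lp_norm_le_iff:
  assumes "0 \<le> c"
  shows "N f \<le> c \<longleftrightarrow> (\<integral>x. cmod (f x) powr p \<partial>m) \<le> c powr p"
proof -
  have "N f \<le> c \<longleftrightarrow> N f powr p \<le> c powr p"
    using p_pos assms by (meson Lp_norm_nonneg linorder_not_less powr_less_mono2 powr_mono2 less_imp_le)
  then show ?thesis
    by (simp add: Lp_norm_powr)
qed

lemma Lp_norm_cong_AE:
  assumes [measurable]: "f \<in> borel_measurable m" "g \<in> borel_measurable m"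
    and "AE x in m. f x = g x"
  shows "N f = N g"
  unfolding Lp_norm_def
  by (intro arg_cong[where f="\<lambda>t. t powr (1 / p)"] integral_cong_AE) (use assms(3) in auto)

lemma Lp_dominated:
  assumes "g \<in> L" and [measurable]: "f \<in> borel_measurable m" and "AE x in m. cmod (f x) \<le> cmod (g x)"
  shows "f \<in> L" "N f \<le> N g"
proof -
  have AE: "AE x in m. cmod (f x) powr p \<le> cmod (g x) powr p"
    using assms(3) by eventually_elim (use p_pos in \<open>simp add: powr_mono2\<close>)
  have int: "integrable m (\<lambda>x. cmod (f x) powr p)"
    by (rule Bochner_Integration.integrable_bound[OF Lp_integrable_powr[OF assms(1)]]) (use AE in auto)
  then show "f \<in> L"
    by (simp add: Lp_def)
  show "N f \<le> N g"
    by (simp add: Lp_norm_le_iff Lp_norm_powr)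
      (rule integral_mono_AE[OF int Lp_integrable_powr[OF assms(1)] AE])
qed

lemma Lp_scale:
  assumes "f \<in> L"
  shows "(\<lambda>x. c * f x) \<in> L" "N (\<lambda>x. c * f x) = cmod c * N f"
proof -
  note [measurable] = assms
  have eq: "cmod (c * f x) powr p = cmod c powr p * cmod (f x) powr p" for x
    by (simp add: norm_mult powr_mult)
  show "(\<lambda>x. c * f x) \<in> L"
    using Lp_integrable_powr[OF assms] assms by (auto simp: Lp_def eq)
  have "(\<integral>x. cmod (f x) powr p \<partial>m) \<ge> 0"
    by (rule integral_nonneg_AE) simp
  then show "N (\<lambda>x. c * f x) = cmod c * N f"
    using p_pos unfolding Lp_norm_def eq by (simp add: powr_mult powr_powr)
qed

lemma Lp_bounded:
  assumes "f \<in> borel_measurable m" "\<And>x. cmod (f x) \<le> B"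
  shows "f \<in> L" "N f \<le> B"
proof -
  have B: "0 \<le> B"
    using norm_ge_zero[of "f undefined"] assms(2)[of undefined] by linarith
  have c: "(\<lambda>_. of_real B) \<in> L"
    by (simp add: Lp_def)
  have n: "N (\<lambda>_. of_real B) = B"
    using B p_pos by (simp add: Lp_norm_def powr_powr)
  show "f \<in> L" "N f \<le> B"
    using Lp_dominated[OF c assms(1)] assms(2) B n by auto
qed

lemma Lp_mult_bounded:
  assumes "f \<in> L" "b \<in> borel_measurable m" "\<And>x. cmod (b x) \<le> B"
  shows "(\<lambda>x. b x * f x) \<in> L" "N (\<lambda>x. b x * f x) \<le> B * N f"
proof -
  note [measurable] = assms(1,2)
  have B: "0 \<le> B"
    using norm_ge_zero[of "b undefined"] assms(3)[of undefined] by linarith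
  have "AE x in m. cmod (b x * f x) \<le> cmod (of_real B * f x)"
    using assms(3) by (simp add: norm_mult mult_right_mono B)
  from Lp_dominated[OF Lp_scale(1)[OF assms(1)] _ this]
  show "(\<lambda>x. b x * f x) \<in> L" "N (\<lambda>x. b x * f x) \<le> B * N f"
    using Lp_scale(2)[OF assms(1), of "of_real B"] B by auto
qed

text \<open>The quasi-triangle inequality is all that is needed below, so Minkowski's inequality is avoided.\<close>

lemma Lp_add:
  assumes "f \<in> L" "g \<in> L"
  shows "(\<lambda>x. f x + g x) \<in> L" "N (\<lambda>x. f x + g x) \<le> 4 * (N f + N g)"
proof -
  note [measurable] = assms
  have le: "cmod (f x + g x) powr p \<le> 2 powr p * (cmod (f x) powr p + cmod (g x) powr p)" for x
  proof -
    have "cmod (f x + g x) \<le> 2 * max (cmod (f x)) (cmod (g x))"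
      by (rule order_trans[OF norm_triangle_ineq]) linarith
    then have "cmod (f x + g x) powr p \<le> (2 * max (cmod (f x)) (cmod (g x))) powr p"
      using p_pos by (simp add: powr_mono2)
    also have "\<dots> = 2 powr p * (max (cmod (f x)) (cmod (g x))) powr p"
      by (simp add: powr_mult)
    also have "\<dots> \<le> 2 powr p * (cmod (f x) powr p + cmod (g x) powr p)"
      by (intro mult_left_mono) (auto simp: max_def)
    finally show ?thesis .
  qed
  have int: "integrable m (\<lambda>x. 2 powr p * (cmod (f x) powr p + cmod (g x) powr p))"
    using assms by (auto intro!: integrable_mult_right Bochner_Integration.integrable_add Lp_integrable_powr)
  have int': "integrable m (\<lambda>x. cmod (f x + g x) powr p)"
    by (rule Bochner_Integration.integrable_bound[OF int]) (use le in auto)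
  then show "(\<lambda>x. f x + g x) \<in> L"
    by (simp add: Lp_def)
  have "(\<integral>x. cmod (f x + g x) powr p \<partial>m) \<le> 2 powr p * (N f powr p + N g powr p)"
    using integral_mono[OF int' int le] assms by (simp add: Lp_norm_powr Lp_integrable_powr)
  \<comment> \<open>The constant 4 is 2 * 2: one factor comes from |f + g| \<le> 2 max(|f|, |g|),
    the other from a^p + b^p \<le> 2 (a + b)^p \<le> 2^p (a + b)^p, where p > 1 enters.\<close>
  also have "\<dots> \<le> 2 powr p * (2 powr p * (N f + N g) powr p)"
  proof (intro mult_left_mono)
    have "N f powr p + N g powr p \<le> 2 powr 1 * (N f + N g) powr p"
      using powr_mono2[of p "N f" "N f + N g"] powr_mono2[of p "N g" "N f + N g"] p_pos by simp
    also have "\<dots> \<le> 2 powr p * (N f + N g) powr p"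
      using p_gt_1 by (intro mult_right_mono powr_mono) auto
    finally show "N f powr p + N g powr p \<le> 2 powr p * (N f + N g) powr p" .
  qed simp
  also have "\<dots> = (4 * (N f + N g)) powr p"
    using powr_mult[of 2 2 p] powr_mult[of 4 "N f + N g" p] by simp
  finally show "N (\<lambda>x. f x + g x) \<le> 4 * (N f + N g)"
    by (subst Lp_norm_le_iff) auto
qed

lemma Lp_diff:
  assumes "f \<in> L" "g \<in> L"
  shows "(\<lambda>x. f x - g x) \<in> L" "N (\<lambda>x. f x - g x) \<le> 4 * (N f + N g)"
  using Lp_add[OF assms(1) Lp_scale(1)[OF assms(2), of "-1"]] Lp_scale(2)[OF assms(2), of "-1"] by simp_all

lemma Lp_norm_zero_iff: "f \<in> L \<Longrightarrow> N f = 0 \<longleftrightarrow> (AE x in m. f x = 0)"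
  by (rule Lp_norm_eq_0_iff)

lemma Lp_norm_diff_zero_iff:
  assumes "f \<in> L" "g \<in> L"
  shows "N (\<lambda>x. f x - g x) = 0 \<longleftrightarrow> (AE x in m. f x = g x)"
  using Lp_norm_zero_iff[OF Lp_diff(1)[OF assms]] by simp

lemma Lp_zero [simp]: "(\<lambda>_. 0) \<in> L"
  by (simp add: Lp_def)

lemma Lp_sum: "(\<And>i. i \<in> I \<Longrightarrow> f i \<in> L) \<Longrightarrow> (\<lambda>x. \<Sum>i\<in>I. f i x) \<in> L"
  by (induction I rule: infinite_finite_induct) (auto intro: Lp_add(1))

text \<open>Dominated convergence applied to the p-th powers |f - s n|^p with majorant |w|^p,
  followed by continuity of the p-th root at 0.\<close>

lemma Lp_norm_dominated_convergence:
  assumes [measurable]: "\<And>n. s n \<in> borel_measurable m" "f \<in> borel_measurable m"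
    and w: "w \<in> L"
    and lim: "AE x in m. (\<lambda>n. s n x) \<longlonglongrightarrow> f x"
    and bound: "\<And>n. AE x in m. cmod (f x - s n x) \<le> cmod (w x)"
  shows "(\<lambda>n. N (\<lambda>x. f x - s n x)) \<longlonglongrightarrow> 0"
proof -
  have "(\<lambda>n. \<integral>x. cmod (f x - s n x) powr p \<partial>m) \<longlonglongrightarrow> (\<integral>x. 0 \<partial>m)"
  proof (rule integral_dominated_convergence[OF _ _ Lp_integrable_powr[OF w]])
    show "AE x in m. (\<lambda>n. cmod (f x - s n x) powr p) \<longlonglongrightarrow> 0"
      using lim
    proof eventually_elim
      case (elim x)
      then have "(\<lambda>n. cmod (f x - s n x)) \<longlonglongrightarrow> cmod (f x - f x)"
        by (intro tendsto_intros)
      then show ?case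
        using tendsto_powr2[of "\<lambda>n. cmod (f x - s n x)" 0 sequentially "\<lambda>_. p" p] p_pos by simp
    qed
    show "AE x in m. norm (cmod (f x - s n x) powr p) \<le> cmod (w x) powr p" for n
      using bound[of n] by eventually_elim (use p_pos in \<open>simp add: powr_mono2\<close>)
  qed auto
  then have "(\<lambda>n. (\<integral>x. cmod (f x - s n x) powr p \<partial>m) powr (1 / p)) \<longlonglongrightarrow> 0"
    using tendsto_powr2[of "\<lambda>n. \<integral>x. cmod (f x - s n x) powr p \<partial>m" 0 sequentially "\<lambda>_. 1 / p" "1 / p"]
      p_pos by (simp add: integral_nonneg_AE)
  then show ?thesis
    by (simp add: Lp_norm_def)
qed

text \<open>Instead of Hoelder's inequality, t \<le> 1 + t^p is integrated for t = |f| / N f over a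
  space of total mass 1; the two summands contribute 1 each, which explains the constant 2.\<close>

lemma Lp_integrable:
  assumes "f \<in> L"
  shows "integrable m f" "(\<integral>x. cmod (f x) \<partial>m) \<le> 2 * N f"
proof -
  note [measurable] = assms
  have aux: "t \<le> 1 + t powr p" if "0 \<le> t" for t :: real
  proof (cases "t \<le> 1")
    case True
    then show ?thesis
      using powr_ge_zero[of t p] by linarith
  next
    case False
    then show ?thesis
      using powr_mono[of 1 p t] p_gt_1 by simp
  qed
  have int: "integrable m (\<lambda>x. 1 + cmod (f x) powr p)"
    using Lp_integrable_powr[OF assms] by simp
  show f: "integrable m f"
    by (rule Bochner_Integration.integrable_bound[OF int]) (use aux in \<open>auto intro: order_trans\<close>)
  show "(\<integral>x. cmod (f x) \<partial>m) \<le> 2 * N f"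
  proof (cases "N f = 0")
    case True
    then have "AE x in m. cmod (f x) = 0"
      using Lp_norm_zero_iff[OF assms] by simp
    then show ?thesis
      using True integral_cong_AE[of "\<lambda>x. cmod (f x)" m "\<lambda>_. 0"] by simp
  next
    case False
    then have pos: "0 < N f"
      using Lp_norm_nonneg[of f] by linarith
    have "cmod (f x) / N f \<le> 1 + cmod (f x) powr p / N f powr p" for x
      using aux[of "cmod (f x) / N f"] pos by (simp add: powr_divide)
    then have "(\<integral>x. cmod (f x) / N f \<partial>m) \<le> (\<integral>x. 1 + cmod (f x) powr p / N f powr p \<partial>m)"
      using f Lp_integrable_powr[OF assms] by (intro integral_mono) auto
    also have "\<dots> = 1 + N f powr p / N f powr p"
      using Lp_integrable_powr[OF assms] by (simp add: Lp_norm_powr)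
    also have "\<dots> = 2"
      using pos by simp
    finally show ?thesis
      using pos by (simp add: field_simps)
  qed
qed

end

section \<open>Characters and Fourier coefficients\<close>

lemma characters_norm: "\<kappa> \<in> characters \<Longrightarrow> cmod (\<kappa> x) = 1"
  by (simp add: characters_def)

lemma characters_nonzero: "\<kappa> \<in> characters \<Longrightarrow> \<kappa> x \<noteq> 0"
  using characters_norm[of \<kappa> x] by auto

lemma characters_add: "\<kappa> \<in> characters \<Longrightarrow> \<kappa> (x + y) = \<kappa> x * \<kappa> y"
  by (simp add: characters_def)

lemma characters_continuous: "\<kappa> \<in> characters \<Longrightarrow> continuous_on UNIV \<kappa>"
  by (simp add: characters_def)

lemma characters_cnj: "\<kappa> \<in> characters \<Longrightarrow> cnj (\<kappa> x) = inverse (\<kappa> x)"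
  using complex_norm_square[of "\<kappa> x"] by (simp add: characters_norm inverse_unique)

lemma characters_one [simp]: "1 \<in> characters"
  by (auto simp: characters_def one_fun_def)

lemma characters_mult: "\<kappa> \<in> characters \<Longrightarrow> \<xi> \<in> characters \<Longrightarrow> \<kappa> * \<xi> \<in> characters"
  by (auto simp: characters_def norm_mult times_fun_def intro!: continuous_intros)

lemma characters_inverse: "\<kappa> \<in> characters \<Longrightarrow> inverse \<kappa> \<in> characters"
  using characters_nonzero[of \<kappa>]
  by (auto simp: characters_def norm_inverse inverse_fun_def o_def intro!: continuous_intros)

lemma characters_power: "\<kappa> \<in> characters \<Longrightarrow> \<kappa> ^ n \<in> characters"
  by (induction n) (auto intro: characters_mult)

lemma power_fun_apply: "(f ^ n) x = (f x :: complex) ^ n"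
  by (induction n) auto

lemma fun_inverse_inverse [simp]: "inverse (inverse \<kappa>) = (\<kappa> :: 'g \<Rightarrow> complex)"
  by (simp add: fun_eq_iff)

lemma characters_mult_inverse_cancel:
  assumes "\<kappa> \<in> characters"
  shows "\<xi> * \<kappa> * inverse \<kappa> = \<xi>" "\<xi> * inverse \<kappa> * \<kappa> = \<xi>"
  using characters_nonzero[OF assms] by (auto simp: fun_eq_iff)

lemma characters_mult_eq_iff:
  assumes "\<kappa> \<in> characters"
  shows "\<kappa> * \<xi> = \<kappa> * \<eta> \<longleftrightarrow> \<xi> = \<eta>"
  using characters_nonzero[OF assms] by (auto simp: fun_eq_iff)

lemma characters_at_zero: "\<kappa> \<in> characters \<Longrightarrow> \<kappa> 0 = 1"
  using characters_add[of \<kappa> 0 0] characters_nonzero[of \<kappa> 0] by simp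

lemma characters_uminus: "\<kappa> \<in> characters \<Longrightarrow> \<kappa> (- x) = inverse (\<kappa> x)"
  using characters_add[of \<kappa> x "- x"] characters_at_zero[of \<kappa>]
  by (simp add: inverse_unique)

context haar_Lp
begin

lemma borel_measurable_cnj [measurable]: "cnj \<in> borel_measurable borel"
  by (intro borel_measurable_continuous_onI continuous_intros)

lemma continuous_measurable: "continuous_on UNIV (f :: 'g \<Rightarrow> 'b::topological_space) \<Longrightarrow> f \<in> borel_measurable m"
  by (subst measurable_cong_sets[OF sets_m refl]) (rule borel_measurable_continuous_onI)

lemma characters_measurable: "\<kappa> \<in> characters \<Longrightarrow> \<kappa> \<in> borel_measurable m"
  by (intro continuous_measurable characters_continuous)

lemma characters_Lp: "\<kappa> \<in> characters \<Longrightarrow> \<kappa> \<in> L"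
  by (rule Lp_bounded[where B=1]) (auto simp: characters_norm characters_measurable)

lemma Lp_mult_character:
  assumes "f \<in> L" "\<kappa> \<in> characters"
  shows "(\<lambda>x. \<kappa> x * f x) \<in> L" "N (\<lambda>x. \<kappa> x * f x) \<le> N f"
  using Lp_mult_bounded[OF assms(1) characters_measurable[OF assms(2)], of 1] assms(2)
  by (auto simp: characters_norm)

lemma haar_translate: "A \<in> sets borel \<Longrightarrow> emeasure m ((\<lambda>x. a + x) ` A) = emeasure m A"
  using haar unfolding normalized_haar_def by (elim conjE) (drule spec, drule bspec)

lemma integral_translate:
  fixes f :: "'g \<Rightarrow> complex"
  assumes "f \<in> borel_measurable m"
  shows "(\<integral>x. f (a + x) \<partial>m) = (\<integral>x. f x \<partial>m)"
proof -
  have cont: "continuous_on UNIV (\<lambda>x :: 'g. a + x)"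
    by (intro continuous_intros)
  have meas: "(\<lambda>x. a + x) \<in> measurable m m"
    by (subst measurable_cong_sets[OF sets_m sets_m]) (rule borel_measurable_continuous_onI[OF cont])
  have "distr m m (\<lambda>x. a + x) = m"
  proof (rule measure_eqI)
    fix A assume A: "A \<in> sets (distr m m (\<lambda>x. a + x))"
    \<comment> \<open>Invariance of the Haar measure is stated for images, whereas the pushforward
      uses preimages; a preimage under translation by a is an image under translation by -a.\<close>
    have "(\<lambda>x. a + x) -` A = (\<lambda>x. - a + x) ` A"
    proof (intro equalityI subsetI)
      fix x assume "x \<in> (\<lambda>x. a + x) -` A"
      then show "x \<in> (\<lambda>x. - a + x) ` A"
        by (intro image_eqI[of _ _ "a + x"]) auto
    qed auto
    then show "emeasure (distr m m (\<lambda>x. a + x)) A = emeasure m A"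
      using A meas haar_translate[of A "- a"] by (simp add: emeasure_distr sets_m)
  qed simp
  then show ?thesis
    using integral_distr[OF meas assms] by simp
qed

text \<open>Translating by some a with \<kappa> a \<noteq> 1 multiplies the integral by \<kappa> a
  without changing it.\<close>

lemma integral_character:
  assumes "\<kappa> \<in> characters"
  shows "(\<integral>x. \<kappa> x \<partial>m) = (if \<kappa> = 1 then 1 else 0)"
proof (cases "\<kappa> = 1")
  case True
  then show ?thesis
    by simp
next
  case False
  then obtain a where a: "\<kappa> a \<noteq> 1"
    by (auto simp: fun_eq_iff)
  have "(\<integral>x. \<kappa> x \<partial>m) = \<kappa> a * (\<integral>x. \<kappa> x \<partial>m)"
    using integral_translate[OF characters_measurable[OF assms], of a] assms
    by (simp add: characters_add)
  then show ?thesis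
    using a False by simp
qed

lemma fourier_integrable:
  assumes "f \<in> L" "\<kappa> \<in> characters"
  shows "integrable m (\<lambda>x. f x * cnj (\<kappa> x))"
proof -
  have "(\<lambda>x. inverse \<kappa> x * f x) \<in> L"
    by (rule Lp_mult_character(1)[OF assms(1) characters_inverse[OF assms(2)]])
  from Lp_integrable(1)[OF this] show ?thesis
    using assms(2) by (simp add: characters_cnj mult.commute)
qed

lemma fourier_add:
  assumes "f \<in> L" "g \<in> L" "\<kappa> \<in> characters"
  shows "F (\<lambda>x. f x + g x) \<kappa> = F f \<kappa> + F g \<kappa>"
  using fourier_integrable assms by (simp add: fourier_def ring_distribs)

lemma fourier_diff:
  assumes "f \<in> L" "g \<in> L" "\<kappa> \<in> characters"
  shows "F (\<lambda>x. f x - g x) \<kappa> = F f \<kappa> - F g \<kappa>"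
  using fourier_integrable assms by (simp add: fourier_def ring_distribs)

lemma fourier_scale: "F (\<lambda>x. c * f x) \<kappa> = c * F f \<kappa>"
  by (simp add: fourier_def mult.assoc)

lemma fourier_zero [simp]: "F (\<lambda>_. 0) \<kappa> = 0"
  by (simp add: fourier_def)

lemma fourier_sum:
  assumes "\<And>i. i \<in> I \<Longrightarrow> f i \<in> L" "\<kappa> \<in> characters"
  shows "F (\<lambda>x. \<Sum>i\<in>I. f i x) \<kappa> = (\<Sum>i\<in>I. F (f i) \<kappa>)"
  using assms(1)
  by (induction I rule: infinite_finite_induct) (simp_all add: fourier_add Lp_sum assms(2))

lemma fourier_cong_AE:
  assumes "f \<in> borel_measurable m" "g \<in> borel_measurable m" "AE x in m. f x = g x" "\<kappa> \<in> characters"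
  shows "F f \<kappa> = F g \<kappa>"
proof -
  note [measurable] = assms(1,2) characters_measurable[OF assms(4)]
  show ?thesis
    unfolding fourier_def by (rule integral_cong_AE) (use assms(3) in auto)
qed

text \<open>The factor 2 is inherited from \<open>Lp_integrable\<close>. What matters later is that
  the bound does not depend on \<kappa>.\<close>

lemma fourier_bound:
  assumes "f \<in> L" "\<kappa> \<in> characters"
  shows "cmod (F f \<kappa>) \<le> 2 * N f"
proof -
  have "cmod (F f \<kappa>) \<le> (\<integral>x. cmod (f x * cnj (\<kappa> x)) \<partial>m)"
    unfolding fourier_def by (rule integral_norm_bound)
  also have "\<dots> = (\<integral>x. cmod (f x) \<partial>m)"
    using assms(2) by (simp add: norm_mult characters_norm)
  finally show ?thesis
    using Lp_integrable(2)[OF assms(1)] by linarith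
qed

text \<open>Multiplication by a character shifts the coefficient family; all coefficient recursions
  below rest on this.\<close>

lemma fourier_mult_character:
  assumes "\<kappa> \<in> characters" "\<xi> \<in> characters"
  shows "F (\<lambda>x. \<kappa> x * f x) \<xi> = F f (\<xi> * inverse \<kappa>)"
proof -
  have eq: "\<kappa> x * f x * cnj (\<xi> x) = f x * cnj ((\<xi> * inverse \<kappa>) x)" for x
    using characters_cnj[OF assms(1), of x, symmetric] by (simp del: complex_cnj_inverse)
  show ?thesis
    unfolding fourier_def eq ..
qed

lemma fourier_character:
  assumes "\<kappa> \<in> characters" "\<xi> \<in> characters"
  shows "F \<kappa> \<xi> = (if \<kappa> = \<xi> then 1 else 0)"
proof -
  have "F \<kappa> \<xi> = (\<integral>x. (\<kappa> * inverse \<xi>) x \<partial>m)"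
    using assms(2) by (simp add: fourier_def characters_cnj)
  moreover have "\<kappa> * inverse \<xi> = 1 \<longleftrightarrow> \<kappa> = \<xi>"
    using characters_nonzero[OF assms(2)] by (auto simp: fun_eq_iff field_simps)
  ultimately show ?thesis
    using integral_character[OF characters_mult[OF assms(1) characters_inverse[OF assms(2)]]] by simp
qed

lemma fourier_tendsto:
  assumes "\<kappa> \<in> characters" "f \<in> L" "\<And>n. s n \<in> L" "(\<lambda>n. N (\<lambda>x. f x - s n x)) \<longlonglongrightarrow> 0"
  shows "(\<lambda>n. F (s n) \<kappa>) \<longlonglongrightarrow> F f \<kappa>"
proof -
  have lim: "(\<lambda>n. 2 * N (\<lambda>x. f x - s n x)) \<longlonglongrightarrow> 0"
    using tendsto_mult_right_zero[OF assms(4)] by simp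
  have "(\<lambda>n. F f \<kappa> - F (s n) \<kappa>) \<longlonglongrightarrow> 0"
  proof (rule Lim_null_comparison[OF _ lim], rule always_eventually, rule allI)
    show "norm (F f \<kappa> - F (s n) \<kappa>) \<le> 2 * N (\<lambda>x. f x - s n x)" for n
      using fourier_bound[OF Lp_diff(1)[OF assms(2) assms(3)[of n]] assms(1)]
        fourier_diff[OF assms(2) assms(3)[of n] assms(1)] by simp
  qed
  then show ?thesis
    using tendsto_diff[OF tendsto_const[of "F f \<kappa>"], of "\<lambda>n. F f \<kappa> - F (s n) \<kappa>" 0 sequentially]
    by simp
qed

end

section \<open>Approximation by characters\<close>

text \<open>The closed linear span of the characters. Closedness is a constructor rather than a
  separate closure operation, so that limits of limits stay inside and rule induction offers a limit
  case.\<close>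

inductive_set char_closure :: "'g::topological_ab_group_add measure \<Rightarrow> real \<Rightarrow> ('g \<Rightarrow> complex) set"
  for m p where
  char: "\<kappa> \<in> characters \<Longrightarrow> \<kappa> \<in> char_closure m p"
| add: "f \<in> char_closure m p \<Longrightarrow> g \<in> char_closure m p \<Longrightarrow> (\<lambda>x. f x + g x) \<in> char_closure m p"
| scale: "f \<in> char_closure m p \<Longrightarrow> (\<lambda>x. c * f x) \<in> char_closure m p"
| limit: "f \<in> Lp m p \<Longrightarrow> \<forall>\<epsilon>>0. \<exists>g. g \<in> char_closure m p \<and> Lp_norm m p (\<lambda>x. f x - g x) < \<epsilon>
    \<Longrightarrow> f \<in> char_closure m p"

context haar_Lp
begin

abbreviation "C \<equiv> char_closure m p"

lemma char_closure_Lp: "f \<in> C \<Longrightarrow> f \<in> L"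
  by (induction rule: char_closure.induct) (auto intro: characters_Lp Lp_add Lp_scale)

lemma char_closure_measurable [measurable_dest]: "f \<in> C \<Longrightarrow> f \<in> borel_measurable m"
  using char_closure_Lp Lp_measurable by blast

lemma char_closure_tendsto:
  assumes "f \<in> L" "\<And>n. s n \<in> C" "(\<lambda>n. N (\<lambda>x. f x - s n x)) \<longlonglongrightarrow> 0"
  shows "f \<in> C"
proof (rule char_closure.limit[OF assms(1)], intro allI impI)
  fix \<epsilon> :: real assume "0 < \<epsilon>"
  then have "eventually (\<lambda>n. N (\<lambda>x. f x - s n x) < \<epsilon>) sequentially"
    using assms(3) by (simp add: order_tendsto_iff)
  then obtain n where "N (\<lambda>x. f x - s n x) < \<epsilon>"
    by (auto simp: eventually_sequentially)
  then show "\<exists>g. g \<in> C \<and> N (\<lambda>x. f x - g x) < \<epsilon>"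
    using assms(2) by blast
qed

text \<open>Constants belong to L^p because the measure is finite, so a uniform bound serves as
  majorant.\<close>

lemma char_closure_bounded_convergence:
  assumes "\<And>n. s n \<in> C" and [measurable]: "f \<in> borel_measurable m"
    and "\<And>x. (\<lambda>n. s n x) \<longlonglongrightarrow> f x" "\<And>n x. cmod (s n x) \<le> B" "\<And>x. cmod (f x) \<le> B"
  shows "f \<in> C"
proof (rule char_closure_tendsto[OF Lp_bounded(1)])
  note [measurable] = assms(1)
  show "(\<lambda>n. N (\<lambda>x. f x - s n x)) \<longlonglongrightarrow> 0"
  proof (rule Lp_norm_dominated_convergence)
    show "(\<lambda>_. of_real (2 * B)) \<in> L"
      by (rule Lp_bounded(1)) auto
    show "AE x in m. cmod (f x - s n x) \<le> cmod (of_real (2 * B))" for n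
    proof (rule AE_I2)
      fix x
      have "cmod (f x - s n x) \<le> cmod (f x) + cmod (s n x)"
        by (rule norm_triangle_ineq4)
      then show "cmod (f x - s n x) \<le> cmod (of_real (2 * B))"
        using assms(4)[of n x] assms(5)[of x] by simp
    qed
  qed (use assms(3) in auto)
qed (use assms in auto)

text \<open>Characters are permuted by the multiplication, and |\<kappa>| = 1 lets it pass through
  limits without loss.\<close>

lemma char_closure_mult_character:
  assumes "f \<in> C" "\<kappa> \<in> characters"
  shows "(\<lambda>x. \<kappa> x * f x) \<in> C"
  using assms(1)
proof (induction rule: char_closure.induct)
  case (char \<xi>)
  then show ?case
    using char_closure.char[OF characters_mult[OF assms(2)]] by (simp add: times_fun_def)
next
  case (add f g)
  then show ?case
    using char_closure.add by (fastforce simp: ring_distribs)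
next
  case (scale f c)
  then show ?case
    using char_closure.scale[of "\<lambda>x. \<kappa> x * f x" m p c] by (simp add: algebra_simps)
next
  case (limit f)
  have "(\<lambda>x. \<kappa> x * f x) \<in> L"
    by (rule Lp_mult_character) (use limit assms(2) in auto)
  then show ?case
  proof (rule char_closure.limit, intro allI impI)
    fix \<epsilon> :: real assume "0 < \<epsilon>"
    then obtain g where g: "g \<in> C" "(\<lambda>x. \<kappa> x * g x) \<in> C" "N (\<lambda>x. f x - g x) < \<epsilon>"
      using limit by blast
    have "N (\<lambda>x. \<kappa> x * (f x - g x)) \<le> N (\<lambda>x. f x - g x)"
      by (rule Lp_mult_character) (use limit g assms(2) in \<open>auto intro: Lp_diff char_closure_Lp\<close>)
    then show "\<exists>h. h \<in> C \<and> N (\<lambda>x. \<kappa> x * f x - h x) < \<epsilon>"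
      using g by (intro exI[of _ "\<lambda>x. \<kappa> x * g x"]) (simp add: right_diff_distrib)
  qed
qed

text \<open>Induction on g: when g is a character, the previous lemma applies with f as the other
  factor; the bound on f carries products through limits of g. This makes the indicators in the
  closure stable under products.\<close>

lemma char_closure_mult_bounded:
  assumes "f \<in> C" "\<And>x. cmod (f x) \<le> B" "g \<in> C"
  shows "(\<lambda>x. f x * g x) \<in> C"
  using assms(3)
proof (induction rule: char_closure.induct)
  case (char \<xi>)
  then show ?case
    using char_closure_mult_character[OF assms(1)] by (simp add: mult.commute)
next
  case (add g h)
  then show ?case
    using char_closure.add by (fastforce simp: ring_distribs)
next
  case (scale g c)
  then show ?case
    using char_closure.scale[of "\<lambda>x. f x * g x" m p c] by (simp add: algebra_simps)
next
  case (limit g)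
  note [measurable] = assms(1)
  have B: "0 \<le> B"
    using norm_ge_zero[of "f undefined"] assms(2)[of undefined] by linarith
  have "(\<lambda>x. f x * g x) \<in> L"
    by (rule Lp_mult_bounded) (use limit assms in auto)
  then show ?case
  proof (rule char_closure.limit, intro allI impI)
    fix \<epsilon> :: real assume "0 < \<epsilon>"
    \<comment> \<open>The bound B may be 0, hence the denominator B + 1.\<close>
    then have "0 < \<epsilon> / (B + 1)"
      using B by simp
    then obtain h where h: "h \<in> C" "(\<lambda>x. f x * h x) \<in> C" "N (\<lambda>x. g x - h x) < \<epsilon> / (B + 1)"
      using limit by blast
    have "N (\<lambda>x. f x * (g x - h x)) \<le> B * N (\<lambda>x. g x - h x)"
      by (rule Lp_mult_bounded) (use limit h assms in \<open>auto intro: Lp_diff char_closure_Lp\<close>)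
    also have "\<dots> \<le> (B + 1) * N (\<lambda>x. g x - h x)"
      by (simp add: mult_right_mono)
    also have "\<dots> < \<epsilon>"
      using h(3) B by (simp add: field_simps)
    finally show "\<exists>k. k \<in> C \<and> N (\<lambda>x. f x * g x - k x) < \<epsilon>"
      using h by (intro exI[of _ "\<lambda>x. f x * h x"]) (simp add: right_diff_distrib)
  qed
qed

lemma char_closure_const: "(\<lambda>_. c) \<in> C"
  using char_closure.scale[OF char_closure.char[OF characters_one], of c] by simp

lemma char_closure_diff:
  assumes "f \<in> C" "g \<in> C"
  shows "(\<lambda>x. f x - g x) \<in> C"
  using char_closure.add[OF assms(1) char_closure.scale[OF assms(2), of "-1"]] by simp

section \<open>The sigma-algebra of sets with approximable indicator functions\<close>

definition char_sets :: "'g set set" where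
  "char_sets = {A \<in> sets borel. (indicator A :: 'g \<Rightarrow> complex) \<in> C}"

text \<open>Complements and disjoint unions follow from linearity and bounded convergence and give a
  Dynkin system; intersections are products of bounded functions in the closure, and an
  intersection-stable Dynkin system is a sigma-algebra.\<close>

lemma char_sets_sigma_algebra: "sigma_algebra UNIV char_sets"
proof -
  have "Dynkin_system UNIV char_sets"
  proof (rule Dynkin_systemI)
    show "UNIV \<in> char_sets"
      using char_closure_const[of 1] by (simp add: char_sets_def)
    show "UNIV - A \<in> char_sets" if "A \<in> char_sets" for A
    proof -
      have "(indicator (UNIV - A) :: 'g \<Rightarrow> complex) = (\<lambda>x. 1 - indicator A x)"
        by (auto simp: fun_eq_iff indicator_def)
      then show ?thesis
        using that char_closure_diff[OF char_closure_const[of 1]] by (auto simp: char_sets_def)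
    qed
    fix A :: "nat \<Rightarrow> 'g set" assume A: "disjoint_family A" "range A \<subseteq> char_sets"
    have "(\<lambda>x. \<Sum>i<n. indicator (A i) x :: complex) \<in> C" for n
    proof (induction n)
      case 0
      then show ?case
        using char_closure_const[of 0] by simp
    next
      case (Suc n)
      then show ?case
        using A by (auto simp: char_sets_def intro!: char_closure.add)
    qed
    moreover have sum_eq: "(\<lambda>x. \<Sum>i<n. indicator (A i) x :: complex) = indicator (\<Union>i<n. A i)" for n
      using A(1) by (auto simp: fun_eq_iff indicator_UN_disjoint[of "{..<n}" A] disjoint_family_on_def)
    ultimately have un: "(indicator (\<Union>i<n. A i) :: 'g \<Rightarrow> complex) \<in> C" for n
      by metis
    have "(\<Union>i. A i) \<in> sets borel"
      using A by (auto simp: char_sets_def)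
    moreover from this have "(indicator (\<Union>i. A i) :: 'g \<Rightarrow> complex) \<in> C"
    proof (intro char_closure_bounded_convergence[OF un, where B=1])
      show "(\<lambda>n. indicator (\<Union>i<n. A i) x :: complex) \<longlonglongrightarrow> indicator (\<Union>i. A i) x" for x
        by (rule LIMSEQ_indicator_UN)
    qed (auto simp: sets_m indicator_def)
    ultimately show "(\<Union>i. A i) \<in> char_sets"
      by (simp add: char_sets_def)
  qed simp
  moreover have "Int_stable char_sets"
  proof (rule Int_stableI)
    fix A B :: "'g set" assume "A \<in> char_sets" "B \<in> char_sets"
    moreover from this have "(\<lambda>x. indicator A x * indicator B x :: complex) \<in> C"
      by (intro char_closure_mult_bounded[where B=1]) (auto simp: char_sets_def, simp add: indicator_def)
    moreover have "(\<lambda>x. indicator A x * indicator B x :: complex) = indicator (A \<inter> B)"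
      by (auto simp: fun_eq_iff indicator_def)
    ultimately show "A \<inter> B \<in> char_sets"
      by (auto simp: char_sets_def)
  qed
  ultimately show ?thesis
    using Dynkin_system.sigma_algebra_eq_Int_stable by blast
qed

text \<open>The real and imaginary parts of \<kappa> are combinations of the characters \<kappa> and
  \<open>inverse \<kappa>\<close>. Boundedness is carried through the induction because the product
  case relies on \<open>char_closure_mult_bounded\<close>.\<close>

lemma real_polynomial_character_closure:
  assumes \<kappa>: "\<kappa> \<in> characters" and "real_polynomial_function q"
  shows "(\<lambda>x. of_real (q (\<kappa> x))) \<in> C \<and> (\<exists>B. \<forall>x. \<bar>q (\<kappa> x)\<bar> \<le> B)"
  using assms(2)
proof (induction rule: real_polynomial_function.induct)
  case (linear q)
  then interpret q: bounded_linear q .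
  have q: "q z = Re z * q 1 + Im z * q \<i>" for z
  proof -
    have "z = Re z *\<^sub>R 1 + Im z *\<^sub>R \<i>"
      by (simp add: complex_eq_iff)
    then have "q z = q (Re z *\<^sub>R 1 + Im z *\<^sub>R \<i>)"
      by simp
    also have "\<dots> = Re z * q 1 + Im z * q \<i>"
      by (simp only: q.add q.scale) simp
    finally show ?thesis .
  qed
  \<comment> \<open>Substitutes Re \<kappa> = (\<kappa> + 1/\<kappa>) / 2 and Im \<kappa> = -i
    (\<kappa> - 1/\<kappa>) / 2, valid since 1/\<kappa> is the conjugate of \<kappa>.\<close>
  have "of_real (q (\<kappa> x)) = of_real (q 1) / 2 * \<kappa> x + - \<i> * of_real (q \<i>) / 2 * \<kappa> x
      + (of_real (q 1) / 2 * inverse \<kappa> x + \<i> * of_real (q \<i>) / 2 * inverse \<kappa> x)" for x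
    unfolding inverse_fun_apply characters_cnj[OF \<kappa>, symmetric]
    by (simp add: q[of "\<kappa> x"] complex_eq_iff)
  moreover have "(\<lambda>x. of_real (q 1) / 2 * \<kappa> x + - \<i> * of_real (q \<i>) / 2 * \<kappa> x
      + (of_real (q 1) / 2 * inverse \<kappa> x + \<i> * of_real (q \<i>) / 2 * inverse \<kappa> x)) \<in> C"
    by (intro char_closure.add char_closure.scale char_closure.char characters_inverse \<kappa>)
  moreover have "\<bar>q (\<kappa> x)\<bar> \<le> onorm q" for x
    using onorm[OF linear, of "\<kappa> x"] \<kappa> by (simp add: characters_norm)
  ultimately show ?case
    by auto
next
  case (const c)
  then show ?case
    using char_closure_const by auto
next
  case (add f g)
  then obtain A B where A: "\<And>x. \<bar>f (\<kappa> x)\<bar> \<le> A" and B: "\<And>x. \<bar>g (\<kappa> x)\<bar> \<le> B"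
    by blast
  have "\<bar>f (\<kappa> x) + g (\<kappa> x)\<bar> \<le> A + B" for x
    using A[of x] B[of x] by linarith
  then show ?case
    using add char_closure.add[of "\<lambda>x. of_real (f (\<kappa> x))" m p] by auto
next
  case (mult f g)
  then obtain A B where A: "\<And>x. \<bar>f (\<kappa> x)\<bar> \<le> A" and B: "\<And>x. \<bar>g (\<kappa> x)\<bar> \<le> B"
    by blast
  have "\<bar>f (\<kappa> x) * g (\<kappa> x)\<bar> \<le> A * B" for x
    using A[of x] B[of x] by (simp add: abs_mult mult_mono')
  moreover have "(\<lambda>x. of_real (f (\<kappa> x)) * of_real (g (\<kappa> x))) \<in> C"
    by (rule char_closure_mult_bounded[where B=A]) (use mult A in auto)
  ultimately show ?case
    by auto
qed

text \<open>Stone-Weierstrass on the unit circle, where \<kappa> takes its values: a uniform error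
  on the circle is a uniform error on the group, and the L^p norm of a function is at most its
  uniform bound.\<close>

lemma continuous_character_closure:
  assumes \<kappa>: "\<kappa> \<in> characters" and h: "continuous_on UNIV (h :: complex \<Rightarrow> real)"
  shows "(\<lambda>x. of_real (h (\<kappa> x))) \<in> C"
proof -
  have meas: "(\<lambda>x. of_real (h (\<kappa> x)) :: complex) \<in> borel_measurable m"
    by (intro continuous_measurable continuous_intros continuous_on_compose2[OF h]
        characters_continuous[OF \<kappa>]) auto
  have hS: "continuous_on (sphere 0 1) h"
    using h continuous_on_subset by blast
  obtain B where B: "\<forall>w\<in>sphere 0 1. \<bar>h w\<bar> \<le> B"
    using compact_imp_bounded[OF compact_continuous_image[OF hS]] by (auto simp: bounded_iff)
  have "(\<lambda>x. complex_of_real (h (\<kappa> x))) \<in> L"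
    by (rule Lp_bounded(1)[OF meas, where B=B]) (use B \<kappa> in \<open>auto simp: characters_norm\<close>)
  then show ?thesis
  proof (rule char_closure.limit, intro allI impI)
    fix \<epsilon> :: real assume "0 < \<epsilon>"
    \<comment> \<open>Half of \<epsilon>, because \<open>Lp_bounded\<close> only yields a non-strict
      inequality.\<close>
    then obtain q where q: "real_polynomial_function q" "\<And>w. w \<in> sphere 0 1 \<Longrightarrow> \<bar>h w - q w\<bar> < \<epsilon> / 2"
      using Stone_Weierstrass_real_polynomial_function[OF _ hS, of "\<epsilon> / 2"] by auto
    have qC: "(\<lambda>x. complex_of_real (q (\<kappa> x))) \<in> C"
      using real_polynomial_character_closure[OF \<kappa> q(1)] by blast
    note [measurable] = meas qC
    have "N (\<lambda>x. complex_of_real (h (\<kappa> x)) - of_real (q (\<kappa> x))) \<le> \<epsilon> / 2"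
    proof (rule Lp_bounded(2))
      show "cmod (complex_of_real (h (\<kappa> x)) - of_real (q (\<kappa> x))) \<le> \<epsilon> / 2" for x
        using q(2)[of "\<kappa> x"] \<kappa> by (simp add: characters_norm flip: of_real_diff)
    qed measurable
    then show "\<exists>g. g \<in> C \<and> N (\<lambda>x. complex_of_real (h (\<kappa> x)) - g x) < \<epsilon>"
      using qC \<open>0 < \<epsilon>\<close> by (intro exI[of _ "\<lambda>x. complex_of_real (q (\<kappa> x))"]) auto
  qed
qed

section \<open>Conditioning on this sigma-algebra\<close>

definition char_algebra :: "'g measure" where
  "char_algebra = sigma UNIV char_sets"

lemma sets_char_algebra: "sets char_algebra = char_sets"
  using sigma_algebra.sigma_sets_eq[OF char_sets_sigma_algebra] by (simp add: char_algebra_def)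

lemma space_char_algebra [simp]: "space char_algebra = UNIV"
  by (simp add: char_algebra_def space_measure_of_conv)

lemma char_algebra_subalgebra: "subalgebra m char_algebra"
  by (auto simp: subalgebra_def sets_char_algebra char_sets_def sets_m)

sublocale char_algebra: finite_measure_subalgebra m char_algebra
  by standard (rule char_algebra_subalgebra)

text \<open>The indicator of the preimage of an open U is the pointwise limit of min(1, n
  dist(\<kappa> x, -U)), and each of these is a continuous function of \<kappa>.\<close>

lemma characters_measurable_char_algebra:
  assumes \<kappa>: "\<kappa> \<in> characters"
  shows "\<kappa> \<in> borel_measurable char_algebra"
proof (rule borel_measurableI)
  fix U :: "complex set" assume U: "open U"
  show "\<kappa> -` U \<inter> space char_algebra \<in> sets char_algebra"
  \<comment> \<open>The distance to the empty set is 0 by convention, so for U = UNIV the cut-off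
    functions would vanish instead of tending to 1.\<close>
  proof (cases "U = UNIV")
    case True
    then show ?thesis
      by (metis Int_UNIV_left sets.top vimage_UNIV)
  next
    case False
    have pre: "\<kappa> -` U \<in> sets m"
      using measurable_sets[OF characters_measurable[OF \<kappa>] borel_open[OF U]] by simp
    define h where "h n w = min 1 (real n * infdist w (- U))" for n w
    have "(indicator (\<kappa> -` U) :: 'g \<Rightarrow> complex) \<in> C"
    proof (rule char_closure_bounded_convergence[where s="\<lambda>n x. of_real (h n (\<kappa> x))" and B=1])
      show "(\<lambda>x. complex_of_real (h n (\<kappa> x))) \<in> C" for n
        unfolding h_def by (intro continuous_character_closure[OF \<kappa>] continuous_intros)
      show "(indicator (\<kappa> -` U) :: 'g \<Rightarrow> complex) \<in> borel_measurable m"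
        using pre by simp
      show "(\<lambda>n. complex_of_real (h n (\<kappa> x))) \<longlonglongrightarrow> indicator (\<kappa> -` U) x" for x
      proof (cases "\<kappa> x \<in> U")
        case True
        then have "0 < infdist (\<kappa> x) (- U)"
          using U False in_closed_iff_infdist_zero[of "- U" "\<kappa> x"] infdist_nonneg[of "\<kappa> x" "- U"]
          by (auto simp: closed_def less_le)
        then obtain k :: nat where k: "1 < real k * infdist (\<kappa> x) (- U)"
          using reals_Archimedean3 by blast
        have "eventually (\<lambda>n. complex_of_real (h n (\<kappa> x)) = 1) sequentially"
        proof (rule eventually_sequentiallyI)
          fix n assume "k \<le> n"
          then have "real k * infdist (\<kappa> x) (- U) \<le> real n * infdist (\<kappa> x) (- U)"
            by (intro mult_right_mono) (auto simp: infdist_nonneg)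
          then show "complex_of_real (h n (\<kappa> x)) = 1"
            using k by (simp add: h_def)
        qed
        then show ?thesis
          using True by (simp add: tendsto_eventually)
      qed (simp add: h_def)
    qed (auto simp: h_def infdist_nonneg indicator_def)
    then show ?thesis
      using pre by (simp add: sets_char_algebra char_sets_def sets_m)
  qed
qed

text \<open>Induction over nonnegative measurable functions: indicators are in the closure by the
  choice of the sigma-algebra, and a common bound allows bounded convergence in the monotone
  limit.\<close>

lemma char_algebra_nonneg_closure:
  assumes "u \<in> borel_measurable char_algebra" "\<And>x. 0 \<le> u x" "\<And>x. u x \<le> B"
  shows "(\<lambda>x. complex_of_real (u x)) \<in> C"
proof -
  \<comment> \<open>The bound is quantified inside the induction statement, since scaling by c
    replaces B with B / c.\<close>
  have "\<forall>B. (\<forall>x. u x \<le> B) \<longrightarrow> (\<lambda>x. complex_of_real (u x)) \<in> C"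
    using assms(1,2)
  proof (induction rule: borel_measurable_induct_real)
    case (set A)
    then show ?case
      by (simp add: sets_char_algebra char_sets_def of_real_indicator[abs_def])
  next
    case (mult u c)
    show ?case
    proof (cases "c = 0")
      case True
      then show ?thesis
        using char_closure_const[of 0] by simp
    next
      case False
      show ?thesis
      proof (intro allI impI)
        fix B assume "\<forall>x. c * u x \<le> B"
        then have "\<forall>x. u x \<le> B / c"
          using mult(1) False by (simp add: pos_le_divide_eq mult.commute)
        then show "(\<lambda>x. complex_of_real (c * u x)) \<in> C"
          using mult char_closure.scale[of "\<lambda>x. of_real (u x)" m p "of_real c"] by auto
      qed
    qed
  next
    case (add u v)
    show ?case
    proof (intro allI impI)
      fix B assume B: "\<forall>x. v x + u x \<le> B"
      \<comment> \<open>Both summands are nonnegative, so each is bounded by the bound of the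
        sum.\<close>
      have "v x \<le> B \<and> u x \<le> B" for x
        using B[rule_format, of x] add.hyps(2)[of x] add.hyps(4)[of x] by linarith
      then have "(\<lambda>x. complex_of_real (v x)) \<in> C" "(\<lambda>x. complex_of_real (u x)) \<in> C"
        using add.IH by blast+
      from char_closure.add[OF this] show "(\<lambda>x. complex_of_real (v x + u x)) \<in> C"
        by simp
    qed
  next
    case (seq U)
    show ?case
    proof (intro allI impI)
      fix B assume B: "\<forall>x. u x \<le> B"
      have le: "U i x \<le> B" for i x
        using incseq_le[of "\<lambda>i. U i x" "u x" i] seq.hyps(3) seq.hyps(4)[of x] B
        by (auto simp: incseq_def le_fun_def intro: order_trans)
      have u: "u \<in> borel_measurable m"
        using assms(1) measurable_from_subalg[OF char_algebra_subalgebra] by blast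
      show "(\<lambda>x. complex_of_real (u x)) \<in> C"
      proof (rule char_closure_bounded_convergence[where s="\<lambda>i x. of_real (U i x)" and B=B])
        show "(\<lambda>x. complex_of_real (U i x)) \<in> C" for i
          using seq.IH[of i] le by blast
      qed (use seq.hyps B le assms(2) u in \<open>auto intro!: tendsto_of_real\<close>)
    qed
  qed
  then show ?thesis
    using assms(3) by blast
qed

lemma char_algebra_bounded_closure:
  assumes "u \<in> borel_measurable char_algebra" "\<And>x. \<bar>u x\<bar> \<le> B"
  shows "(\<lambda>x. complex_of_real (u x)) \<in> C"
proof -
  have "(\<lambda>x. complex_of_real (u x + B)) \<in> C"
  proof (rule char_algebra_nonneg_closure)
    show "(\<lambda>x. u x + B) \<in> borel_measurable char_algebra"
      using assms(1) by measurable
    show "0 \<le> u x + B" "u x + B \<le> B + B" for x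
      using assms(2)[of x] by linarith+
  qed
  from char_closure_diff[OF this char_closure_const[of "of_real B"]] show ?thesis
    by simp
qed

text \<open>The remainder after conditioning on the \<open>\<sigma>\<close>-algebra generated by the characters has no
  Fourier coefficients; this replaces the density of trigonometric polynomials.\<close>

lemma bounded_real_decomposition:
  fixes f :: "'g \<Rightarrow> real"
  assumes f [measurable]: "f \<in> borel_measurable m" and B: "\<And>x. \<bar>f x\<bar> \<le> B"
  obtains e where "(\<lambda>x. complex_of_real (e x)) \<in> C"
    "\<And>\<kappa>. \<kappa> \<in> characters \<Longrightarrow> F (\<lambda>x. complex_of_real (f x - e x)) \<kappa> = 0"
proof -
  let ?E = "real_cond_exp m char_algebra f"
  \<comment> \<open>The conditional expectation obeys the bound B only almost everywhere. Clipping
    changes it on a null set, keeps it measurable for the smaller sigma-algebra, and gives the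
    everywhere bound that membership in the closure is derived from.\<close>
  define e where "e x = max (- B) (min B (?E x))" for x
  have B0: "0 \<le> B"
    using abs_ge_zero[of "f undefined"] B[of undefined] by linarith
  have int: "integrable m f"
    by (rule integrable_const_bound[where B=B]) (use B in auto)
  have eG: "e \<in> borel_measurable char_algebra"
    unfolding e_def by measurable
  note [measurable] = measurable_from_subalg[OF char_algebra_subalgebra eG]
  have eB: "\<bar>e x\<bar> \<le> B" for x
    using B0 by (simp add: e_def)
  have eC: "(\<lambda>x. complex_of_real (e x)) \<in> C"
    by (rule char_algebra_bounded_closure[OF eG eB])
  have "AE x in m. ?E x \<le> B" "AE x in m. ?E x \<ge> - B"
    using char_algebra.real_cond_exp_le_c[OF int] char_algebra.real_cond_exp_ge_c[OF int] B
    by (simp_all add: abs_le_iff minus_le_iff)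
  then have AE: "AE x in m. ?E x = e x"
    by eventually_elim (simp add: e_def)
  \<comment> \<open>The defining property of the conditional expectation, tested against real
    functions; it is applied with g = Re \<kappa> and g = - Im \<kappa>, the two parts of the
    conjugate character.\<close>
  have orth: "(\<integral>x. (f x - e x) * g x \<partial>m) = 0"
    if gG: "g \<in> borel_measurable char_algebra" and g1: "\<And>x. \<bar>g x\<bar> \<le> 1" for g
  proof -
    note [measurable] = measurable_from_subalg[OF char_algebra_subalgebra gG]
    have i1: "integrable m (\<lambda>x. g x * f x)"
    proof (rule integrable_const_bound[where B="1 * B"], rule AE_I2)
      show "norm (g x * f x) \<le> 1 * B" for x
        using mult_mono[OF g1[of x] B[of x]] by (simp add: abs_mult)
    qed simp
    have i2: "integrable m (\<lambda>x. g x * e x)"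
    proof (rule integrable_const_bound[where B="1 * B"], rule AE_I2)
      show "norm (g x * e x) \<le> 1 * B" for x
        using mult_mono[OF g1[of x] eB[of x]] by (simp add: abs_mult)
    qed simp
    have "(\<integral>x. g x * f x \<partial>m) = (\<integral>x. g x * ?E x \<partial>m)"
      using char_algebra.real_cond_exp_intg(2)[OF i1 gG f] by simp
    also have "\<dots> = (\<integral>x. g x * e x \<partial>m)"
      by (rule integral_cong_AE) (use AE in auto)
    finally have "(\<integral>x. g x * f x - g x * e x \<partial>m) = 0"
      using i1 i2 by simp
    moreover have "(f x - e x) * g x = g x * f x - g x * e x" for x
      by (simp add: algebra_simps)
    ultimately show ?thesis
      by simp
  qed
  have "F (\<lambda>x. complex_of_real (f x - e x)) \<kappa> = 0" if \<kappa>: "\<kappa> \<in> characters" for \<kappa>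
  proof -
    note [measurable] = characters_measurable_char_algebra[OF \<kappa>] characters_measurable[OF \<kappa>]
    have fe: "\<bar>f x - e x\<bar> \<le> 2 * B" for x
      using B[of x] eB[of x] by linarith
    have int: "integrable m (\<lambda>x. complex_of_real (f x - e x) * cnj (\<kappa> x))"
      by (rule fourier_integrable[OF Lp_bounded(1)[where B="2 * B"] \<kappa>])
        (measurable, use fe in \<open>simp flip: of_real_diff\<close>)
    have "Re (F (\<lambda>x. complex_of_real (f x - e x)) \<kappa>) = (\<integral>x. (f x - e x) * Re (\<kappa> x) \<partial>m)"
      using int by (simp add: fourier_def integral_Re[symmetric])
    moreover have "\<dots> = 0"
    proof (rule orth)
      show "\<bar>Re (\<kappa> x)\<bar> \<le> 1" for x
        using abs_Re_le_cmod[of "\<kappa> x"] characters_norm[OF \<kappa>] by simp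
    qed measurable
    moreover have "Im (F (\<lambda>x. complex_of_real (f x - e x)) \<kappa>) = (\<integral>x. (f x - e x) * (- Im (\<kappa> x)) \<partial>m)"
      using int by (simp add: fourier_def integral_Im[symmetric])
    moreover have "\<dots> = 0"
    proof (rule orth)
      show "\<bar>- Im (\<kappa> x)\<bar> \<le> 1" for x
        using abs_Im_le_cmod[of "\<kappa> x"] characters_norm[OF \<kappa>] by simp
    qed measurable
    ultimately show ?thesis
      by (simp add: complex_eq_iff)
  qed
  with eC that show ?thesis
    by blast
qed

text \<open>The substitute for a density argument: a property stable under linear combinations and
  limits is checked on characters and on functions without Fourier coefficients. Bounded real
  functions split by \<open>bounded_real_decomposition\<close>; real and imaginary parts and
  truncation do the rest.\<close>

lemma Lp_induct [consumes 1, case_names char fourier_null add scale limit]: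
  assumes "f \<in> L"
    and char: "\<And>\<kappa>. \<kappa> \<in> characters \<Longrightarrow> Q \<kappa>"
    and null: "\<And>f. f \<in> L \<Longrightarrow> (\<And>\<kappa>. \<kappa> \<in> characters \<Longrightarrow> F f \<kappa> = 0) \<Longrightarrow> Q f"
    and add: "\<And>f g. f \<in> L \<Longrightarrow> g \<in> L \<Longrightarrow> Q f \<Longrightarrow> Q g \<Longrightarrow> Q (\<lambda>x. f x + g x)"
    and scale: "\<And>f c. f \<in> L \<Longrightarrow> Q f \<Longrightarrow> Q (\<lambda>x. c * f x)"
    and limit: "\<And>f. f \<in> L \<Longrightarrow> (\<And>\<epsilon>. 0 < \<epsilon> \<Longrightarrow> \<exists>g\<in>L. Q g \<and> N (\<lambda>x. f x - g x) < \<epsilon>) \<Longrightarrow> Q f"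
  shows "Q f"
proof -
  have C: "Q g" if "g \<in> C" for g
    using that
  proof (induction rule: char_closure.induct)
    case (limit f)
    then show ?case
      using assms(6) char_closure_Lp by blast
  qed (use char add scale char_closure_Lp in blast)+
  have real: "Q (\<lambda>x. complex_of_real (g x))"
    if g [measurable]: "g \<in> borel_measurable m" and B: "\<And>x. \<bar>g x\<bar> \<le> B" for g B
  proof -
    obtain e where e: "(\<lambda>x. complex_of_real (e x)) \<in> C"
      "\<And>\<kappa>. \<kappa> \<in> characters \<Longrightarrow> F (\<lambda>x. complex_of_real (g x - e x)) \<kappa> = 0"
      using bounded_real_decomposition[OF g B] by blast
    have "(\<lambda>x. complex_of_real (g x)) \<in> L"
      by (rule Lp_bounded[where B=B]) (use B in auto)
    then have d: "(\<lambda>x. complex_of_real (g x - e x)) \<in> L"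
      using Lp_diff(1) char_closure_Lp[OF e(1)] by simp
    have "Q (\<lambda>x. complex_of_real (g x - e x) + of_real (e x))"
      by (rule add[OF d char_closure_Lp[OF e(1)] null[OF d e(2)] C[OF e(1)]])
    then show ?thesis
      by simp
  qed
  have bounded: "Q g" if g: "g \<in> L" and B: "\<And>x. cmod (g x) \<le> B" for g B
  proof -
    note [measurable] = g
    have re: "\<bar>Re (g x)\<bar> \<le> B" and im: "\<bar>Im (g x)\<bar> \<le> B" for x
      using abs_Re_le_cmod[of "g x"] abs_Im_le_cmod[of "g x"] B[of x] by linarith+
    have L: "(\<lambda>x. complex_of_real (Re (g x))) \<in> L" "(\<lambda>x. complex_of_real (Im (g x))) \<in> L"
      by (rule Lp_bounded[where B=B]; use re im in simp)+
    have "Q (\<lambda>x. complex_of_real (Re (g x)) + \<i> * of_real (Im (g x)))"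
      by (intro add scale real[of _ B] L Lp_scale re im) auto
    then show ?thesis
      by (simp flip: complex_eq)
  qed
  \<comment> \<open>Truncation by magnitude: each \<open>s n\<close> is bounded, and |f - s n| \<le>
    |f| provides the majorant.\<close>
  define s where "s n = (\<lambda>x. indicator {x. cmod (f x) \<le> real n} x * f x)" for n
  note [measurable] = assms(1)
  have sL: "s n \<in> L" for n
    unfolding s_def by (rule Lp_mult_bounded(1)[OF assms(1), where B=1]) (auto simp: indicator_def)
  have lim: "(\<lambda>n. N (\<lambda>x. f x - s n x)) \<longlonglongrightarrow> 0"
  proof (rule Lp_norm_dominated_convergence[OF _ _ assms(1)])
    show "AE x in m. (\<lambda>n. s n x) \<longlonglongrightarrow> f x"
    proof (rule AE_I2)
      fix x
      obtain k where "cmod (f x) \<le> real k"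
        using real_arch_simple by blast
      then show "(\<lambda>n. s n x) \<longlonglongrightarrow> f x"
        by (intro tendsto_eventually eventually_sequentiallyI[of k]) (auto simp: s_def indicator_def)
    qed
  qed (use sL in \<open>auto simp: s_def indicator_def\<close>)
  have Qs: "Q (s n)" for n
    by (rule bounded[OF sL, of _ "real n"]) (auto simp: s_def indicator_def)
  show ?thesis
  proof (rule limit[OF assms(1)])
    fix \<epsilon> :: real assume "0 < \<epsilon>"
    then obtain n where "N (\<lambda>x. f x - s n x) < \<epsilon>"
      using order_tendstoD(2)[OF lim] by (auto simp: eventually_sequentially)
    then show "\<exists>g\<in>L. Q g \<and> N (\<lambda>x. f x - g x) < \<epsilon>"
      using sL Qs by blast
  qed
qed

end

section \<open>Hardy spaces and the Riesz projection\<close>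

locale riesz_setting = haar_Lp m p
  for m :: "'g::topological_ab_group_add measure" and p +
  fixes T :: "('g \<Rightarrow> complex) set" and P :: "('g \<Rightarrow> complex) \<Rightarrow> 'g \<Rightarrow> complex"
  assumes cone: "positive_cone T" and total: "linearly_ordered_by T"
    and riesz: "riesz_projection m T p P"
begin

abbreviation "H \<equiv> Hp m T p"

lemma T_characters: "\<kappa> \<in> T \<Longrightarrow> \<kappa> \<in> characters"
  using cone by (auto simp: positive_cone_def)

lemma T_one: "1 \<in> T"
  using cone by (simp add: positive_cone_def)

lemma T_mult: "\<kappa> \<in> T \<Longrightarrow> \<xi> \<in> T \<Longrightarrow> \<kappa> * \<xi> \<in> T"
  using cone by (simp add: positive_cone_def)

lemma T_power: "\<kappa> \<in> T \<Longrightarrow> \<kappa> ^ n \<in> T"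
  by (induction n) (auto intro: T_one T_mult)

lemma T_antisym:
  assumes "\<kappa> \<in> T" "inverse \<kappa> \<in> T"
  shows "\<kappa> = 1"
proof -
  have "\<kappa> \<in> inverse ` T"
    using assms(2) by (intro image_eqI[of _ _ "inverse \<kappa>"]) auto
  then show ?thesis
    using assms(1) cone by (auto simp: positive_cone_def)
qed

lemma T_cases:
  assumes "\<kappa> \<in> characters"
  obtains "\<kappa> \<in> T" | \<xi> where "\<xi> \<in> T" "\<kappa> = inverse \<xi>"
  using assms total by (auto simp: linearly_ordered_by_def)

text \<open>An ordered group has no torsion: \<kappa>^n = 1 would make the inverse of \<kappa> equal
  to \<kappa>^(n - 1), an element of T, against antisymmetry.\<close>

lemma T_power_neq_one:
  assumes "\<kappa> \<in> T" "\<kappa> \<noteq> 1" "0 < n"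
  shows "\<kappa> ^ n \<noteq> 1"
proof
  assume eq: "\<kappa> ^ n = 1"
  have "inverse \<kappa> = \<kappa> ^ (n - 1)"
  proof
    fix x
    have "\<kappa> x * (\<kappa> ^ (n - 1)) x = (\<kappa> ^ n) x"
      using \<open>0 < n\<close> by (cases n) auto
    then show "inverse \<kappa> x = (\<kappa> ^ (n - 1)) x"
      using eq by (simp add: inverse_unique)
  qed
  then have "inverse \<kappa> \<in> T"
    using T_power[OF assms(1)] by simp
  then show False
    using T_antisym assms by blast
qed

lemma T_divide_notin:
  assumes "\<xi> \<notin> T" "\<kappa> \<in> T"
  shows "\<xi> * inverse \<kappa> \<notin> T"
  using T_mult[of "\<xi> * inverse \<kappa>" \<kappa>] assms by (auto simp: characters_mult_inverse_cancel T_characters)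

lemma Hp_iff: "f \<in> H \<longleftrightarrow> f \<in> L \<and> (\<forall>\<kappa>\<in>characters. \<kappa> \<notin> T \<longrightarrow> F f \<kappa> = 0)"
  by (auto simp: Hp_def)

lemma Hp_Lp: "f \<in> H \<Longrightarrow> f \<in> L"
  by (simp add: Hp_iff)

lemma Hp_fourier: "f \<in> H \<Longrightarrow> \<kappa> \<in> characters \<Longrightarrow> \<kappa> \<notin> T \<Longrightarrow> F f \<kappa> = 0"
  by (simp add: Hp_iff)

lemma Hp_measurable [measurable_dest]: "f \<in> H \<Longrightarrow> f \<in> borel_measurable m"
  using Hp_Lp Lp_measurable by blast

lemma Hp_add: "f \<in> H \<Longrightarrow> g \<in> H \<Longrightarrow> (\<lambda>x. f x + g x) \<in> H"
  by (auto simp: Hp_iff Lp_add(1) fourier_add)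

lemma Hp_diff: "f \<in> H \<Longrightarrow> g \<in> H \<Longrightarrow> (\<lambda>x. f x - g x) \<in> H"
  by (auto simp: Hp_iff Lp_diff(1) fourier_diff)

lemma Hp_scale: "f \<in> H \<Longrightarrow> (\<lambda>x. c * f x) \<in> H"
  by (auto simp: Hp_iff Lp_scale(1) fourier_scale)

lemma Hp_zero: "(\<lambda>_. 0) \<in> H"
  by (simp add: Hp_iff)

lemma Hp_sum: "(\<And>i. i \<in> I \<Longrightarrow> f i \<in> H) \<Longrightarrow> (\<lambda>x. \<Sum>i\<in>I. f i x) \<in> H"
  by (induction I rule: infinite_finite_induct) (auto intro: Hp_add Hp_zero)

lemma Hp_character: "\<kappa> \<in> T \<Longrightarrow> \<kappa> \<in> H"
  by (auto simp: Hp_iff characters_Lp T_characters fourier_character)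

lemma Hp_mult_character:
  assumes "f \<in> H" "\<kappa> \<in> T"
  shows "(\<lambda>x. \<kappa> x * f x) \<in> H"
proof -
  have "F (\<lambda>x. \<kappa> x * f x) \<xi> = 0" if "\<xi> \<in> characters" "\<xi> \<notin> T" for \<xi>
    using T_divide_notin[OF that(2) assms(2)] assms that
    by (simp add: fourier_mult_character T_characters Hp_fourier characters_mult characters_inverse)
  then show ?thesis
    using assms by (simp add: Hp_iff Lp_mult_character(1) T_characters)
qed

lemma Hp_closed:
  assumes "f \<in> L" "\<And>\<epsilon>. 0 < \<epsilon> \<Longrightarrow> \<exists>g\<in>H. N (\<lambda>x. f x - g x) < \<epsilon>"
  shows "f \<in> H"
proof -
  have "F f \<kappa> = 0" if \<kappa>: "\<kappa> \<in> characters" "\<kappa> \<notin> T" for \<kappa>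
  proof (rule ccontr)
    assume "F f \<kappa> \<noteq> 0"
    \<comment> \<open>The half compensates for the factor 2 in \<open>fourier_bound\<close>.\<close>
    then have "0 < cmod (F f \<kappa>) / 2"
      by simp
    then obtain g where g: "g \<in> H" "N (\<lambda>x. f x - g x) < cmod (F f \<kappa>) / 2"
      using assms(2) by blast
    have "cmod (F (\<lambda>x. f x - g x) \<kappa>) \<le> 2 * N (\<lambda>x. f x - g x)"
      by (rule fourier_bound) (use assms g \<kappa> in \<open>auto intro: Lp_diff Hp_Lp\<close>)
    then show False
      using g \<kappa> assms(1) by (simp add: fourier_diff Hp_Lp Hp_fourier)
  qed
  then show ?thesis
    using assms(1) by (simp add: Hp_iff)
qed

subsection \<open>The projection modulo null functions\<close>

lemma riesz_bounded: "bounded_operator N L H P"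
  using riesz by (simp add: riesz_projection_def)

lemma P_Hp: "f \<in> L \<Longrightarrow> P f \<in> H"
  using riesz_bounded by (simp add: bounded_operator_def)

lemma P_Lp: "f \<in> L \<Longrightarrow> P f \<in> L"
  by (rule Hp_Lp[OF P_Hp])

lemma P_measurable: "f \<in> L \<Longrightarrow> P f \<in> borel_measurable m"
  by (intro Lp_measurable P_Lp)

lemma P_add:
  assumes "f \<in> L" "g \<in> L"
  shows "AE x in m. P (\<lambda>x. f x + g x) x = P f x + P g x"
proof -
  have "N (\<lambda>x. P (\<lambda>x. f x + g x) x - (P f x + P g x)) = 0"
    using riesz_bounded assms by (auto simp: bounded_operator_def plus_fun_def fun_diff_def)
  then show ?thesis
    using assms by (subst (asm) Lp_norm_diff_zero_iff) (auto intro: P_Lp Lp_add)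
qed

lemma P_scale:
  assumes "f \<in> L"
  shows "AE x in m. P (\<lambda>x. c * f x) x = c * P f x"
proof -
  have "N (\<lambda>x. P (\<lambda>x. c * f x) x - c * P f x) = 0"
    using riesz_bounded assms by (auto simp: bounded_operator_def cscale_def fun_diff_def)
  then show ?thesis
    using assms by (subst (asm) Lp_norm_diff_zero_iff) (auto intro: P_Lp Lp_scale)
qed

text \<open>The constant in \<open>bounded_operator\<close> may have any sign; |K| + 1 makes it
  positive, as the later multiplications of inequalities require.\<close>

lemma P_bound:
  obtains K where "0 < K" "\<And>f. f \<in> L \<Longrightarrow> N (P f) \<le> K * N f"
proof -
  obtain K where K: "\<forall>f\<in>L. N (P f) \<le> K * N f"
    using riesz_bounded by (auto simp: bounded_operator_def)
  have "N (P f) \<le> (\<bar>K\<bar> + 1) * N f" if "f \<in> L" for f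
  proof -
    have "K * N f \<le> (\<bar>K\<bar> + 1) * N f"
      by (intro mult_right_mono) auto
    then show ?thesis
      using K that by (meson order_trans)
  qed
  then show ?thesis
    by (intro that[of "\<bar>K\<bar> + 1"]) auto
qed

lemma P_diff:
  assumes "f \<in> L" "g \<in> L"
  shows "AE x in m. P (\<lambda>x. f x - g x) x = P f x - P g x"
  using P_add[OF assms(1) Lp_scale(1)[OF assms(2), of "-1"]] P_scale[OF assms(2), of "-1"]
  by (auto elim: AE_mp)

lemma P_null:
  assumes "f \<in> L" "AE x in m. f x = 0"
  shows "AE x in m. P f x = 0"
proof -
  obtain K where K: "\<And>f. f \<in> L \<Longrightarrow> N (P f) \<le> K * N f"
    using P_bound by blast
  have "N f = 0"
    using assms Lp_norm_zero_iff by blast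
  then have "N (P f) = 0"
    using K[OF assms(1)] Lp_norm_nonneg[of "P f"] by simp
  then show ?thesis
    using Lp_norm_zero_iff[OF P_Lp[OF assms(1)]] by blast
qed

lemma P_cong_AE:
  assumes "f \<in> L" "g \<in> L" "AE x in m. f x = g x"
  shows "AE x in m. P f x = P g x"
proof -
  have "AE x in m. P (\<lambda>x. f x - g x) x = 0"
    by (rule P_null) (use assms in \<open>auto intro: Lp_diff\<close>)
  with P_diff[OF assms(1,2)] show ?thesis
    by eventually_elim simp
qed

lemma P_ident:
  assumes "f \<in> H"
  shows "AE x in m. P f x = f x"
proof -
  have "N (\<lambda>x. P f x - f x) = 0"
    using riesz assms by (auto simp: riesz_projection_def fun_diff_def)
  then show ?thesis
    using assms by (subst (asm) Lp_norm_diff_zero_iff) (auto intro: P_Lp Hp_Lp)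
qed

lemma P_character:
  assumes "\<kappa> \<in> characters"
  shows "AE x in m. P \<kappa> x = (if \<kappa> \<in> T then \<kappa> x else 0)"
proof (cases "\<kappa> \<in> T")
  case True
  then show ?thesis
    using P_ident[OF Hp_character] by simp
next
  case False
  have "N (P (\<Sum>\<psi>\<in>{\<kappa>}. cscale 1 \<psi>) - (\<Sum>\<psi>\<in>{\<kappa>} \<inter> T. cscale 1 \<psi>)) = 0"
    using riesz assms unfolding riesz_projection_def by (elim conjE allE[of _ "{\<kappa>}"] allE[of _ "\<lambda>_. 1"]) simp
  then have "N (P \<kappa>) = 0"
    using False by (simp add: cscale_def)
  then show ?thesis
    using False Lp_norm_zero_iff[OF P_Lp[OF characters_Lp[OF assms]]] by simp
qed

text \<open>For characters this is the defining property of P; a function without coefficients lies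
  in H and is fixed by P. The difference of the two sides is additive and bounded by a multiple of
  the norm, which settles limits.\<close>

lemma fourier_P:
  assumes "f \<in> L" "\<kappa> \<in> characters"
  shows "F (P f) \<kappa> = (if \<kappa> \<in> T then F f \<kappa> else 0)"
  using assms(1)
proof (induction rule: Lp_induct)
  case (char \<xi>)
  have "F (P \<xi>) \<kappa> = F (\<lambda>x. if \<xi> \<in> T then \<xi> x else 0) \<kappa>"
  proof (rule fourier_cong_AE[OF _ _ P_character[OF char] assms(2)])
    show "(\<lambda>x. if \<xi> \<in> T then \<xi> x else 0) \<in> borel_measurable m"
      using characters_measurable[OF char] by (cases "\<xi> \<in> T") auto
  qed (rule P_measurable[OF characters_Lp[OF char]])
  then show ?case
    using char assms(2) by (cases "\<xi> \<in> T") (auto simp: fourier_character)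
next
  case (fourier_null f)
  then have "f \<in> H"
    by (simp add: Hp_iff)
  then have "F (P f) \<kappa> = F f \<kappa>"
    by (intro fourier_cong_AE P_ident P_measurable Hp_Lp Hp_measurable assms(2))
  then show ?case
    using fourier_null assms(2) by simp
next
  case (add f g)
  have "F (P (\<lambda>x. f x + g x)) \<kappa> = F (\<lambda>x. P f x + P g x) \<kappa>"
    using add by (intro fourier_cong_AE P_add assms(2))
      (auto intro: Lp_measurable P_Lp Lp_add)
  then show ?case
    using add assms(2) by (simp add: fourier_add P_Lp)
next
  case (scale f c)
  have "F (P (\<lambda>x. c * f x)) \<kappa> = F (\<lambda>x. c * P f x) \<kappa>"
    using scale by (intro fourier_cong_AE P_scale assms(2))
      (auto intro: Lp_measurable P_Lp Lp_scale)
  then show ?case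
    using scale by (simp add: fourier_scale)
next
  case (limit f)
  obtain K where K: "0 < K" "\<And>f. f \<in> L \<Longrightarrow> N (P f) \<le> K * N f"
    using P_bound by blast
  let ?d = "\<lambda>f. F (P f) \<kappa> - (if \<kappa> \<in> T then F f \<kappa> else 0)"
  show ?case
  proof (rule ccontr)
    assume "\<not> ?case"
    \<comment> \<open>Bounds for the difference of the two sides: \<open>2 * K\<close> from the
      coefficient of the projection, 2 from the coefficient of the function itself.\<close>
    then have "0 < cmod (?d f) / (2 * K + 2)"
      using K(1) by simp
    then obtain g where g: "g \<in> L" "?d g = 0" "N (\<lambda>x. f x - g x) < cmod (?d f) / (2 * K + 2)"
      using limit(2) by fastforce
    have fg: "(\<lambda>x. f x - g x) \<in> L"
      using limit(1) g(1) by (intro Lp_diff)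
    have "F (P (\<lambda>x. f x - g x)) \<kappa> = F (\<lambda>x. P f x - P g x) \<kappa>"
      using limit(1) g(1) fg by (intro fourier_cong_AE P_diff assms(2))
        (auto intro: Lp_measurable P_Lp Lp_diff)
    then have "?d f = F (P (\<lambda>x. f x - g x)) \<kappa> - (if \<kappa> \<in> T then F (\<lambda>x. f x - g x) \<kappa> else 0)"
      using g(1,2) limit(1) assms(2) by (simp add: fourier_diff P_Lp split: if_splits)
    then have "cmod (?d f) \<le> cmod (F (P (\<lambda>x. f x - g x)) \<kappa>) + cmod (F (\<lambda>x. f x - g x) \<kappa>)"
      by (auto intro: norm_triangle_ineq4)
    also have "\<dots> \<le> 2 * (K * N (\<lambda>x. f x - g x)) + 2 * N (\<lambda>x. f x - g x)"
      using fourier_bound[OF P_Lp[OF fg] assms(2)] fourier_bound[OF fg assms(2)] K(2)[OF fg] by linarith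
    also have "\<dots> = (2 * K + 2) * N (\<lambda>x. f x - g x)"
      by (simp add: algebra_simps)
    also have "\<dots> < cmod (?d f)"
      using g(3) K(1) by (simp add: field_simps)
    finally show False
      by simp
  qed
qed

text \<open>Whatever P removes stays removable after division by \<phi>: if \<kappa> is outside T,
  so is \<kappa>/\<phi>, because T is a semigroup. Hence Toeplitz operators with symbols
  \<open>inverse \<phi>\<close> compose like their symbols.\<close>

lemma P_inverse_mult_P:
  assumes "f \<in> L" "\<phi> \<in> T"
  shows "AE x in m. P (\<lambda>x. inverse \<phi> x * P f x) x = P (\<lambda>x. inverse \<phi> x * f x) x"
  using assms(1)
proof (induction rule: Lp_induct)
  case (char \<kappa>)
  note i = characters_inverse[OF T_characters[OF assms(2)]]
  show ?case
  proof (cases "\<kappa> \<in> T")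
    case True
    from P_ident[OF Hp_character[OF True]] have "AE x in m. inverse \<phi> x * P \<kappa> x = inverse \<phi> x * \<kappa> x"
      by eventually_elim simp
    from P_cong_AE[OF Lp_mult_character(1)[OF _ i] Lp_mult_character(1)[OF _ i] this] char show ?thesis
      by (simp add: P_Lp characters_Lp)
  next
    case False
    have "inverse \<phi> * \<kappa> \<notin> T"
    proof
      assume "inverse \<phi> * \<kappa> \<in> T"
      then have "inverse \<phi> * \<kappa> * \<phi> \<in> T"
        using assms(2) T_mult by blast
      moreover have "inverse \<phi> * \<kappa> * \<phi> = \<kappa>"
        using characters_nonzero[OF T_characters[OF assms(2)]] by (simp add: fun_eq_iff)
      ultimately show False
        using False by simp
    qed
    moreover have "inverse \<phi> * \<kappa> \<in> characters"
      using i char by (rule characters_mult)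
    ultimately have null: "AE x in m. P (\<lambda>x. inverse \<phi> x * \<kappa> x) x = 0"
      using P_character[of "inverse \<phi> * \<kappa>"] by (simp add: times_fun_def)
    have "AE x in m. P \<kappa> x = 0"
      using P_character[OF char] False by simp
    then have "AE x in m. inverse \<phi> x * P \<kappa> x = 0"
      by eventually_elim simp
    from P_null[OF Lp_mult_character(1)[OF P_Lp[OF characters_Lp[OF char]] i] this] null show ?thesis
      by eventually_elim simp
  qed
next
  case (fourier_null f)
  note i = characters_inverse[OF T_characters[OF assms(2)]]
  from fourier_null have "f \<in> H"
    by (simp add: Hp_iff)
  from P_ident[OF this] have "AE x in m. inverse \<phi> x * P f x = inverse \<phi> x * f x"
    by eventually_elim simp
  from P_cong_AE[OF Lp_mult_character(1)[OF _ i] Lp_mult_character(1)[OF _ i] this] fourier_null(1)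
  show ?case
    by (simp add: P_Lp)
next
  case (add f g)
  note i = Lp_mult_character(1)[OF _ characters_inverse[OF T_characters[OF assms(2)]]]
  from P_add[OF add(1,2)] have "AE x in m. inverse \<phi> x * P (\<lambda>x. f x + g x) x = inverse \<phi> x * P f x + inverse \<phi> x * P g x"
    by eventually_elim (simp add: ring_distribs)
  from P_cong_AE[OF i Lp_add(1)[OF i i] this]
  have "AE x in m. P (\<lambda>x. inverse \<phi> x * P (\<lambda>x. f x + g x) x) x = P (\<lambda>x. inverse \<phi> x * P f x + inverse \<phi> x * P g x) x"
    using add(1,2) by (simp add: P_Lp Lp_add)
  moreover have "AE x in m. P (\<lambda>x. inverse \<phi> x * P f x + inverse \<phi> x * P g x) x
    = P (\<lambda>x. inverse \<phi> x * P f x) x + P (\<lambda>x. inverse \<phi> x * P g x) x"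
    by (rule P_add[OF i[OF P_Lp[OF add(1)]] i[OF P_Lp[OF add(2)]]])
  moreover have "AE x in m. P (\<lambda>x. inverse \<phi> x * f x + inverse \<phi> x * g x) x
    = P (\<lambda>x. inverse \<phi> x * f x) x + P (\<lambda>x. inverse \<phi> x * g x) x"
    by (rule P_add[OF i[OF add(1)] i[OF add(2)]])
  ultimately show ?case
    using add(3,4) by eventually_elim (simp add: ring_distribs)
next
  case (scale f c)
  note i = Lp_mult_character(1)[OF _ characters_inverse[OF T_characters[OF assms(2)]]]
  from P_scale[OF scale(1), of c] have "AE x in m. inverse \<phi> x * P (\<lambda>x. c * f x) x = c * (inverse \<phi> x * P f x)"
    by eventually_elim simp
  from P_cong_AE[OF i Lp_scale(1)[OF i] this]
  have "AE x in m. P (\<lambda>x. inverse \<phi> x * P (\<lambda>x. c * f x) x) x = P (\<lambda>x. c * (inverse \<phi> x * P f x)) x"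
    using scale(1) by (simp add: P_Lp Lp_scale)
  moreover have "AE x in m. P (\<lambda>x. c * (inverse \<phi> x * P f x)) x = c * P (\<lambda>x. inverse \<phi> x * P f x) x"
    by (rule P_scale[OF i[OF P_Lp[OF scale(1)]]])
  moreover have "AE x in m. P (\<lambda>x. c * (inverse \<phi> x * f x)) x = c * P (\<lambda>x. inverse \<phi> x * f x) x"
    by (rule P_scale[OF i[OF scale(1)]])
  ultimately show ?case
    using scale(2) by eventually_elim (simp add: mult.left_commute)
next
  case (limit f)
  note ic = characters_inverse[OF T_characters[OF assms(2)]]
  note i = Lp_mult_character(1)[OF _ ic]
  obtain K where K: "0 < K" "\<And>f. f \<in> L \<Longrightarrow> N (P f) \<le> K * N f"
    using P_bound by blast
  let ?D = "\<lambda>f x. P (\<lambda>x. inverse \<phi> x * P f x) x - P (\<lambda>x. inverse \<phi> x * f x) x"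
  \<comment> \<open>K * K bounds the side with two projections, K the side with one, and 4 is the
    quasi-triangle constant.\<close>
  define B where "B = 4 * (K * K + K)"
  have DL: "?D f \<in> L" if "f \<in> L" for f
    using that by (intro Lp_diff P_Lp i)
  have Dbound: "N (?D f) \<le> B * N f" if f: "f \<in> L" for f
  proof -
    have "N (P (\<lambda>x. inverse \<phi> x * P f x)) \<le> K * N (\<lambda>x. inverse \<phi> x * P f x)"
      by (intro K(2) i P_Lp f)
    also have "\<dots> \<le> K * (K * N f)"
      using Lp_mult_character(2)[OF P_Lp[OF f] ic] K(1) K(2)[OF f] by (intro mult_left_mono) linarith+
    finally have 1: "N (P (\<lambda>x. inverse \<phi> x * P f x)) \<le> K * (K * N f)" .
    have "N (P (\<lambda>x. inverse \<phi> x * f x)) \<le> K * N (\<lambda>x. inverse \<phi> x * f x)"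
      by (intro K(2) i f)
    also have "\<dots> \<le> K * N f"
      using Lp_mult_character(2)[OF f ic] K(1) by (intro mult_left_mono) auto
    finally have 2: "N (P (\<lambda>x. inverse \<phi> x * f x)) \<le> K * N f" .
    have "N (?D f) \<le> 4 * (N (P (\<lambda>x. inverse \<phi> x * P f x)) + N (P (\<lambda>x. inverse \<phi> x * f x)))"
      by (intro Lp_diff P_Lp i f)
    also have "\<dots> \<le> 4 * (K * (K * N f) + K * N f)"
      using 1 2 by (intro mult_left_mono add_mono) auto
    finally show ?thesis
      by (simp add: B_def algebra_simps)
  qed
  have Bpos: "0 < B"
    using K(1) by (simp add: B_def add_pos_pos)
  have "N (?D f) = 0"
  proof (rule ccontr)
    assume "N (?D f) \<noteq> 0"
    then have "0 < N (?D f) / B"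
      using Bpos Lp_norm_nonneg[of "?D f"] by (simp add: less_le)
    then obtain g where g: "g \<in> L" "AE x in m. P (\<lambda>x. inverse \<phi> x * P g x) x = P (\<lambda>x. inverse \<phi> x * g x) x"
      "N (\<lambda>x. f x - g x) < N (?D f) / B"
      using limit(2) by blast
    note fg = Lp_diff(1)[OF limit(1) g(1)]
    have "AE x in m. inverse \<phi> x * P (\<lambda>x. f x - g x) x = inverse \<phi> x * P f x - inverse \<phi> x * P g x"
      using P_diff[OF limit(1) g(1)] by eventually_elim (simp add: right_diff_distrib)
    from P_cong_AE[OF i[OF P_Lp[OF fg]] Lp_diff(1)[OF i[OF P_Lp[OF limit(1)]] i[OF P_Lp[OF g(1)]]] this]
      P_diff[OF i[OF P_Lp[OF limit(1)]] i[OF P_Lp[OF g(1)]]]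
      P_diff[OF i[OF limit(1)] i[OF g(1)]] g(2)
    have "AE x in m. ?D (\<lambda>x. f x - g x) x = ?D f x"
      by eventually_elim (simp add: right_diff_distrib)
    then have "N (?D (\<lambda>x. f x - g x)) = N (?D f)"
      by (rule Lp_norm_cong_AE[rotated 2]) (rule Lp_measurable[OF DL[OF fg]] Lp_measurable[OF DL[OF limit(1)]])+
    then have "N (?D f) \<le> B * N (\<lambda>x. f x - g x)"
      using Dbound[OF fg] by simp
    also have "\<dots> < N (?D f)"
      using g(3) Bpos by (simp add: field_simps)
    finally show False
      by simp
  qed
  then show ?case
    using Lp_norm_diff_zero_iff[OF P_Lp[OF i[OF P_Lp[OF limit(1)]]] P_Lp[OF i[OF limit(1)]]] by simp
qed

end

section \<open>Toeplitz operators modulo null functions\<close>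

lemma sum_cscale_apply: "(\<Sum>h\<in>M. cscale (c h) h) x = (\<Sum>h\<in>M. c h * h x)"
  by (induction M rule: infinite_finite_induct) (simp_all add: cscale_def)

context riesz_setting
begin

section \<open>Operator notions restated with almost everywhere identities\<close>

lemma bounded_operatorI:
  assumes "\<And>f. f \<in> H \<Longrightarrow> B f \<in> H"
    and "\<And>f g. f \<in> H \<Longrightarrow> g \<in> H \<Longrightarrow> AE x in m. B (\<lambda>x. f x + g x) x = B f x + B g x"
    and "\<And>c f. f \<in> H \<Longrightarrow> AE x in m. B (\<lambda>x. c * f x) x = c * B f x"
    and "\<And>f. f \<in> H \<Longrightarrow> N (B f) \<le> K * N f"
  shows "bounded_operator N H H B"
proof -
  have "N (B (f + g) - (B f + B g)) = 0" if "f \<in> H" "g \<in> H" for f g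
    using assms(1,2) that
    by (simp add: plus_fun_def fun_diff_def Lp_norm_diff_zero_iff Hp_Lp Hp_add)
  moreover have "N (B (cscale c f) - cscale c (B f)) = 0" if "f \<in> H" for c f
    using assms(1,3) that
    by (simp add: cscale_def fun_diff_def Lp_norm_diff_zero_iff Hp_Lp Hp_scale)
  ultimately show ?thesis
    using assms(1,4) unfolding bounded_operator_def by blast
qed

lemma bounded_operator_Hp: "bounded_operator N H H B \<Longrightarrow> f \<in> H \<Longrightarrow> B f \<in> H"
  by (simp add: bounded_operator_def)

lemma Lp_norm_fun_diff_zero_iff:
  assumes "f \<in> H" "g \<in> H"
  shows "N (f - g) = 0 \<longleftrightarrow> (AE x in m. f x = g x)"
  using Lp_norm_diff_zero_iff[OF Hp_Lp Hp_Lp, OF assms] by (simp add: fun_diff_def)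

lemma invertible_operatorI:
  assumes "bounded_operator N H H A" "bounded_operator N H H B"
    and "\<And>f. f \<in> H \<Longrightarrow> AE x in m. A (B f) x = f x" "\<And>f. f \<in> H \<Longrightarrow> AE x in m. B (A f) x = f x"
  shows "invertible_operator N H A"
  unfolding invertible_operator_def
  using assms bounded_operator_Hp[OF assms(1)] bounded_operator_Hp[OF assms(2)]
  by (auto simp: Lp_norm_fun_diff_zero_iff)

lemma invertible_operator_onto:
  assumes "invertible_operator N H A" "h \<in> H"
  shows "\<exists>g\<in>H. AE x in m. A g x = h x"
proof -
  obtain B where "bounded_operator N H H A" "bounded_operator N H H B" "N (A (B h) - h) = 0"
    using assms by (auto simp: invertible_operator_def)
  then show ?thesis
    using assms(2) by (auto simp: Lp_norm_fun_diff_zero_iff bounded_operator_Hp)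
qed

lemma invertible_operator_injective:
  assumes "invertible_operator N H A" "f \<in> H" "AE x in m. A f x = 0"
  shows "AE x in m. f x = 0"
proof -
  obtain B where A: "bounded_operator N H H A" and B: "bounded_operator N H H B" and 0: "N (B (A f) - f) = 0"
    using assms(1,2) by (auto simp: invertible_operator_def)
  note mem = bounded_operator_Hp[OF A assms(2)] bounded_operator_Hp[OF B bounded_operator_Hp[OF A assms(2)]]
  obtain K where "N (B (A f)) \<le> K * N (A f)"
    using B mem(1) by (auto simp: bounded_operator_def)
  moreover have "N (A f) = 0"
    using assms(3) Lp_norm_zero_iff[OF Hp_Lp[OF mem(1)]] by simp
  ultimately have "N (B (A f)) = 0"
    using Lp_norm_nonneg[of "B (A f)"] by simp
  then have "AE x in m. B (A f) x = 0"
    using Lp_norm_zero_iff[OF Hp_Lp[OF mem(2)]] by simp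
  moreover have "AE x in m. B (A f) x = f x"
    using 0 mem(2) assms(2) by (simp add: Lp_norm_fun_diff_zero_iff)
  ultimately show ?thesis
    by eventually_elim simp
qed

lemma fredholm_operatorI:
  assumes "bounded_operator N H H A"
    and closed: "\<And>f. f \<in> H \<Longrightarrow> (\<And>\<epsilon>. 0 < \<epsilon> \<Longrightarrow> \<exists>g\<in>H. N (\<lambda>x. f x - A g x) < \<epsilon>) \<Longrightarrow> \<exists>g\<in>H. AE x in m. f x = A g x"
    and kernel: "finite M" "M \<subseteq> H"
      "\<And>f. f \<in> H \<Longrightarrow> AE x in m. A f x = 0 \<Longrightarrow> \<exists>c. AE x in m. f x = (\<Sum>h\<in>M. c h * h x)"
    and cokernel: "finite M'" "M' \<subseteq> H"
      "\<And>f. f \<in> H \<Longrightarrow> \<exists>g\<in>H. \<exists>c. AE x in m. f x = A g x + (\<Sum>h\<in>M'. c h * h x)"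
  shows "fredholm_operator N H A"
proof -
  note A = bounded_operator_Hp[OF assms(1)]
  have sum_eq: "(\<Sum>h\<in>S. cscale (c h) h) = (\<lambda>x. \<Sum>h\<in>S. c h * h x)" for S c
    by (simp add: fun_eq_iff sum_cscale_apply)
  have sum_H: "(\<lambda>x. \<Sum>h\<in>S. c h * h x) \<in> H" if "S \<subseteq> H" for S c
    using that by (intro Hp_sum Hp_scale) auto
  have c1: "\<exists>g\<in>H. N (f - A g) = 0" if f: "f \<in> H" and lim: "\<forall>\<epsilon>>0. \<exists>g\<in>H. N (f - A g) < \<epsilon>" for f
  proof -
    obtain g where g: "g \<in> H" "AE x in m. f x = A g x"
      using closed[OF f] lim unfolding fun_diff_def by blast
    then show ?thesis
      using Lp_norm_fun_diff_zero_iff[OF f A[OF g(1)]] by blast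
  qed
  have c2: "\<exists>c. N (f - (\<Sum>h\<in>M. cscale (c h) h)) = 0" if f: "f \<in> H" and null: "N (A f) = 0" for f
  proof -
    obtain c where "AE x in m. f x = (\<Sum>h\<in>M. c h * h x)"
      using kernel(3)[OF f] null Lp_norm_zero_iff[OF Hp_Lp[OF A[OF f]]] by blast
    then show ?thesis
      unfolding sum_eq using Lp_norm_fun_diff_zero_iff[OF f sum_H[OF kernel(2)]] by blast
  qed
  have c3: "\<exists>g\<in>H. \<exists>c. N (f - (A g + (\<Sum>h\<in>M'. cscale (c h) h))) = 0" if f: "f \<in> H" for f
  proof -
    obtain g c where g: "g \<in> H" "AE x in m. f x = A g x + (\<Sum>h\<in>M'. c h * h x)"
      using cokernel(3)[OF f] by blast
    then show ?thesis
      unfolding sum_eq plus_fun_def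
      using Lp_norm_fun_diff_zero_iff[OF f Hp_add[OF A[OF g(1)] sum_H[OF cokernel(2)]]] by blast
  qed
  show ?thesis
    unfolding fredholm_operator_def
  proof (intro conjI assms(1))
    show "\<forall>f\<in>H. (\<forall>\<epsilon>>0. \<exists>g\<in>H. N (f - A g) < \<epsilon>) \<longrightarrow> (\<exists>g\<in>H. N (f - A g) = 0)"
      by (intro ballI impI c1)
    show "\<exists>F. finite F \<and> F \<subseteq> H \<and> (\<forall>f\<in>H. N (A f) = 0 \<longrightarrow> (\<exists>c. N (f - (\<Sum>h\<in>F. cscale (c h) h)) = 0))"
      by (intro exI[of _ M] conjI ballI impI kernel(1,2) c2)
    show "\<exists>F. finite F \<and> F \<subseteq> H \<and>
        (\<forall>f\<in>H. \<exists>g\<in>H. \<exists>c. N (f - (A g + (\<Sum>h\<in>F. cscale (c h) h))) = 0)"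
      by (intro exI[of _ M'] conjI ballI cokernel(1,2) c3)
  qed
qed

lemma fredholm_operator_of_onto:
  assumes "bounded_operator N H H A" and "\<And>f. f \<in> H \<Longrightarrow> \<exists>g\<in>H. AE x in m. A g x = f x"
    and "finite M" "M \<subseteq> H"
      "\<And>f. f \<in> H \<Longrightarrow> AE x in m. A f x = 0 \<Longrightarrow> \<exists>c. AE x in m. f x = (\<Sum>h\<in>M. c h * h x)"
  shows "fredholm_operator N H A"
proof -
  have onto: "\<exists>g\<in>H. AE x in m. f x = A g x" if f: "f \<in> H" for f
  proof -
    obtain g where g: "g \<in> H" "AE x in m. A g x = f x"
      using assms(2)[OF f] by blast
    from g(2) have "AE x in m. f x = A g x"
      by eventually_elim simp
    then show ?thesis
      using g(1) by blast
  qed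
  show ?thesis
    by (rule fredholm_operatorI[OF assms(1) _ assms(3-5), of "{}"]) (use onto in simp_all)
qed

lemma fredholm_operator_of_invertible:
  assumes "invertible_operator N H A"
  shows "fredholm_operator N H A"
  using assms invertible_operator_onto[OF assms] invertible_operator_injective[OF assms]
  by (intro fredholm_operator_of_onto[where M="{}"]) (auto simp: invertible_operator_def)

lemma fredholm_operator_closed_range:
  assumes "fredholm_operator N H A" "f \<in> H" "\<And>\<epsilon>. 0 < \<epsilon> \<Longrightarrow> \<exists>g\<in>H. N (\<lambda>x. f x - A g x) < \<epsilon>"
  shows "\<exists>g\<in>H. AE x in m. A g x = f x"
proof -
  obtain g where g: "g \<in> H" "N (f - A g) = 0"
    using assms unfolding fredholm_operator_def fun_diff_def by blast
  have "A g \<in> H"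
    using assms(1) g(1) by (auto simp: fredholm_operator_def intro: bounded_operator_Hp)
  then have "AE x in m. f x = A g x"
    using g(2) assms(2) by (simp add: Lp_norm_fun_diff_zero_iff)
  then have "AE x in m. A g x = f x"
    by eventually_elim simp
  then show ?thesis
    using g(1) by blast
qed

lemma fredholm_operator_kernel:
  assumes "fredholm_operator N H A"
  obtains M where "finite M" "M \<subseteq> H"
    "\<And>f. f \<in> H \<Longrightarrow> AE x in m. A f x = 0 \<Longrightarrow> \<exists>c. AE x in m. f x = (\<Sum>h\<in>M. c h * h x)"
proof -
  have "\<exists>M. finite M \<and> M \<subseteq> H \<and> (\<forall>f\<in>H. N (A f) = 0 \<longrightarrow> (\<exists>c. N (f - (\<Sum>h\<in>M. cscale (c h) h)) = 0))"
    using assms unfolding fredholm_operator_def by (elim conjE)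
  then obtain M where M: "finite M" "M \<subseteq> H"
    "\<And>f. f \<in> H \<Longrightarrow> N (A f) = 0 \<Longrightarrow> \<exists>c. N (f - (\<Sum>h\<in>M. cscale (c h) h)) = 0"
    by auto
  have A: "A f \<in> L" if "f \<in> H" for f
    using assms that by (auto simp: fredholm_operator_def intro: Hp_Lp bounded_operator_Hp)
  have sum_eq: "(\<Sum>h\<in>M. cscale (c h) h) = (\<lambda>x. \<Sum>h\<in>M. c h * h x)" for c
    by (simp add: fun_eq_iff sum_cscale_apply)
  have sum_H: "(\<lambda>x. \<Sum>h\<in>M. c h * h x) \<in> H" for c
    using M(2) by (intro Hp_sum Hp_scale) auto
  have "\<exists>c. AE x in m. f x = (\<Sum>h\<in>M. c h * h x)" if "f \<in> H" "AE x in m. A f x = 0" for f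
    using M(3)[OF that(1)] that(2) Lp_norm_zero_iff[OF A[OF that(1)]]
      Lp_norm_fun_diff_zero_iff[OF that(1) sum_H] unfolding sum_eq by blast
  then show ?thesis
    using that M(1,2) by blast
qed

lemma fredholm_operator_cokernel:
  assumes "fredholm_operator N H A"
  obtains M where "finite M" "M \<subseteq> H"
    "\<And>f. f \<in> H \<Longrightarrow> \<exists>g\<in>H. \<exists>c. AE x in m. f x = A g x + (\<Sum>h\<in>M. c h * h x)"
proof -
  have "\<exists>M. finite M \<and> M \<subseteq> H \<and>
      (\<forall>f\<in>H. \<exists>g\<in>H. \<exists>c. N (f - (A g + (\<Sum>h\<in>M. cscale (c h) h))) = 0)"
    using assms unfolding fredholm_operator_def by (elim conjE)
  then obtain M where M: "finite M" "M \<subseteq> H"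
    "\<And>f. f \<in> H \<Longrightarrow> \<exists>g\<in>H. \<exists>c. N (f - (A g + (\<Sum>h\<in>M. cscale (c h) h))) = 0"
    by auto
  have A: "A f \<in> H" if "f \<in> H" for f
    using assms that by (auto simp: fredholm_operator_def intro: bounded_operator_Hp)
  have sum_eq: "(\<Sum>h\<in>M. cscale (c h) h) = (\<lambda>x. \<Sum>h\<in>M. c h * h x)" for c
    by (simp add: fun_eq_iff sum_cscale_apply)
  have sum_H: "(\<lambda>x. \<Sum>h\<in>M. c h * h x) \<in> H" for c
    using M(2) by (intro Hp_sum Hp_scale) auto
  have "\<exists>g\<in>H. \<exists>c. AE x in m. f x = A g x + (\<Sum>h\<in>M. c h * h x)" if f: "f \<in> H" for f
  proof -
    obtain g c where g: "g \<in> H" "N (f - (A g + (\<Sum>h\<in>M. cscale (c h) h))) = 0"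
      using M(3)[OF f] by blast
    then show ?thesis
      unfolding sum_eq plus_fun_def
      using Lp_norm_fun_diff_zero_iff[OF f Hp_add[OF A[OF g(1)] sum_H]] by blast
  qed
  then show ?thesis
    using that M(1,2) by blast
qed

section \<open>The operators T_\<psi> - z and their explicit forms\<close>

definition toeplitz_minus :: "('g \<Rightarrow> complex) \<Rightarrow> complex \<Rightarrow> ('g \<Rightarrow> complex) \<Rightarrow> 'g \<Rightarrow> complex" where
  "toeplitz_minus \<psi> z = (\<lambda>f. toeplitz P \<psi> f - cscale z f)"

lemma toeplitz_minus_eq: "toeplitz_minus \<psi> z f = (\<lambda>x. P (\<lambda>x. \<psi> x * f x) x - z * f x)"
  by (simp add: toeplitz_minus_def toeplitz_def times_fun_def cscale_def fun_diff_def)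

lemma toeplitz_minus_Hp:
  assumes "\<psi> \<in> characters" "f \<in> H"
  shows "toeplitz_minus \<psi> z f \<in> H"
  unfolding toeplitz_minus_eq using assms by (intro Hp_diff Hp_scale P_Hp Lp_mult_character Hp_Lp)

lemma toeplitz_minus_bounded:
  assumes \<psi>: "\<psi> \<in> characters"
  shows "bounded_operator N H H (toeplitz_minus \<psi> z)"
proof -
  obtain K where K: "0 < K" "\<And>f. f \<in> L \<Longrightarrow> N (P f) \<le> K * N f"
    using P_bound by blast
  note i = Lp_mult_character(1)[OF Hp_Lp \<psi>]
  show ?thesis
  proof (rule bounded_operatorI[where K="4 * (K + cmod z)"])
    show "toeplitz_minus \<psi> z f \<in> H" if "f \<in> H" for f
      using toeplitz_minus_Hp \<psi> that by blast
    show "AE x in m. toeplitz_minus \<psi> z (\<lambda>x. f x + g x) x = toeplitz_minus \<psi> z f x + toeplitz_minus \<psi> z g x" if "f \<in> H" "g \<in> H" for f g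
      using P_add[OF i i, OF that] unfolding toeplitz_minus_eq ring_distribs(1) by eventually_elim simp
    show "AE x in m. toeplitz_minus \<psi> z (\<lambda>x. c * f x) x = c * toeplitz_minus \<psi> z f x" if "f \<in> H" for c f
      using P_scale[OF i, OF that, of c] unfolding toeplitz_minus_eq mult.left_commute[of "\<psi> _" c]
      by eventually_elim (simp add: algebra_simps)
    show "N (toeplitz_minus \<psi> z f) \<le> 4 * (K + cmod z) * N f" if f: "f \<in> H" for f
    proof -
      have "N (toeplitz_minus \<psi> z f) \<le> 4 * (N (P (\<lambda>x. \<psi> x * f x)) + N (\<lambda>x. z * f x))"
        unfolding toeplitz_minus_eq by (intro Lp_diff P_Lp i Lp_scale Hp_Lp f)
      also have "\<dots> \<le> 4 * (K * N f + cmod z * N f)"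
      proof (intro mult_left_mono add_mono)
        have "N (P (\<lambda>x. \<psi> x * f x)) \<le> K * N (\<lambda>x. \<psi> x * f x)"
          by (intro K(2) i f)
        also have "\<dots> \<le> K * N f"
          using Lp_mult_character(2)[OF Hp_Lp[OF f] \<psi>] K(1) by (intro mult_left_mono) auto
        finally show "N (P (\<lambda>x. \<psi> x * f x)) \<le> K * N f" .
        show "N (\<lambda>x. z * f x) \<le> cmod z * N f"
          using Lp_scale(2)[OF Hp_Lp[OF f]] by simp
      qed simp
      finally show ?thesis
        by (simp add: algebra_simps)
    qed
  qed
qed

text \<open>The product \<phi> f is already in H, where P is the identity.\<close>

lemma toeplitz_minus_positive:
  assumes "\<phi> \<in> T" "f \<in> H"
  shows "AE x in m. toeplitz_minus \<phi> z f x = (\<phi> x - z) * f x"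
  using P_ident[OF Hp_mult_character[OF assms(2,1)]] unfolding toeplitz_minus_eq
  by eventually_elim (simp add: left_diff_distrib)

text \<open>Factor 1/\<phi> - z = (1/\<phi>) (1 - z\<phi>). The second factor maps H into itself and
  is invertible there for |z| < 1, so inside the disc the operator behaves like the one for z =
  0.\<close>

lemma toeplitz_minus_negative:
  assumes "\<phi> \<in> T" "f \<in> H"
  shows "AE x in m. toeplitz_minus (inverse \<phi>) z f x = P (\<lambda>x. inverse \<phi> x * ((1 - z * \<phi> x) * f x)) x"
proof -
  note \<phi> = T_characters[OF assms(1)]
  have eq: "inverse \<phi> x * ((1 - z * \<phi> x) * f x) = inverse \<phi> x * f x - z * f x" for x
    using characters_nonzero[OF \<phi>, of x] by (simp add: field_simps)
  have "AE x in m. P (\<lambda>x. inverse \<phi> x * f x - z * f x) x = P (\<lambda>x. inverse \<phi> x * f x) x - P (\<lambda>x. z * f x) x"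
    using assms by (intro P_diff Lp_mult_character characters_inverse \<phi> Lp_scale Hp_Lp)
  moreover have "AE x in m. P (\<lambda>x. z * f x) x = z * f x"
    by (intro P_ident Hp_scale assms)
  ultimately show ?thesis
    unfolding toeplitz_minus_eq eq by eventually_elim simp
qed

lemma P_inverse_mult_cancel:
  assumes "\<phi> \<in> T" "f \<in> H"
  shows "AE x in m. P (\<lambda>x. inverse \<phi> x * (\<phi> x * f x)) x = f x"
proof -
  have "(\<lambda>x. inverse \<phi> x * (\<phi> x * f x)) = f"
    using characters_nonzero[OF T_characters[OF assms(1)]] by (simp add: fun_eq_iff)
  then show ?thesis
    using P_ident[OF assms(2)] by (simp only:)
qed

end

section \<open>Resolvents off the unit circle\<close>

text \<open>Iterating the step gives |a i| \<le> q^n B for every n. The chain of indices may go on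
  forever inside S, which is what happens for a non-archimedean order.\<close>

lemma geometric_decay_zero:
  fixes a :: "'a \<Rightarrow> complex"
  assumes q: "0 \<le> q" "q < 1"
    and bound: "\<And>i. i \<in> S \<Longrightarrow> cmod (a i) \<le> B"
    and step: "\<And>i. i \<in> S \<Longrightarrow> a i = 0 \<or> (\<exists>j\<in>S. cmod (a i) \<le> q * cmod (a j))"
    and "i \<in> S"
  shows "a i = 0"
proof -
  have B: "0 \<le> B"
    using bound[OF \<open>i \<in> S\<close>] norm_ge_zero[of "a i"] by linarith
  have "\<forall>i\<in>S. cmod (a i) \<le> q ^ n * B" for n
  proof (induction n)
    case 0
    then show ?case
      using bound by simp
  next
    case (Suc n)
    show ?case
    proof
      fix i assume "i \<in> S"
      from step[OF this] show "cmod (a i) \<le> q ^ Suc n * B"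
      proof
        assume "a i = 0"
        then show ?thesis
          using q B by simp
      next
        assume "\<exists>j\<in>S. cmod (a i) \<le> q * cmod (a j)"
        then obtain j where j: "j \<in> S" "cmod (a i) \<le> q * cmod (a j)"
          by blast
        have "q * cmod (a j) \<le> q * (q ^ n * B)"
          using Suc j(1) q by (intro mult_left_mono) auto
        then show ?thesis
          using j(2) by (simp add: mult.assoc)
      qed
    qed
  qed
  then have "cmod (a i) \<le> q ^ n * B" for n
    using \<open>i \<in> S\<close> by blast
  moreover have "(\<lambda>n. q ^ n * B) \<longlonglongrightarrow> 0 * B"
    using q by (intro tendsto_mult LIMSEQ_realpow_zero tendsto_const)
  ultimately have "cmod (a i) \<le> 0 * B"
    by (intro LIMSEQ_le_const) auto
  then show ?thesis
    by simp
qed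

text \<open>More indices than elements of M would place card M + 1 independent unit vectors in a
  span of card M vectors. It turns a finite-dimensional kernel or cokernel into finiteness of an
  index set.\<close>

lemma finite_biorthogonal:
  fixes a :: "'v \<Rightarrow> 'i \<Rightarrow> complex"
  assumes "finite M"
    and "\<And>i. i \<in> I \<Longrightarrow> \<exists>c. \<forall>j\<in>I. (\<Sum>h\<in>M. c h * a h j) = (if i = j then 1 else 0)"
  shows "finite I"
proof (rule ccontr)
  assume "infinite I"
  then obtain E where E: "E \<subseteq> I" "finite E" "card E = Suc (card M)"
    using infinite_arbitrarily_large by blast
  interpret V: vector_space "cscale :: complex \<Rightarrow> ('i \<Rightarrow> complex) \<Rightarrow> 'i \<Rightarrow> complex"
    by standard (auto simp: cscale_def fun_eq_iff algebra_simps)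
  \<comment> \<open>The hypothesis says nothing about \<open>a h j\<close> for j outside I; cutting
    off outside E makes it an identity of functions.\<close>
  define b where "b h = (\<lambda>j. if j \<in> E then a h j else 0)" for h
  define e :: "'i \<Rightarrow> 'i \<Rightarrow> complex" where "e i = (\<lambda>j. if i = j then 1 else 0)" for i
  have inj: "inj e"
    by (auto simp: inj_def e_def fun_eq_iff split: if_splits)
  have "e i \<in> V.span (b ` M)" if i: "i \<in> E" for i
  proof -
    obtain c where c: "\<forall>j\<in>I. (\<Sum>h\<in>M. c h * a h j) = (if i = j then 1 else 0)"
      using assms(2) i E(1) by blast
    have "e i = (\<Sum>h\<in>M. cscale (c h) (b h))"
    proof
      fix j
      have "(\<Sum>h\<in>M. cscale (c h) (b h)) j = (\<Sum>h\<in>M. c h * b h j)"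
        using assms(1) by (induction M) (auto simp: cscale_def)
      also have "\<dots> = e i j"
        using c E(1) i by (cases "j \<in> E") (auto simp: b_def e_def)
      finally show "e i j = (\<Sum>h\<in>M. cscale (c h) (b h)) j" ..
    qed
    also have "\<dots> \<in> V.span (b ` M)"
      by (intro V.span_sum V.span_scale V.span_base) auto
    finally show ?thesis .
  qed
  then have "e ` E \<subseteq> V.span (b ` M)"
    by blast
  moreover have "V.independent (e ` E)"
  proof -
    have "u (e j) = 0" if u: "(\<Sum>v\<in>e ` E. cscale (u v) v) = 0" and j: "j \<in> E" for u j
    proof -
      have "0 = (\<Sum>v\<in>e ` E. cscale (u v) v) j"
        using u by simp
      also have "\<dots> = (\<Sum>v\<in>e ` E. u v * v j)"
        by (rule sum_cscale_apply)
      also have "\<dots> = (\<Sum>i\<in>E. u (e i) * e i j)"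
        using inj by (subst sum.reindex) (auto simp: inj_on_def inj_def)
      also have "\<dots> = (\<Sum>i\<in>E. if i = j then u (e i) else 0)"
        by (rule sum.cong) (auto simp: e_def)
      also have "\<dots> = u (e j)"
        using E(2) j by simp
      finally show ?thesis ..
    qed
    then show ?thesis
      using E(2) by (subst V.dependent_finite) auto
  qed
  ultimately have "card (e ` E) \<le> card (b ` M)"
    using V.independent_span_bound[of "b ` M" "e ` E"] assms(1) by blast
  then have "card E \<le> card M"
    using card_image[of e E] inj card_image_le[OF assms(1), of b] by (metis inj_on_subset le_trans subset_UNIV)
  then show False
    using E(3) by simp
qed

context haar_Lp
begin

lemma resolvent_denominator:
  assumes "\<phi> \<in> characters" "cmod c \<noteq> 1"
  shows "\<bar>1 - cmod c\<bar> \<le> cmod (\<phi> x - c)" "\<phi> x \<noteq> c" "0 < \<bar>1 - cmod c\<bar>"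
  using norm_triangle_ineq3[of "\<phi> x" c] assms by (auto simp: characters_norm)

lemma resolvent_Lp:
  assumes \<phi>: "\<phi> \<in> characters" and c: "cmod c \<noteq> 1" and f: "f \<in> L"
  shows "(\<lambda>x. f x / (\<phi> x - c)) \<in> L" "N (\<lambda>x. f x / (\<phi> x - c)) \<le> N f / \<bar>1 - cmod c\<bar>"
proof -
  note d = resolvent_denominator[OF \<phi> c]
  have meas: "(\<lambda>x. 1 / (\<phi> x - c)) \<in> borel_measurable m"
    using d(2) by (intro continuous_measurable continuous_intros characters_continuous \<phi>) auto
  have bd: "cmod (1 / (\<phi> x - c)) \<le> 1 / \<bar>1 - cmod c\<bar>" for x
    using d(1)[of x] d(3) by (simp add: norm_divide frac_le)
  show "(\<lambda>x. f x / (\<phi> x - c)) \<in> L" "N (\<lambda>x. f x / (\<phi> x - c)) \<le> N f / \<bar>1 - cmod c\<bar>"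
    using Lp_mult_bounded[OF f meas bd] by simp_all
qed

text \<open>Coefficients are compared in f = \<phi> u - c u for the quotient u. This recursion
  drives all arguments off the circle.\<close>

lemma resolvent_fourier:
  assumes \<phi>: "\<phi> \<in> characters" and c: "cmod c \<noteq> 1" and f: "f \<in> L" and \<kappa>: "\<kappa> \<in> characters"
  shows "F (\<lambda>x. f x / (\<phi> x - c)) (\<kappa> * inverse \<phi>) = c * F (\<lambda>x. f x / (\<phi> x - c)) \<kappa> + F f \<kappa>"
proof -
  let ?u = "\<lambda>x. f x / (\<phi> x - c)"
  note u = resolvent_Lp(1)[OF \<phi> c f]
  have "f = (\<lambda>x. \<phi> x * ?u x - c * ?u x)"
    using resolvent_denominator(2)[OF \<phi> c] by (simp add: fun_eq_iff flip: left_diff_distrib diff_divide_distrib)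
  then have "F f \<kappa> = F (\<lambda>x. \<phi> x * ?u x - c * ?u x) \<kappa>"
    by metis
  also have "\<dots> = F (\<lambda>x. \<phi> x * ?u x) \<kappa> - F (\<lambda>x. c * ?u x) \<kappa>"
    by (rule fourier_diff[OF Lp_mult_character(1)[OF u \<phi>] Lp_scale(1)[OF u] \<kappa>])
  also have "\<dots> = F ?u (\<kappa> * inverse \<phi>) - c * F ?u \<kappa>"
    by (simp only: fourier_mult_character[OF \<phi> \<kappa>] fourier_scale)
  finally show ?thesis
    by simp
qed

end

context riesz_setting
begin

text \<open>For a character \<phi> in the linear order this is the half-open interval of all \<eta>
  with 1 \<le> \<eta> < \<phi>.\<close>

definition gap :: "('g \<Rightarrow> complex) \<Rightarrow> ('g \<Rightarrow> complex) set" where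
  "gap \<phi> = T - (\<lambda>\<xi>. \<phi> * \<xi>) ` T"

lemma gap_iff:
  assumes "\<phi> \<in> T"
  shows "\<eta> \<in> gap \<phi> \<longleftrightarrow> \<eta> \<in> T \<and> \<eta> * inverse \<phi> \<notin> T"
proof -
  have "\<eta> \<in> (\<lambda>\<xi>. \<phi> * \<xi>) ` T \<longleftrightarrow> \<eta> * inverse \<phi> \<in> T"
  proof
    assume "\<eta> * inverse \<phi> \<in> T"
    then show "\<eta> \<in> (\<lambda>\<xi>. \<phi> * \<xi>) ` T"
      using characters_nonzero[OF T_characters[OF assms]]
      by (intro image_eqI[of _ _ "\<eta> * inverse \<phi>"]) (auto simp: fun_eq_iff)
  next
    assume "\<eta> \<in> (\<lambda>\<xi>. \<phi> * \<xi>) ` T"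
    then obtain \<xi> where "\<xi> \<in> T" "\<eta> = \<phi> * \<xi>"
      by blast
    moreover have "\<phi> * \<xi> * inverse \<phi> = \<xi>"
      using characters_nonzero[OF T_characters[OF assms]] by (auto simp: fun_eq_iff)
    ultimately show "\<eta> * inverse \<phi> \<in> T"
      by simp
  qed
  then show ?thesis
    by (auto simp: gap_def)
qed

lemma gap_T: "\<eta> \<in> gap \<phi> \<Longrightarrow> \<eta> \<in> T"
  by (simp add: gap_def)

text \<open>A single element of the gap suffices to refute invertibility inside the disc.\<close>

lemma one_in_gap:
  assumes "\<phi> \<in> T" "\<phi> \<noteq> 1"
  shows "1 \<in> gap \<phi>"
proof -
  have "1 * inverse \<phi> = inverse \<phi>"
    by (simp add: fun_eq_iff)
  then show ?thesis
    using T_antisym[OF assms(1)] assms by (auto simp: gap_iff T_one)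
qed

text \<open>Outside T the recursion is homogeneous, so the coefficient at \<kappa> is 1/c times the
  one at \<kappa>/\<phi>, and \<kappa>/\<phi> is outside T again. Decay forces all of them to
  vanish.\<close>

lemma resolvent_outside_Hp:
  assumes \<phi>: "\<phi> \<in> T" and c: "1 < cmod c" and f: "f \<in> H"
  shows "(\<lambda>x. f x / (\<phi> x - c)) \<in> H"
proof -
  let ?u = "\<lambda>x. f x / (\<phi> x - c)"
  have c': "cmod c \<noteq> 1" "c \<noteq> 0"
    using c by auto
  note \<phi>' = T_characters[OF \<phi>]
  note u = resolvent_Lp(1)[OF \<phi>' c'(1) Hp_Lp[OF f]]
  have "F ?u \<kappa> = 0" if "\<kappa> \<in> characters - T" for \<kappa>
  proof (rule geometric_decay_zero[of "1 / cmod c" "characters - T" "F ?u" "2 * N ?u"])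
    fix \<kappa> assume \<kappa>: "\<kappa> \<in> characters - T"
    then have "F f \<kappa> = 0"
      using Hp_fourier[OF f] by blast
    then have "F ?u (\<kappa> * inverse \<phi>) = c * F ?u \<kappa>"
      using resolvent_fourier[OF \<phi>' c'(1) Hp_Lp[OF f], of \<kappa>] \<kappa> by simp
    then have "cmod (F ?u (\<kappa> * inverse \<phi>)) = cmod c * cmod (F ?u \<kappa>)"
      by (simp only: norm_mult)
    then have "cmod (F ?u \<kappa>) \<le> 1 / cmod c * cmod (F ?u (\<kappa> * inverse \<phi>))"
      using c'(2) by simp
    moreover have "\<kappa> * inverse \<phi> \<in> characters - T"
      using \<kappa> T_divide_notin[of \<kappa> \<phi>] \<phi> by (auto intro: characters_mult characters_inverse \<phi>')
    ultimately show "F ?u \<kappa> = 0 \<or> (\<exists>\<xi>\<in>characters - T. cmod (F ?u \<kappa>) \<le> 1 / cmod c * cmod (F ?u \<xi>))"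
      by blast
    show "cmod (F ?u \<kappa>) \<le> 2 * N ?u"
      using \<kappa> by (intro fourier_bound u) auto
  qed (use c that in \<open>auto simp: divide_less_eq\<close>)
  then show ?thesis
    using u by (auto simp: Hp_iff)
qed

text \<open>Write 1 - z\<phi> = -z (\<phi> - 1/z), where 1/z lies outside the disc; z = 0 is
  trivial.\<close>

lemma resolvent_inside_Hp:
  assumes \<phi>: "\<phi> \<in> T" and z: "cmod z < 1" and f: "f \<in> H"
  shows "(\<lambda>x. f x / (1 - z * \<phi> x)) \<in> H"
proof (cases "z = 0")
  case True
  then show ?thesis
    using f by simp
next
  case False
  have 1: "1 < cmod (1 / z)"
    using z False by (simp add: norm_divide)
  have "f x / (1 - z * \<phi> x) = (- 1 / z) * (f x / (\<phi> x - 1 / z))" for x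
  proof -
    have "1 - z * \<phi> x = - z * (\<phi> x - 1 / z)"
      using False by (simp add: field_simps)
    then show ?thesis
      by simp
  qed
  then show ?thesis
    using Hp_scale[OF resolvent_outside_Hp[OF \<phi> 1 f], of "- 1 / z"] by simp
qed

lemma one_minus_nonzero:
  assumes "\<phi> \<in> characters" "cmod z < 1"
  shows "1 - z * \<phi> x \<noteq> 0"
proof
  assume "1 - z * \<phi> x = 0"
  then have "cmod (z * \<phi> x) = 1"
    by (metis eq_iff_diff_eq_0 norm_one)
  then show False
    using assms by (simp add: norm_mult characters_norm)
qed

text \<open>For \<xi> in T the character \<xi>\<phi> is never \<eta>, so going up by \<phi> the
  recursion is homogeneous with ratio z and all coefficients on T vanish. One step down from
  \<kappa> then leaves only the coefficient of \<eta> itself. Thus h maps to the coefficient of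
  h/(\<phi> - z) at \<kappa>/\<phi> as a functional dual to the gap characters.\<close>

lemma fourier_resolvent_gap:
  assumes \<phi>: "\<phi> \<in> T" and z: "cmod z < 1" and \<eta>: "\<eta> \<in> gap \<phi>" and \<kappa>: "\<kappa> \<in> T"
  shows "F (\<lambda>x. \<eta> x / (\<phi> x - z)) (\<kappa> * inverse \<phi>) = (if \<eta> = \<kappa> then 1 else 0)"
proof -
  let ?u = "\<lambda>x. \<eta> x / (\<phi> x - z)"
  have z': "cmod z \<noteq> 1"
    using z by simp
  note \<phi>' = T_characters[OF \<phi>] and \<eta>' = T_characters[OF gap_T[OF \<eta>]]
  note u = resolvent_Lp(1)[OF \<phi>' z' characters_Lp[OF \<eta>']]
  have rec: "F ?u (\<xi> * inverse \<phi>) = z * F ?u \<xi> + (if \<eta> = \<xi> then 1 else 0)" if "\<xi> \<in> characters" for \<xi>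
    using resolvent_fourier[OF \<phi>' z' characters_Lp[OF \<eta>'] that] fourier_character[OF \<eta>' that] by simp
  have "F ?u \<kappa> = 0"
  proof (rule geometric_decay_zero[of "cmod z" T "F ?u" "2 * N ?u"])
    fix \<xi> assume \<xi>: "\<xi> \<in> T"
    have *: "\<xi> * \<phi> * inverse \<phi> = \<xi>"
      by (rule characters_mult_inverse_cancel(1)[OF \<phi>'])
    then have "\<eta> \<noteq> \<xi> * \<phi>"
      using \<eta> \<xi> by (auto simp: gap_iff[OF \<phi>])
    then have "F ?u \<xi> = z * F ?u (\<xi> * \<phi>)"
      using rec[of "\<xi> * \<phi>"] T_characters[OF T_mult[OF \<xi> \<phi>]] * by simp
    then have "cmod (F ?u \<xi>) \<le> cmod z * cmod (F ?u (\<xi> * \<phi>))"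
      by (simp only: norm_mult order.refl)
    then show "F ?u \<xi> = 0 \<or> (\<exists>\<zeta>\<in>T. cmod (F ?u \<xi>) \<le> cmod z * cmod (F ?u \<zeta>))"
      using T_mult[OF \<xi> \<phi>] by blast
    show "cmod (F ?u \<xi>) \<le> 2 * N ?u"
      by (intro fourier_bound u T_characters \<xi>)
  qed (use z \<kappa> in auto)
  then show ?thesis
    using rec[OF T_characters[OF \<kappa>]] by simp
qed

text \<open>Division by \<phi> - z recovers g, which has no coefficient at \<kappa>/\<phi>; the
  functionals dual to the gap annihilate the range.\<close>

lemma fourier_resolvent_range:
  assumes \<phi>: "\<phi> \<in> T" and z: "cmod z < 1" and \<kappa>: "\<kappa> \<in> gap \<phi>" and g: "g \<in> H"
  shows "F (\<lambda>x. toeplitz_minus \<phi> z g x / (\<phi> x - z)) (\<kappa> * inverse \<phi>) = 0"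
proof -
  have z': "cmod z \<noteq> 1"
    using z by simp
  note \<phi>' = T_characters[OF \<phi>]
  have \<kappa>': "\<kappa> * inverse \<phi> \<in> characters"
    using gap_T[OF \<kappa>] by (intro characters_mult characters_inverse T_characters \<phi>)
  have "AE x in m. toeplitz_minus \<phi> z g x / (\<phi> x - z) = g x"
    using toeplitz_minus_positive[OF \<phi> g, of z] by eventually_elim (simp add: resolvent_denominator(2)[OF \<phi>' z'])
  then have "F (\<lambda>x. toeplitz_minus \<phi> z g x / (\<phi> x - z)) (\<kappa> * inverse \<phi>) = F g (\<kappa> * inverse \<phi>)"
    using resolvent_Lp(1)[OF \<phi>' z' Hp_Lp[OF toeplitz_minus_Hp[OF \<phi>' g]]]
    by (intro fourier_cong_AE \<kappa>') (auto intro: Lp_measurable Hp_Lp g)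
  also have "\<dots> = 0"
    using \<kappa> by (intro Hp_fourier g \<kappa>') (simp add: gap_iff[OF \<phi>])
  finally show ?thesis .
qed

subsection \<open>Positive symbols\<close>

lemma toeplitz_minus_positive_invertible:
  assumes \<phi>: "\<phi> \<in> T" and z: "1 < cmod z"
  shows "invertible_operator N H (toeplitz_minus \<phi> z)"
proof -
  let ?B = "\<lambda>f x. f x / (\<phi> x - z)"
  have z': "cmod z \<noteq> 1"
    using z by simp
  note \<phi>' = T_characters[OF \<phi>] and B = resolvent_outside_Hp[OF \<phi> z]
  note nz = resolvent_denominator(2)[OF \<phi>' z']
  show ?thesis
  proof (rule invertible_operatorI)
    show "bounded_operator N H H ?B"
    proof (rule bounded_operatorI[where K="1 / \<bar>1 - cmod z\<bar>"])
      show "N (?B f) \<le> 1 / \<bar>1 - cmod z\<bar> * N f" if "f \<in> H" for f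
        using resolvent_Lp(2)[OF \<phi>' z' Hp_Lp[OF that]] by simp
    qed (auto intro: B simp: add_divide_distrib)
    show "AE x in m. toeplitz_minus \<phi> z (?B f) x = f x" if "f \<in> H" for f
      using toeplitz_minus_positive[OF \<phi> B[OF that], of z] by eventually_elim (simp add: nz)
    show "AE x in m. ?B (toeplitz_minus \<phi> z f) x = f x" if "f \<in> H" for f
      using toeplitz_minus_positive[OF \<phi> that, of z] by eventually_elim (simp add: nz)
  qed (rule toeplitz_minus_bounded[OF \<phi>'])
qed

text \<open>The constant 1 is not in the range: the functional belonging to the gap element 1 takes
  the value 1 there and 0 on the range.\<close>

lemma toeplitz_minus_positive_not_invertible:
  assumes \<phi>: "\<phi> \<in> T" "\<phi> \<noteq> 1" and z: "cmod z < 1"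
  shows "\<not> invertible_operator N H (toeplitz_minus \<phi> z)"
proof
  assume "invertible_operator N H (toeplitz_minus \<phi> z)"
  then obtain g where g: "g \<in> H" "AE x in m. toeplitz_minus \<phi> z g x = 1 x"
    using invertible_operator_onto Hp_character[OF T_one] by blast
  have z': "cmod z \<noteq> 1"
    using z by simp
  note \<phi>' = T_characters[OF \<phi>(1)] and gap = one_in_gap[OF \<phi>]
  have "AE x in m. toeplitz_minus \<phi> z g x / (\<phi> x - z) = 1 x / (\<phi> x - z)"
    using g(2) by eventually_elim simp
  then have "F (\<lambda>x. toeplitz_minus \<phi> z g x / (\<phi> x - z)) (1 * inverse \<phi>) = F (\<lambda>x. 1 x / (\<phi> x - z)) (1 * inverse \<phi>)"
    by (intro fourier_cong_AE Lp_measurable resolvent_Lp(1)[OF \<phi>' z'] Hp_Lp toeplitz_minus_Hp \<phi>' g(1)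
        Hp_character T_one characters_mult characters_inverse characters_one)
  then show False
    using fourier_resolvent_range[OF \<phi>(1) z gap g(1)] fourier_resolvent_gap[OF \<phi>(1) z gap T_one] by simp
qed

text \<open>The kernel is trivial as \<phi> - z has no zeros, the range is closed as 1/(\<phi> - z)
  is bounded, and the gap characters span a complement of the range.\<close>

lemma toeplitz_minus_positive_fredholm:
  assumes \<phi>: "\<phi> \<in> T" and z: "cmod z < 1" and fin: "finite (gap \<phi>)"
  shows "fredholm_operator N H (toeplitz_minus \<phi> z)"
proof (rule fredholm_operatorI[OF _ _ finite.emptyI empty_subsetI _ fin])
  have z': "cmod z \<noteq> 1" and d: "0 < \<bar>1 - cmod z\<bar>"
    using z by auto
  note \<phi>' = T_characters[OF \<phi>]
  note nz = resolvent_denominator(2)[OF \<phi>' z'] and u = resolvent_Lp[OF \<phi>' z' Hp_Lp]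
  show "bounded_operator N H H (toeplitz_minus \<phi> z)"
    by (rule toeplitz_minus_bounded[OF \<phi>'])
  show gapH: "gap \<phi> \<subseteq> H"
    using gap_T Hp_character by blast
  show "\<exists>c. AE x in m. f x = (\<Sum>h\<in>{}. c h * h x)" if "f \<in> H" "AE x in m. toeplitz_minus \<phi> z f x = 0" for f
  proof -
    have "AE x in m. f x = 0"
      using that(2) toeplitz_minus_positive[OF \<phi> that(1), of z] by eventually_elim (simp add: nz)
    then show ?thesis
      by simp
  qed
  show "\<exists>g\<in>H. AE x in m. f x = toeplitz_minus \<phi> z g x"
    if f: "f \<in> H" and lim: "\<And>\<epsilon>. 0 < \<epsilon> \<Longrightarrow> \<exists>g\<in>H. N (\<lambda>x. f x - toeplitz_minus \<phi> z g x) < \<epsilon>" for f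
  proof -
    let ?u = "\<lambda>x. f x / (\<phi> x - z)"
    \<comment> \<open>Division by \<phi> - z is continuous, so approximants of f in the range give
      approximants of u in the closed space H.\<close>
    have "?u \<in> H"
    proof (rule Hp_closed[OF u(1)[OF f]])
      fix \<epsilon> :: real assume "0 < \<epsilon>"
      then obtain g where g: "g \<in> H" "N (\<lambda>x. f x - toeplitz_minus \<phi> z g x) < \<epsilon> * \<bar>1 - cmod z\<bar>"
        using lim d by (meson mult_pos_pos)
      have fg: "(\<lambda>x. f x - toeplitz_minus \<phi> z g x) \<in> H"
        by (intro Hp_diff f toeplitz_minus_Hp \<phi>' g)
      have eq: "AE x in m. ?u x - g x = (f x - toeplitz_minus \<phi> z g x) / (\<phi> x - z)"
        using toeplitz_minus_positive[OF \<phi> g(1), of z] by eventually_elim (simp add: nz diff_divide_distrib)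
      have "N (\<lambda>x. ?u x - g x) = N (\<lambda>x. (f x - toeplitz_minus \<phi> z g x) / (\<phi> x - z))"
        by (intro Lp_norm_cong_AE[OF _ _ eq] Lp_measurable u(1) fg Lp_diff Hp_Lp g(1) f)
      also have "\<dots> \<le> N (\<lambda>x. f x - toeplitz_minus \<phi> z g x) / \<bar>1 - cmod z\<bar>"
        by (rule u(2)[OF fg])
      also have "\<dots> < \<epsilon>"
        using g(2) d by (simp add: pos_divide_less_eq)
      finally show "\<exists>g\<in>H. N (\<lambda>x. ?u x - g x) < \<epsilon>"
        using g(1) by blast
    qed
    moreover from toeplitz_minus_positive[OF \<phi> this, of z] have "AE x in m. f x = toeplitz_minus \<phi> z ?u x"
      by eventually_elim (simp add: nz)
    ultimately show ?thesis
      by blast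
  qed
  show "\<exists>g\<in>H. \<exists>c. AE x in m. f x = toeplitz_minus \<phi> z g x + (\<Sum>h\<in>gap \<phi>. c h * h x)" if f: "f \<in> H" for f
  proof -
    \<comment> \<open>The values of the dual functionals at f; subtracting the corresponding
      combination of gap characters leaves a function that all of them annihilate.\<close>
    define c where "c \<eta> = F (\<lambda>x. f x / (\<phi> x - z)) (\<eta> * inverse \<phi>)" for \<eta>
    define f' where "f' = (\<lambda>x. f x - (\<Sum>\<eta>\<in>gap \<phi>. c \<eta> * \<eta> x))"
    let ?u = "\<lambda>x. f' x / (\<phi> x - z)"
    have f': "f' \<in> H"
      unfolding f'_def using gapH by (intro Hp_diff f Hp_sum Hp_scale) auto
    have gap_zero: "F ?u (\<kappa> * inverse \<phi>) = 0" if \<kappa>: "\<kappa> \<in> gap \<phi>" for \<kappa>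
    proof -
      have \<kappa>': "\<kappa> * inverse \<phi> \<in> characters"
        using gap_T[OF \<kappa>] by (intro characters_mult characters_inverse T_characters \<phi>)
      have r: "(\<lambda>x. \<eta> x / (\<phi> x - z)) \<in> L" if "\<eta> \<in> gap \<phi>" for \<eta>
        using u(1) gapH that by blast
      have "F ?u (\<kappa> * inverse \<phi>)
        = F (\<lambda>x. f x / (\<phi> x - z) - (\<Sum>\<eta>\<in>gap \<phi>. c \<eta> * (\<eta> x / (\<phi> x - z)))) (\<kappa> * inverse \<phi>)"
        by (simp add: f'_def diff_divide_distrib sum_divide_distrib)
      also have "\<dots> = c \<kappa> - (\<Sum>\<eta>\<in>gap \<phi>. c \<eta> * F (\<lambda>x. \<eta> x / (\<phi> x - z)) (\<kappa> * inverse \<phi>))"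
        by (subst fourier_diff[OF u(1)[OF f] Lp_sum[OF Lp_scale(1)[OF r]] \<kappa>'], assumption)
          (simp only: fourier_sum[OF Lp_scale(1)[OF r] \<kappa>'] fourier_scale c_def)
      also have "\<dots> = c \<kappa> - (\<Sum>\<eta>\<in>gap \<phi>. if \<eta> = \<kappa> then c \<eta> else 0)"
        using fourier_resolvent_gap[OF \<phi> z _ gap_T[OF \<kappa>]]
        by (intro arg_cong2[where f="(-)"] sum.cong) auto
      also have "\<dots> = 0"
        using fin \<kappa> by simp
      finally show ?thesis .
    qed
    have "F ?u \<kappa> = 0" if "\<kappa> \<in> characters - T" for \<kappa>
    proof (rule geometric_decay_zero[of "cmod z" "characters - T" "F ?u" "2 * N ?u"])
      fix \<kappa> assume \<kappa>: "\<kappa> \<in> characters - T"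
      show "cmod (F ?u \<kappa>) \<le> 2 * N ?u"
        using \<kappa> by (intro fourier_bound u f') auto
      have *: "\<kappa> * \<phi> * inverse \<phi> = \<kappa>"
        by (rule characters_mult_inverse_cancel(1)[OF \<phi>'])
      have \<kappa>\<phi>: "\<kappa> * \<phi> \<in> characters"
        using \<kappa> \<phi>' by (auto intro: characters_mult)
      \<comment> \<open>Either the step to \<kappa>\<phi> enters T, necessarily at a gap character,
        where the correction of f gives zero, or it stays outside T and contracts by |z|.\<close>
      show "F ?u \<kappa> = 0 \<or> (\<exists>\<xi>\<in>characters - T. cmod (F ?u \<kappa>) \<le> cmod z * cmod (F ?u \<xi>))"
      proof (cases "\<kappa> * \<phi> \<in> T")
        case True
        then have "\<kappa> * \<phi> \<in> gap \<phi>"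
          using \<kappa> * by (simp add: gap_iff[OF \<phi>])
        from gap_zero[OF this] show ?thesis
          using * by simp
      next
        case False
        then have "F f' (\<kappa> * \<phi>) = 0"
          by (intro Hp_fourier f' \<kappa>\<phi>)
        then have "F ?u \<kappa> = z * F ?u (\<kappa> * \<phi>)"
          using resolvent_fourier[OF \<phi>' z' Hp_Lp[OF f'] \<kappa>\<phi>] * by simp
        then have "cmod (F ?u \<kappa>) \<le> cmod z * cmod (F ?u (\<kappa> * \<phi>))"
          by (simp only: norm_mult order.refl)
        then show ?thesis
          using False \<kappa>\<phi> by blast
      qed
    qed (use z that in auto)
    then have uH: "?u \<in> H"
      using u(1)[OF f'] by (auto simp: Hp_iff)
    from toeplitz_minus_positive[OF \<phi> this, of z]
    have "AE x in m. f x = toeplitz_minus \<phi> z ?u x + (\<Sum>h\<in>gap \<phi>. c h * h x)"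
      by eventually_elim (simp add: nz f'_def)
    then show ?thesis
      using uH by blast
  qed
qed

text \<open>Each gap character is an element of the range plus a combination of the finite family M.
  Applying the dual functionals kills the range part and leaves the biorthogonality
  relations.\<close>

lemma toeplitz_minus_positive_fredholm_finite_gap:
  assumes \<phi>: "\<phi> \<in> T" and z: "cmod z < 1" and fred: "fredholm_operator N H (toeplitz_minus \<phi> z)"
  shows "finite (gap \<phi>)"
proof -
  obtain M where M: "finite M" "M \<subseteq> H"
    "\<And>f. f \<in> H \<Longrightarrow> \<exists>g\<in>H. \<exists>c. AE x in m. f x = toeplitz_minus \<phi> z g x + (\<Sum>h\<in>M. c h * h x)"
    using fredholm_operator_cokernel[OF fred] by blast
  have z': "cmod z \<noteq> 1"
    using z by simp
  note \<phi>' = T_characters[OF \<phi>]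
  note u = resolvent_Lp(1)[OF \<phi>' z' Hp_Lp]
  define l where "l h \<kappa> = F (\<lambda>x. h x / (\<phi> x - z)) (\<kappa> * inverse \<phi>)" for h \<kappa>
  show ?thesis
  proof (rule finite_biorthogonal[OF M(1), of _ l])
    fix \<eta> assume \<eta>: "\<eta> \<in> gap \<phi>"
    then obtain g c where g: "g \<in> H" "AE x in m. \<eta> x = toeplitz_minus \<phi> z g x + (\<Sum>h\<in>M. c h * h x)"
      using M(3) Hp_character gap_T by meson
    have "(\<Sum>h\<in>M. c h * l h \<kappa>) = (if \<eta> = \<kappa> then 1 else 0)" if \<kappa>: "\<kappa> \<in> gap \<phi>" for \<kappa>
    proof -
      have \<kappa>': "\<kappa> * inverse \<phi> \<in> characters"
        using gap_T[OF \<kappa>] by (intro characters_mult characters_inverse T_characters \<phi>)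
      have r: "(\<lambda>x. c h * (h x / (\<phi> x - z))) \<in> L" if "h \<in> M" for h
        using u M(2) that by (intro Lp_scale) blast
      have "(if \<eta> = \<kappa> then 1 else 0) = F (\<lambda>x. \<eta> x / (\<phi> x - z)) (\<kappa> * inverse \<phi>)"
        using fourier_resolvent_gap[OF \<phi> z \<eta> gap_T[OF \<kappa>]] by simp
      also have "\<dots> = F (\<lambda>x. toeplitz_minus \<phi> z g x / (\<phi> x - z) + (\<Sum>h\<in>M. c h * (h x / (\<phi> x - z)))) (\<kappa> * inverse \<phi>)"
      proof (rule fourier_cong_AE[OF _ _ _ \<kappa>'])
        show "AE x in m. \<eta> x / (\<phi> x - z) = toeplitz_minus \<phi> z g x / (\<phi> x - z) + (\<Sum>h\<in>M. c h * (h x / (\<phi> x - z)))"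
          using g(2) by eventually_elim (simp add: add_divide_distrib sum_divide_distrib)
      qed (intro Lp_measurable Lp_add Lp_sum r u toeplitz_minus_Hp \<phi>' g(1) Hp_character gap_T[OF \<eta>]; assumption)+
      also have "\<dots> = (\<Sum>h\<in>M. c h * l h \<kappa>)"
        by (subst fourier_add[OF u[OF toeplitz_minus_Hp[OF \<phi>' g(1)]] Lp_sum[OF r] \<kappa>'], assumption)
          (simp only: fourier_sum[OF r \<kappa>'] fourier_scale l_def fourier_resolvent_range[OF \<phi> z \<kappa> g(1)] add_0_left)
      finally show ?thesis ..
    qed
    then show "\<exists>c. \<forall>\<kappa>\<in>gap \<phi>. (\<Sum>h\<in>M. c h * l h \<kappa>) = (if \<eta> = \<kappa> then 1 else 0)"
      by blast
  qed
qed

subsection \<open>Negative symbols\<close>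

lemma toeplitz_minus_diff:
  assumes \<psi>: "\<psi> \<in> characters" and "f \<in> H" "g \<in> H"
  shows "AE x in m. toeplitz_minus \<psi> z (\<lambda>x. f x - g x) x = toeplitz_minus \<psi> z f x - toeplitz_minus \<psi> z g x"
proof -
  note i = Lp_mult_character(1)[OF Hp_Lp \<psi>]
  show ?thesis
    using P_diff[OF i i, OF assms(2,3)] unfolding toeplitz_minus_eq right_diff_distrib by eventually_elim simp
qed

text \<open>An eigenvector of the operator with symbol 1/\<phi> is one for every symbol \<phi>^(-n).
  Iterating on the symbol instead of composing operators keeps a single P, hence a norm bound
  independent of n.\<close>

lemma toeplitz_minus_negative_iterate:
  assumes \<phi>: "\<phi> \<in> T" and f: "f \<in> H" "AE x in m. toeplitz_minus (inverse \<phi>) z f x = 0"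
  shows "AE x in m. P (\<lambda>x. (inverse \<phi> ^ n) x * f x) x = z ^ n * f x"
proof (induction n)
  case 0
  then show ?case
    using P_ident[OF f(1)] by simp
next
  case (Suc n)
  note c = characters_inverse[OF T_characters[OF \<phi>]]
  note i = Lp_mult_character(1)[OF _ c] and fL = Hp_Lp[OF f(1)]
  have nf: "(\<lambda>x. (inverse \<phi> ^ n) x * f x) \<in> L"
    by (rule Lp_mult_character(1)[OF fL characters_power[OF c]])
  have "AE x in m. inverse \<phi> x * P (\<lambda>x. (inverse \<phi> ^ n) x * f x) x = z ^ n * (inverse \<phi> x * f x)"
    using Suc by eventually_elim (simp only: mult.left_commute)
  from P_cong_AE[OF i[OF P_Lp[OF nf]] Lp_scale(1)[OF i[OF fL]] this] P_scale[OF i[OF fL], of "z ^ n"]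
    P_inverse_mult_P[OF nf \<phi>] f(2)
  have "AE x in m. P (\<lambda>x. inverse \<phi> x * ((inverse \<phi> ^ n) x * f x)) x = z ^ Suc n * f x"
  proof eventually_elim
    case (elim x)
    have "P (\<lambda>x. inverse \<phi> x * ((inverse \<phi> ^ n) x * f x)) x = z ^ n * P (\<lambda>x. inverse \<phi> x * f x) x"
      by (simp only: elim(3)[symmetric] elim(1) elim(2))
    also have "P (\<lambda>x. inverse \<phi> x * f x) x = z * f x"
      using elim(4) by (simp only: toeplitz_minus_eq right_minus_eq)
    finally show ?case
      by (simp only: power_Suc ac_simps)
  qed
  moreover have "(\<lambda>x. inverse \<phi> x * ((inverse \<phi> ^ n) x * f x)) = (\<lambda>x. (inverse \<phi> ^ Suc n) x * f x)"
    by (simp add: fun_eq_iff)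
  ultimately show ?case
    by (simp only:)
qed

text \<open>An eigenvector would satisfy |z|^n N f \<le> K N f for all n with one fixed K.\<close>

lemma toeplitz_minus_negative_injective:
  assumes \<phi>: "\<phi> \<in> T" and z: "1 < cmod z" and f: "f \<in> H" "AE x in m. toeplitz_minus (inverse \<phi>) z f x = 0"
  shows "AE x in m. f x = 0"
proof (rule ccontr)
  assume "\<not> ?thesis"
  then have pos: "0 < N f"
    using Lp_norm_zero_iff[OF Hp_Lp[OF f(1)]] Lp_norm_nonneg[of f] by (simp add: less_le)
  obtain K where K: "0 < K" "\<And>f. f \<in> L \<Longrightarrow> N (P f) \<le> K * N f"
    using P_bound by blast
  have "cmod z ^ n \<le> K" for n
  proof -
    note c = characters_power[OF characters_inverse[OF T_characters[OF \<phi>]], of n]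
    let ?g = "\<lambda>x. (inverse \<phi> ^ n) x * f x"
    note gL = Lp_mult_character(1)[OF Hp_Lp[OF f(1)] c]
    have "cmod z ^ n * N f = N (\<lambda>x. z ^ n * f x)"
      using Lp_scale(2)[OF Hp_Lp[OF f(1)], of "z ^ n"] by (simp add: norm_power)
    also have "\<dots> = N (P ?g)"
      by (intro Lp_norm_cong_AE[symmetric] toeplitz_minus_negative_iterate[OF \<phi> f] Lp_measurable P_Lp gL Lp_scale Hp_Lp f(1))
    also have "\<dots> \<le> K * N ?g"
      by (rule K(2)[OF gL])
    also have "\<dots> \<le> K * N f"
      using K(1) Lp_mult_character(2)[OF Hp_Lp[OF f(1)] c] by (intro mult_left_mono) auto
    finally show ?thesis
      using pos by simp
  qed
  then show False
    using real_arch_pow[OF z, of K] by (meson linorder_not_less)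
qed

text \<open>The inverse is f to P (f / (1/\<phi> - z)). It is a right inverse since the inner P may
  be dropped by \<open>P_inverse_mult_P\<close>.\<close>

lemma toeplitz_minus_negative_invertible:
  assumes \<phi>: "\<phi> \<in> T" and z: "1 < cmod z"
  shows "invertible_operator N H (toeplitz_minus (inverse \<phi>) z)"
proof -
  note \<psi> = characters_inverse[OF T_characters[OF \<phi>]]
  let ?u = "\<lambda>f x. f x / (inverse \<phi> x - z)"
  let ?B = "\<lambda>f. P (?u f)"
  have z': "cmod z \<noteq> 1"
    using z by simp
  obtain K where K: "0 < K" "\<And>f. f \<in> L \<Longrightarrow> N (P f) \<le> K * N f"
    using P_bound by blast
  note u = resolvent_Lp[OF \<psi> z' Hp_Lp] and nz = resolvent_denominator(2)[OF \<psi> z']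
  note i = Lp_mult_character(1)[OF _ \<psi>]
  have AB: "AE x in m. toeplitz_minus (inverse \<phi>) z (?B f) x = f x" if f: "f \<in> H" for f
  proof -
    have eq: "(\<lambda>x. inverse \<phi> x * ?u f x - z * ?u f x) = f"
    proof
      fix x
      have "inverse \<phi> x * ?u f x - z * ?u f x = (inverse \<phi> x - z) * ?u f x"
        by (rule left_diff_distrib[symmetric])
      then show "inverse \<phi> x * ?u f x - z * ?u f x = f x"
        using nz[of x] by simp
    qed
    have "AE x in m. P (\<lambda>x. inverse \<phi> x * P (?u f) x) x = P (\<lambda>x. inverse \<phi> x * ?u f x) x"
      by (rule P_inverse_mult_P[OF u(1)[OF f] \<phi>])
    moreover have "AE x in m. P (\<lambda>x. z * ?u f x) x = z * P (?u f) x"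
      by (rule P_scale[OF u(1)[OF f]])
    moreover
    have "AE x in m. P f x = P (\<lambda>x. inverse \<phi> x * ?u f x) x - P (\<lambda>x. z * ?u f x) x"
      using P_diff[OF i[OF u(1)[OF f]] Lp_scale(1)[OF u(1)[OF f], of z]] unfolding eq .
    ultimately show ?thesis
      using P_ident[OF f] unfolding toeplitz_minus_eq
    proof eventually_elim
      case (elim x)
      show ?case
        by (simp only: elim(1) elim(2)[symmetric] elim(3)[symmetric] elim(4))
    qed
  qed
  note AH = toeplitz_minus_Hp[OF \<psi>]
  have BH: "?B f \<in> H" if "f \<in> H" for f
    by (rule P_Hp[OF u(1)[OF that]])
  show ?thesis
  proof (rule invertible_operatorI[OF toeplitz_minus_bounded[OF \<psi>] _ AB])
    show "bounded_operator N H H ?B"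
    proof (rule bounded_operatorI[where K="K / \<bar>1 - cmod z\<bar>"])
      show "?B f \<in> H" if "f \<in> H" for f
        by (rule BH[OF that])
      show "AE x in m. ?B (\<lambda>x. f x + g x) x = ?B f x + ?B g x" if "f \<in> H" "g \<in> H" for f g
        using P_add[OF u(1)[OF that(1)] u(1)[OF that(2)]] by (simp only: add_divide_distrib)
      show "AE x in m. ?B (\<lambda>x. c * f x) x = c * ?B f x" if "f \<in> H" for c f
        using P_scale[OF u(1)[OF that], of c] by (simp only: times_divide_eq_right)
      show "N (?B f) \<le> K / \<bar>1 - cmod z\<bar> * N f" if f: "f \<in> H" for f
      proof -
        have "N (?B f) \<le> K * N (?u f)"
          by (rule K(2)[OF u(1)[OF f]])
        also have "\<dots> \<le> K * (N f / \<bar>1 - cmod z\<bar>)"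
          using K(1) u(2)[OF f] by (intro mult_left_mono) auto
        finally show ?thesis
          by simp
      qed
    qed
    \<comment> \<open>A right inverse of an injective operator is also a left inverse: the
      difference of both sides lies in the kernel.\<close>
    show "AE x in m. ?B (toeplitz_minus (inverse \<phi>) z f) x = f x" if f: "f \<in> H" for f
    proof -
      let ?g = "?B (toeplitz_minus (inverse \<phi>) z f)"
      have gH: "?g \<in> H"
        by (rule BH[OF AH[OF f]])
      have "AE x in m. toeplitz_minus (inverse \<phi>) z (\<lambda>x. ?g x - f x) x = 0"
        using toeplitz_minus_diff[OF \<psi> gH f, of z] AB[OF AH[OF f]] by eventually_elim simp
      from toeplitz_minus_negative_injective[OF \<phi> z Hp_diff[OF gH f] this] show ?thesis
        by eventually_elim simp
    qed
  qed
qed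

text \<open>With the factor 1 - z\<phi> split off, the preimage of h is \<phi> h / (1 - z\<phi>),
  because P (\<phi> h / \<phi>) = h.\<close>

lemma toeplitz_minus_negative_onto:
  assumes \<phi>: "\<phi> \<in> T" and z: "cmod z < 1" and h: "h \<in> H"
  shows "\<exists>g\<in>H. AE x in m. toeplitz_minus (inverse \<phi>) z g x = h x"
proof
  let ?g = "\<lambda>x. \<phi> x * (h x / (1 - z * \<phi> x))"
  show g: "?g \<in> H"
    by (rule Hp_mult_character[OF resolvent_inside_Hp[OF \<phi> z h] \<phi>])
  have eq: "(\<lambda>x. inverse \<phi> x * ((1 - z * \<phi> x) * ?g x)) = (\<lambda>x. inverse \<phi> x * (\<phi> x * h x))"
    using one_minus_nonzero[OF T_characters[OF \<phi>] z] by (simp add: fun_eq_iff)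
  from toeplitz_minus_negative[OF \<phi> g, of z] P_inverse_mult_cancel[OF \<phi> h]
  show "AE x in m. toeplitz_minus (inverse \<phi>) z ?g x = h x"
    unfolding eq by eventually_elim (simp only:)
qed

lemma P_gap:
  assumes \<phi>: "\<phi> \<in> T" and \<eta>: "\<eta> \<in> gap \<phi>"
  shows "AE x in m. P (\<lambda>x. inverse \<phi> x * \<eta> x) x = 0"
proof -
  have eq: "(\<lambda>x. inverse \<phi> x * \<eta> x) = \<eta> * inverse \<phi>"
    by (simp add: fun_eq_iff)
  have "\<eta> * inverse \<phi> \<in> characters" "\<eta> * inverse \<phi> \<notin> T"
    using \<eta> \<phi> by (auto simp: gap_iff intro: characters_mult characters_inverse T_characters)
  then show ?thesis
    using P_character[of "\<eta> * inverse \<phi>"] unfolding eq by simp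
qed

text \<open>After the factorization only P (\<eta>/\<phi>) remains, and \<eta>/\<phi> is a character
  outside T.\<close>

lemma toeplitz_minus_negative_kernel:
  assumes \<phi>: "\<phi> \<in> T" and z: "cmod z < 1" and \<eta>: "\<eta> \<in> gap \<phi>"
  shows "(\<lambda>x. \<eta> x / (1 - z * \<phi> x)) \<in> H"
    and "AE x in m. toeplitz_minus (inverse \<phi>) z (\<lambda>x. \<eta> x / (1 - z * \<phi> x)) x = 0"
proof -
  let ?g = "\<lambda>x. \<eta> x / (1 - z * \<phi> x)"
  show g: "?g \<in> H"
    by (rule resolvent_inside_Hp[OF \<phi> z Hp_character[OF gap_T[OF \<eta>]]])
  have eq: "(\<lambda>x. inverse \<phi> x * ((1 - z * \<phi> x) * ?g x)) = (\<lambda>x. inverse \<phi> x * \<eta> x)"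
    using one_minus_nonzero[OF T_characters[OF \<phi>] z] by (simp add: fun_eq_iff)
  from toeplitz_minus_negative[OF \<phi> g, of z] P_gap[OF \<phi> \<eta>]
  show "AE x in m. toeplitz_minus (inverse \<phi>) z ?g x = 0"
    unfolding eq by eventually_elim (simp only:)
qed

text \<open>The kernel contains 1/(1 - z\<phi>), which comes from the gap element 1 and is nowhere
  zero.\<close>

lemma toeplitz_minus_negative_not_invertible:
  assumes \<phi>: "\<phi> \<in> T" "\<phi> \<noteq> 1" and z: "cmod z < 1"
  shows "\<not> invertible_operator N H (toeplitz_minus (inverse \<phi>) z)"
proof
  assume inv: "invertible_operator N H (toeplitz_minus (inverse \<phi>) z)"
  note k = toeplitz_minus_negative_kernel[OF \<phi>(1) z one_in_gap[OF \<phi>]]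
  from invertible_operator_injective[OF inv k] have "AE x in m. (1 :: 'g \<Rightarrow> complex) x = 0"
    using one_minus_nonzero[OF T_characters[OF \<phi>(1)] z] by simp
  then have "F 1 1 = F (\<lambda>_. 0) 1"
    by (intro fourier_cong_AE characters_one characters_measurable) auto
  then show False
    by (simp add: fourier_character)
qed

lemma P_sum_null:
  assumes "\<And>i. i \<in> I \<Longrightarrow> f i \<in> L" "\<And>i. i \<in> I \<Longrightarrow> AE x in m. P (f i) x = 0"
  shows "AE x in m. P (\<lambda>x. \<Sum>i\<in>I. f i x) x = 0"
proof -
  have 0: "AE x in m. P (\<lambda>_. 0) x = 0"
    by (rule P_null) auto
  show ?thesis
    using assms
  proof (induction I rule: infinite_finite_induct)
    case (insert i I)
    have "AE x in m. P (\<lambda>x. f i x + (\<Sum>i\<in>I. f i x)) x = P (f i) x + P (\<lambda>x. \<Sum>i\<in>I. f i x) x"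
      using insert by (intro P_add Lp_sum) auto
    moreover have "AE x in m. P (f i) x = 0" "AE x in m. P (\<lambda>x. \<Sum>i\<in>I. f i x) x = 0"
      using insert by auto
    ultimately have "AE x in m. P (\<lambda>x. f i x + (\<Sum>i\<in>I. f i x)) x = 0"
      by eventually_elim simp
    then show ?case
      using insert by simp
  qed (use 0 in auto)
qed

text \<open>For f in the kernel, g = (1 - z\<phi>) f satisfies P (g/\<phi>) = 0, so g is a
  combination of gap characters; dividing back gives f in terms of the functions
  \<open>e \<eta>\<close>.\<close>

lemma toeplitz_minus_negative_fredholm:
  assumes \<phi>: "\<phi> \<in> T" and z: "cmod z < 1" and fin: "finite (gap \<phi>)"
  shows "fredholm_operator N H (toeplitz_minus (inverse \<phi>) z)"
proof -
  note \<phi>' = T_characters[OF \<phi>]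
  note \<psi> = characters_inverse[OF \<phi>'] and nz = one_minus_nonzero[OF \<phi>' z]
  note i = Lp_mult_character(1)[OF _ \<psi>]
  define e where "e \<eta> = (\<lambda>x. \<eta> x / (1 - z * \<phi> x))" for \<eta> :: "'g \<Rightarrow> complex"
  have e_mult: "(\<lambda>x. e \<eta> x * (1 - z * \<phi> x)) = \<eta>" for \<eta>
    using nz by (simp add: e_def fun_eq_iff)
  \<comment> \<open>The spanning family is a set of functions, so coefficients indexed by \<eta>
    must be reindexed along e.\<close>
  have inj: "inj_on e (gap \<phi>)"
    by (rule inj_on_inverseI[of _ "\<lambda>h x. h x * (1 - z * \<phi> x)"]) (rule e_mult)
  show ?thesis
  proof (rule fredholm_operator_of_onto[OF toeplitz_minus_bounded[OF \<psi>], of _ "e ` gap \<phi>"])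
    show "\<exists>g\<in>H. AE x in m. toeplitz_minus (inverse \<phi>) z g x = f x" if "f \<in> H" for f
      by (rule toeplitz_minus_negative_onto[OF \<phi> z that])
    show "finite (e ` gap \<phi>)"
      using fin by simp
    show "e ` gap \<phi> \<subseteq> H"
      using toeplitz_minus_negative_kernel(1)[OF \<phi> z] by (auto simp: e_def)
    fix f assume f: "f \<in> H" and null: "AE x in m. toeplitz_minus (inverse \<phi>) z f x = 0"
    define g where "g = (\<lambda>x. (1 - z * \<phi> x) * f x)"
    define s where "s = (\<lambda>x. \<Sum>\<eta>\<in>gap \<phi>. F g \<eta> * \<eta> x)"
    define w where "w = (\<lambda>x. g x - s x)"
    have "(\<lambda>x. f x - z * (\<phi> x * f x)) \<in> H"
      by (intro Hp_diff Hp_scale Hp_mult_character f \<phi>)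
    then have g: "g \<in> H"
      by (simp add: g_def algebra_simps)
    have terms: "(\<lambda>x. F g \<eta> * \<eta> x) \<in> H" if "\<eta> \<in> gap \<phi>" for \<eta>
      by (intro Hp_scale Hp_character gap_T[OF that])
    then have s: "s \<in> H"
      unfolding s_def by (rule Hp_sum)
    have w: "w \<in> H"
      unfolding w_def by (rule Hp_diff[OF g s])
    \<comment> \<open>Division by \<phi> pushes out of T exactly the gap coefficients, and these
      were removed from w.\<close>
    have "(\<lambda>x. inverse \<phi> x * w x) \<in> H"
    proof -
      have "F (\<lambda>x. inverse \<phi> x * w x) \<kappa> = 0" if \<kappa>: "\<kappa> \<in> characters" "\<kappa> \<notin> T" for \<kappa>
      proof -
        have \<kappa>\<phi>: "\<kappa> * \<phi> \<in> characters"
          by (rule characters_mult[OF \<kappa>(1) \<phi>'])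
        have "F w (\<kappa> * \<phi>) = 0"
        proof (cases "\<kappa> * \<phi> \<in> T")
          case True
          have "\<kappa> * \<phi> * inverse \<phi> = \<kappa>"
            by (rule characters_mult_inverse_cancel(1)[OF \<phi>'])
          then have gap: "\<kappa> * \<phi> \<in> gap \<phi>"
            using True \<kappa> by (simp add: gap_iff[OF \<phi>])
          have "F s (\<kappa> * \<phi>) = (\<Sum>\<eta>\<in>gap \<phi>. F g \<eta> * F \<eta> (\<kappa> * \<phi>))"
            unfolding s_def using terms by (subst fourier_sum[OF Hp_Lp \<kappa>\<phi>]) (auto simp: fourier_scale)
          also have "\<dots> = (\<Sum>\<eta>\<in>gap \<phi>. if \<eta> = \<kappa> * \<phi> then F g \<eta> else 0)"
            by (rule sum.cong) (auto simp: fourier_character[OF T_characters[OF gap_T] \<kappa>\<phi>])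
          also have "\<dots> = F g (\<kappa> * \<phi>)"
            using fin gap by simp
          finally show ?thesis
            unfolding w_def by (simp add: fourier_diff[OF Hp_Lp[OF g] Hp_Lp[OF s] \<kappa>\<phi>])
        next
          case False
          then show ?thesis
            by (intro Hp_fourier w \<kappa>\<phi>)
        qed
        then show ?thesis
          by (simp only: fourier_mult_character[OF \<psi> \<kappa>(1)] fun_inverse_inverse)
      qed
      then show ?thesis
        using i[OF Hp_Lp[OF w]] by (simp add: Hp_iff)
    qed
    from P_ident[OF this] have "AE x in m. P (\<lambda>x. inverse \<phi> x * w x) x = inverse \<phi> x * w x" .
    moreover have "AE x in m. P (\<lambda>x. inverse \<phi> x * g x - inverse \<phi> x * s x) x
        = P (\<lambda>x. inverse \<phi> x * g x) x - P (\<lambda>x. inverse \<phi> x * s x) x"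
      by (rule P_diff[OF i[OF Hp_Lp[OF g]] i[OF Hp_Lp[OF s]]])
    moreover have "AE x in m. P (\<lambda>x. inverse \<phi> x * g x) x = 0"
      using toeplitz_minus_negative[OF \<phi> f, of z] null unfolding g_def by eventually_elim simp
    moreover have "AE x in m. P (\<lambda>x. inverse \<phi> x * s x) x = 0"
    proof -
      have t: "(\<lambda>x. F g \<eta> * (inverse \<phi> x * \<eta> x)) \<in> L" if "\<eta> \<in> gap \<phi>" for \<eta>
        by (intro Lp_scale i characters_Lp T_characters gap_T[OF that])
      have "AE x in m. P (\<lambda>x. F g \<eta> * (inverse \<phi> x * \<eta> x)) x = 0" if "\<eta> \<in> gap \<phi>" for \<eta>
        using P_scale[OF i[OF characters_Lp[OF T_characters[OF gap_T[OF that]]]], of "F g \<eta>"] P_gap[OF \<phi> that]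
        by eventually_elim simp
      from P_sum_null[OF t this] show ?thesis
        by (simp add: s_def sum_distrib_left mult.left_commute)
    qed
    \<comment> \<open>w/\<phi> equals P (w/\<phi>), which is P (g/\<phi>) - P (s/\<phi>) = 0; \<phi>
      has no zeros.\<close>
    ultimately have "AE x in m. w x = 0"
      unfolding w_def right_diff_distrib[symmetric]
      by eventually_elim (simp add: characters_nonzero[OF \<phi>'])
    then have "AE x in m. f x = (\<Sum>\<eta>\<in>gap \<phi>. F g \<eta> * e \<eta> x)"
    proof eventually_elim
      case (elim x)
      then have "f x = s x / (1 - z * \<phi> x)"
        using nz[of x] by (simp add: w_def g_def field_simps)
      then show ?case
        by (simp add: s_def e_def sum_divide_distrib)
    qed
    moreover have "(\<Sum>\<eta>\<in>gap \<phi>. F g \<eta> * e \<eta> x) = (\<Sum>h\<in>e ` gap \<phi>. F g (\<lambda>x. h x * (1 - z * \<phi> x)) * h x)" for x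
      by (simp add: sum.reindex[OF inj] e_mult)
    ultimately show "\<exists>c. AE x in m. f x = (\<Sum>h\<in>e ` gap \<phi>. c h * h x)"
      by (intro exI[of _ "\<lambda>h. F g (\<lambda>x. h x * (1 - z * \<phi> x))"]) simp
  qed
qed

text \<open>All \<eta>/(1 - z\<phi>) lie in the span of the finite family M. Multiplying by 1 -
  z\<phi> and taking coefficients at gap characters gives the biorthogonality relations.\<close>

lemma toeplitz_minus_negative_fredholm_finite_gap:
  assumes \<phi>: "\<phi> \<in> T" and z: "cmod z < 1" and fred: "fredholm_operator N H (toeplitz_minus (inverse \<phi>) z)"
  shows "finite (gap \<phi>)"
proof -
  obtain M where M: "finite M" "M \<subseteq> H"
    "\<And>f. f \<in> H \<Longrightarrow> AE x in m. toeplitz_minus (inverse \<phi>) z f x = 0 \<Longrightarrow> \<exists>c. AE x in m. f x = (\<Sum>h\<in>M. c h * h x)"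
    using fredholm_operator_kernel[OF fred] by blast
  note nz = one_minus_nonzero[OF T_characters[OF \<phi>] z]
  have r: "(\<lambda>x. (1 - z * \<phi> x) * h x) \<in> L" if "h \<in> M" for h
  proof -
    have "(\<lambda>x. h x - z * (\<phi> x * h x)) \<in> H"
      using M(2) that by (intro Hp_diff Hp_scale Hp_mult_character \<phi>) auto
    then show ?thesis
      using Hp_Lp by (simp add: algebra_simps)
  qed
  show ?thesis
  proof (rule finite_biorthogonal[OF M(1), of _ "\<lambda>h. F (\<lambda>x. (1 - z * \<phi> x) * h x)"])
    fix \<eta> assume \<eta>: "\<eta> \<in> gap \<phi>"
    note \<eta>' = T_characters[OF gap_T[OF \<eta>]]
    obtain c where c: "AE x in m. \<eta> x / (1 - z * \<phi> x) = (\<Sum>h\<in>M. c h * h x)"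
      using M(3)[OF toeplitz_minus_negative_kernel[OF \<phi> z \<eta>]] by blast
    have AE: "AE x in m. \<eta> x = (\<Sum>h\<in>M. c h * ((1 - z * \<phi> x) * h x))"
      using c
    proof eventually_elim
      case (elim x)
      have "\<eta> x = (1 - z * \<phi> x) * (\<eta> x / (1 - z * \<phi> x))"
        using nz[of x] by simp
      also have "\<dots> = (\<Sum>h\<in>M. c h * ((1 - z * \<phi> x) * h x))"
        unfolding elim sum_distrib_left by (simp add: mult.left_commute)
      finally show ?case .
    qed
    have "(\<Sum>h\<in>M. c h * F (\<lambda>x. (1 - z * \<phi> x) * h x) \<kappa>) = (if \<eta> = \<kappa> then 1 else 0)" if "\<kappa> \<in> gap \<phi>" for \<kappa>
    proof -
      note \<kappa>' = T_characters[OF gap_T[OF that]]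
      have "F \<eta> \<kappa> = F (\<lambda>x. \<Sum>h\<in>M. c h * ((1 - z * \<phi> x) * h x)) \<kappa>"
        by (intro fourier_cong_AE[OF _ _ AE \<kappa>'] characters_measurable \<eta>' Lp_measurable Lp_sum Lp_scale r)
      also have "\<dots> = (\<Sum>h\<in>M. c h * F (\<lambda>x. (1 - z * \<phi> x) * h x) \<kappa>)"
        by (simp only: fourier_sum[OF Lp_scale(1)[OF r] \<kappa>'] fourier_scale)
      finally show ?thesis
        using fourier_character[OF \<eta>' \<kappa>'] by simp
    qed
    then show "\<exists>c. \<forall>\<kappa>\<in>gap \<phi>. (\<Sum>h\<in>M. c h * F (\<lambda>x. (1 - z * \<phi> x) * h x) \<kappa>) = (if \<eta> = \<kappa> then 1 else 0)"
      by blast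
  qed
qed

end

section \<open>The unit circle\<close>

text \<open>The increments telescope to c times a partial sum of the harmonic series.\<close>

lemma harmonic_increments_unbounded:
  fixes s :: "nat \<Rightarrow> complex"
  assumes bound: "\<And>n. cmod (s n) \<le> B" and step: "\<And>n. 1 \<le> n \<Longrightarrow> s (Suc n) - s n = c / of_nat n"
  shows "c = 0"
proof (rule ccontr)
  assume c: "c \<noteq> 0"
  \<comment> \<open>Anchored at \<open>s 1\<close>, since the increments are prescribed only from n
    = 1 on.\<close>
  have sum: "s (Suc n) = s 1 + c * of_real (\<Sum>k<n. inverse (real (Suc k)))" for n
  proof (induction n)
    case (Suc n)
    then show ?case
      using step[of "Suc n"] by (simp add: algebra_simps divide_inverse)
  qed simp
  have "(\<Sum>k<n. inverse (real (Suc k))) \<le> 2 * B / cmod c" for n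
  proof -
    have "cmod c * (\<Sum>k<n. inverse (real (Suc k))) = cmod (c * of_real (\<Sum>k<n. inverse (real (Suc k))))"
      unfolding norm_mult norm_of_real by (simp add: sum_nonneg)
    also have "\<dots> = cmod (s (Suc n) - s 1)"
      using sum[of n] by simp
    also have "\<dots> \<le> 2 * B"
      using norm_triangle_ineq4[of "s (Suc n)" "s 1"] bound[of "Suc n"] bound[of 1] by linarith
    finally show ?thesis
      using c by (simp add: pos_le_divide_eq mult.commute)
  qed
  then have "summable (\<lambda>k. inverse (real (Suc k)))"
    by (intro summableI_nonneg_bounded) auto
  then show False
    using not_summable_harmonic[where 'a=real] summable_Suc_iff[of "\<lambda>n. inverse (real n)"] by simp
qed

context riesz_setting
begin

lemma T_power_eq_iff:
  assumes "\<phi> \<in> T" "\<phi> \<noteq> 1"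
  shows "\<phi> ^ j = \<phi> ^ k \<longleftrightarrow> j = k"
proof -
  have "j = k" if "j \<le> k" "\<phi> ^ j = \<phi> ^ k" for j k
  proof (rule ccontr)
    assume "j \<noteq> k"
    have "\<phi> ^ (k - j) = 1"
    proof
      fix x
      have "(\<phi> ^ j) x * (\<phi> ^ (k - j)) x = (\<phi> ^ k) x"
        using that(1) by (simp add: power_fun_apply flip: power_add)
      then show "(\<phi> ^ (k - j)) x = 1 x"
        using that(2) characters_nonzero[OF characters_power[OF T_characters[OF assms(1)]], of k x] by simp
    qed
    then show False
      using T_power_neq_one[OF assms, of "k - j"] \<open>j \<noteq> k\<close> that(1) by simp
  qed
  from this[of j k] this[of k j] show ?thesis
    by (cases "j \<le> k") auto
qed

lemma power_inverse_neq:
  assumes "\<phi> \<in> T" "\<phi> \<noteq> 1" "0 < k"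
  shows "inverse (\<phi> ^ k) \<noteq> \<phi> ^ n"
proof
  assume eq: "inverse (\<phi> ^ k) = \<phi> ^ n"
  have "\<phi> ^ (n + k) = 1"
  proof
    fix x
    have "(\<phi> ^ (n + k)) x = (\<phi> ^ n) x * (\<phi> ^ k) x"
      by (simp add: power_fun_apply power_add)
    also have "\<dots> = 1"
      using characters_nonzero[OF characters_power[OF T_characters[OF assms(1)]], of k x]
      by (simp flip: eq)
    finally show "(\<phi> ^ (n + k)) x = 1 x"
      by simp
  qed
  then show False
    using T_power_neq_one[OF assms(1,2), of "n + k"] assms(3) by simp
qed

end

text \<open>Both signs of the symbol reduce to multiplication by 1 - z\<phi>. The positive symbol
  \<phi> is then studied at the spectral point 1/z, the negative symbol
  \<open>inverse \<phi>\<close> at z itself.\<close>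

locale circle_point = riesz_setting m p T P
  for m :: "'g::topological_ab_group_add measure" and p T P +
  fixes \<phi> :: "'g \<Rightarrow> complex" and z :: complex
  assumes \<phi>_T: "\<phi> \<in> T" and \<phi>_neq: "\<phi> \<noteq> 1" and z_circle: "cmod z = 1"
begin

lemmas \<phi>_char = T_characters[OF \<phi>_T]
lemmas \<phi>_power_char = characters_power[OF \<phi>_char]

definition w :: "'g \<Rightarrow> complex" where
  "w x = z * \<phi> x"

lemma w_norm [simp]: "cmod (w x) = 1"
  using z_circle characters_norm[OF \<phi>_char] by (simp add: w_def norm_mult)

lemma w_continuous: "continuous_on UNIV w"
  unfolding w_def[abs_def] by (intro continuous_intros characters_continuous[OF \<phi>_char])

lemma w_measurable [measurable]: "w \<in> borel_measurable m"
  by (rule continuous_measurable[OF w_continuous])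

lemma w_power: "w x ^ k = z ^ k * (\<phi> ^ k) x"
  by (simp add: w_def power_mult_distrib power_fun_apply)

lemma w_power_Lp: "(\<lambda>x. w x ^ k) \<in> L"
  unfolding w_power by (intro Lp_scale characters_Lp \<phi>_power_char)

lemma fourier_w_power: "F (\<lambda>x. w x ^ k) (\<phi> ^ n) = (if k = n then z ^ n else 0)"
  unfolding w_power fourier_scale
  by (simp add: fourier_character \<phi>_power_char T_power_eq_iff[OF \<phi>_T \<phi>_neq])

lemma fourier_cnj_w_power:
  assumes "0 < k"
  shows "F (\<lambda>x. cnj (w x ^ k)) (\<phi> ^ n) = 0"
proof -
  have "cnj (w x ^ k) = cnj (z ^ k) * inverse (\<phi> ^ k) x" for x
    unfolding w_power complex_cnj_mult characters_cnj[OF \<phi>_power_char] by simp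
  then show ?thesis
    using power_inverse_neq[OF \<phi>_T \<phi>_neq assms, of n]
    by (simp only: fourier_scale fourier_character[OF characters_inverse[OF \<phi>_power_char] \<phi>_power_char]) simp
qed

text \<open>The Cesaro means of the powers of \<open>w\<close> converge to the indicator function of \<open>w = 1\<close>.\<close>

lemma AE_w_neq_1: "AE x in m. w x \<noteq> 1"
proof -
  define i :: "'g \<Rightarrow> complex" where "i = indicator {x. w x = 1}"
  define s where "s n = (\<lambda>x. (1 / of_nat (Suc n)) * (\<Sum>k<Suc n. w x ^ k))" for n
  have meas [measurable]: "{x. w x = 1} \<in> sets m"
    using measurable_sets[OF w_measurable, of "{1}"] by (simp add: vimage_def)
  have iL: "i \<in> L"
    unfolding i_def by (rule Lp_bounded[where B=1]) (auto simp: indicator_def)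
  have sL: "s n \<in> L" for n
    unfolding s_def by (intro Lp_scale Lp_sum w_power_Lp)
  have s_bound: "cmod (s n x) \<le> 1" for n x
  proof -
    have "cmod (\<Sum>k<Suc n. w x ^ k) \<le> (\<Sum>k<Suc n. cmod (w x ^ k))"
      by (rule norm_sum)
    also have "\<dots> = real (Suc n)"
      by (simp add: norm_power)
    finally show ?thesis
      by (simp add: s_def norm_mult norm_divide divide_simps del: sum.lessThan_Suc of_nat_Suc)
  qed
  have "(\<lambda>n. N (\<lambda>x. i x - s n x)) \<longlonglongrightarrow> 0"
  proof (rule Lp_norm_dominated_convergence)
    show "AE x in m. (\<lambda>n. s n x) \<longlonglongrightarrow> i x"
    proof (rule AE_I2)
      fix x
      show "(\<lambda>n. s n x) \<longlonglongrightarrow> i x"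
      proof (cases "w x = 1")
        case True
        then have "s n x = i x" for n
          by (simp add: s_def i_def del: sum.lessThan_Suc of_nat_Suc)
        then show ?thesis
          by simp
      next
        case False
        have lim: "(\<lambda>n. (2 / cmod (1 - w x)) * inverse (real (Suc n))) \<longlonglongrightarrow> 0"
          by (rule tendsto_mult_right_zero[OF LIMSEQ_inverse_real_of_nat])
        have "cmod (s n x) \<le> (2 / cmod (1 - w x)) * inverse (real (Suc n))" for n
        proof -
          have sum: "(\<Sum>k<Suc n. w x ^ k) = (1 - w x ^ Suc n) / (1 - w x)"
            using False by (subst sum_gp_strict) auto
          have "cmod (1 - w x ^ Suc n) \<le> 2"
            using norm_triangle_ineq4[of 1 "w x ^ Suc n"] by (simp add: norm_power norm_mult)
          then have "cmod (1 - w x ^ Suc n) / cmod (1 - w x) \<le> 2 / cmod (1 - w x)"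
            by (rule divide_right_mono) simp
          then have "cmod (1 - w x ^ Suc n) / cmod (1 - w x) * inverse (real (Suc n))
              \<le> 2 / cmod (1 - w x) * inverse (real (Suc n))"
            by (rule mult_right_mono) simp
          moreover have "cmod (s n x) = cmod (1 - w x ^ Suc n) / cmod (1 - w x) * inverse (real (Suc n))"
            unfolding s_def sum norm_mult norm_divide norm_of_nat by (simp add: divide_inverse)
          ultimately show ?thesis
            by simp
        qed
        then have "(\<lambda>n. s n x) \<longlonglongrightarrow> 0"
          by (intro Lim_null_comparison[OF _ lim]) auto
        then show ?thesis
          using False by (simp add: i_def)
      qed
    qed
    show "(\<lambda>_. 2) \<in> L"
      by (rule Lp_bounded[where B=2]) auto
    show "AE x in m. cmod (i x - s n x) \<le> cmod 2" for n
    proof (rule AE_I2)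
      fix x
      have "cmod (i x) \<le> 1"
        by (simp add: i_def indicator_def)
      then show "cmod (i x - s n x) \<le> cmod 2"
        using norm_triangle_ineq4[of "i x" "s n x"] s_bound[of n x] by simp
    qed
  qed (auto intro: Lp_measurable sL iL)
  from fourier_tendsto[OF characters_one iL sL this] have "(\<lambda>n. F (s n) 1) \<longlonglongrightarrow> F i 1" .
  \<comment> \<open>Only the term k = 0 has a coefficient at the character 1, so the integral of the
    mean is 1/(n + 1) and tends to 0.\<close>
  moreover have "F (s n) 1 = of_real (inverse (real (Suc n)))" for n
  proof -
    have "F (s n) 1 = (1 / of_nat (Suc n)) * (\<Sum>k<Suc n. F (\<lambda>x. w x ^ k) (\<phi> ^ 0))"
      unfolding s_def fourier_scale by (simp only: fourier_sum[OF w_power_Lp characters_one] power_0)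
    then show ?thesis
      unfolding fourier_w_power by (simp add: inverse_eq_divide del: sum.lessThan_Suc of_nat_Suc)
  qed
  moreover have "(\<lambda>n. complex_of_real (inverse (real (Suc n)))) \<longlonglongrightarrow> of_real 0"
    by (intro tendsto_of_real LIMSEQ_inverse_real_of_nat)
  ultimately have "F i 1 = 0"
    using LIMSEQ_unique by force
  moreover have "F i 1 = of_real (measure m {x. w x = 1})"
  proof -
    have "F i 1 = (\<integral>x. complex_of_real (indicator {x. w x = 1} x) \<partial>m)"
      by (simp add: fourier_def i_def of_real_indicator)
    then show ?thesis
      by (simp only: integral_complex_of_real) simp
  qed
  ultimately have "emeasure m {x. w x = 1} = 0"
    by (simp add: emeasure_eq_measure)
  then show ?thesis
    by (subst AE_iff_measurable[OF meas]) auto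
qed

text \<open>Abel regularization: f/(1 - r w) is in H for r < 1, and the error is f multiplied by w
  (1 - r)/(1 - r w). That factor has modulus at most 1 and tends to 0 wherever w \<noteq> 1, hence
  almost everywhere.\<close>

lemma Hp_approximation:
  assumes f: "f \<in> H" and \<epsilon>: "0 < \<epsilon>"
  shows "\<exists>g\<in>H. N (\<lambda>x. f x - (1 - w x) * g x) < \<epsilon>"
proof -
  define r where "r n = real n / real (Suc n)" for n
  have r: "0 \<le> r n" "r n < 1" for n
    by (auto simp: r_def)
  define g where "g n = (\<lambda>x. f x / (1 - (of_real (r n) * z) * \<phi> x))" for n
  have rz: "cmod (of_real (r n) * z) < 1" for n
    using r z_circle by (simp add: norm_mult)
  have gH: "g n \<in> H" for n
    unfolding g_def by (rule resolvent_inside_Hp[OF \<phi>_T rz f])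
  have den: "1 - r n \<le> cmod (1 - of_real (r n) * w x)" for n x
    using norm_triangle_ineq2[of 1 "of_real (r n) * w x"] r[of n] by (simp add: norm_mult)
  have den0: "1 - of_real (r n) * w x \<noteq> 0" for n x
  proof -
    have "cmod (1 - of_real (r n) * w x) \<noteq> 0"
      using r(2)[of n] den[of n x] by linarith
    then show ?thesis
      by (metis norm_zero)
  qed
  have eq: "f x - (1 - w x) * g n x = f x * (w x * of_real (1 - r n) / (1 - of_real (r n) * w x))" for n x
    using den0[of n x] by (simp add: g_def w_def mult.assoc field_simps)
  have "(\<lambda>n. N (\<lambda>x. f x - (1 - w x) * g n x)) \<longlonglongrightarrow> 0"
  proof (rule Lp_norm_dominated_convergence[OF _ _ Hp_Lp[OF f]])
    note [measurable] = f gH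
    show "f \<in> borel_measurable m" "(\<lambda>x. (1 - w x) * g n x) \<in> borel_measurable m" for n
      by measurable
    show "AE x in m. (\<lambda>n. (1 - w x) * g n x) \<longlonglongrightarrow> f x"
      using AE_w_neq_1
    proof eventually_elim
      case (elim x)
      have r1: "r \<longlonglongrightarrow> 1"
        unfolding r_def by (rule LIMSEQ_n_over_Suc_n)
      have "(\<lambda>n. (1 - w x) * (f x / (1 - of_real (r n) * w x))) \<longlonglongrightarrow> (1 - w x) * (f x / (1 - of_real 1 * w x))"
        using elim by (intro tendsto_intros r1) auto
      moreover have "(1 - w x) * (f x / (1 - of_real 1 * w x)) = f x"
        using elim by simp
      ultimately show ?case
        by (simp add: g_def w_def mult.assoc)
    qed
    show "AE x in m. cmod (f x - (1 - w x) * g n x) \<le> cmod (f x)" for n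
    proof (rule AE_I2)
      fix x
      have "cmod (w x * of_real (1 - r n) / (1 - of_real (r n) * w x)) \<le> 1"
        using den[of n x] r[of n] den0[of n x]
        by (simp add: norm_divide norm_mult divide_le_eq flip: of_real_diff)
      then show "cmod (f x - (1 - w x) * g n x) \<le> cmod (f x)"
        unfolding eq norm_mult by (simp add: mult_left_le)
    qed
  qed
  from order_tendstoD(2)[OF this \<epsilon>] show ?thesis
    using gH by (auto simp: eventually_sequentially)
qed

text \<open>A bounded function on the circle whose Fourier coefficients are not summable.\<close>

definition sawtooth :: "'g \<Rightarrow> complex" where
  "sawtooth x = (if w x = 1 then 0 else of_real (Im (Ln (1 - w x))))"

text \<open>The version inside the disc: for 0 \<le> r < 1 the argument of the logarithm has
  positive real part, so it stays off the branch cut and the power series is available.\<close>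

definition sawtooth_approx :: "real \<Rightarrow> 'g \<Rightarrow> complex" where
  "sawtooth_approx r x = of_real (Im (Ln (1 - of_real r * w x)))"

text \<open>Partial sums of the series of Ln (1 - r w). The term k = 0 vanishes because division by
  zero yields 0.\<close>

definition log_sum :: "real \<Rightarrow> nat \<Rightarrow> 'g \<Rightarrow> complex" where
  "log_sum r n x = (\<Sum>k<n. (- of_real (r ^ k / real k)) * w x ^ k)"

lemma Im_Ln_bounded: "u \<noteq> 0 \<Longrightarrow> cmod (of_real (Im (Ln u))) \<le> pi"
  using mpi_less_Im_Ln[of u] Im_Ln_le_pi[of u] by (simp add: abs_le_iff)

lemma sawtooth_bounded: "cmod (sawtooth x) \<le> pi"
  using Im_Ln_bounded[of "1 - w x"] by (simp add: sawtooth_def)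

lemma one_minus_w_Re:
  assumes "0 \<le> r" "r < 1"
  shows "0 < Re (1 - of_real r * w x)"
proof -
  have "Re (of_real r * w x) \<le> cmod (of_real r * w x)"
    by (rule complex_Re_le_cmod)
  also have "\<dots> < 1"
    using assms by (simp add: norm_mult)
  finally show ?thesis
    by simp
qed

lemma sawtooth_approx_bounded:
  assumes "0 \<le> r" "r < 1"
  shows "cmod (sawtooth_approx r x) \<le> pi"
  unfolding sawtooth_approx_def
proof (rule Im_Ln_bounded)
  show "1 - of_real r * w x \<noteq> 0"
    using one_minus_w_Re[OF assms, of x] by (metis less_irrefl zero_complex.sel(1))
qed

lemma sawtooth_approx_continuous:
  assumes "0 \<le> r" "r < 1"
  shows "continuous_on UNIV (sawtooth_approx r)"
  unfolding sawtooth_approx_def[abs_def]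
  using one_minus_w_Re[OF assms]
  by (intro continuous_intros w_continuous) (auto simp: complex_nonpos_Reals_iff less_le_not_le)

lemma sawtooth_approx_Lp:
  assumes "0 \<le> r" "r < 1"
  shows "sawtooth_approx r \<in> L"
  by (rule Lp_bounded[OF continuous_measurable[OF sawtooth_approx_continuous[OF assms]], of pi])
    (rule sawtooth_approx_bounded[OF assms])

text \<open>The condition n < j ensures that index n occurs in the sum. The conjugate contains only
  negative powers of \<phi>, none of which is a power \<phi>^n.\<close>

lemma fourier_log_sum:
  shows "log_sum r j \<in> L" "(\<lambda>x. cnj (log_sum r j x)) \<in> L"
    and "n < j \<Longrightarrow> F (log_sum r j) (\<phi> ^ n) = - of_real (r ^ n / real n) * z ^ n"
    and "F (\<lambda>x. cnj (log_sum r j x)) (\<phi> ^ n) = 0"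
proof -
  have t: "(\<lambda>x. (- of_real (r ^ k / real k)) * w x ^ k) \<in> L" for k
    by (intro Lp_scale w_power_Lp)
  have cL: "(\<lambda>x. cnj (w x ^ k)) \<in> L" for k
    by (rule Lp_bounded[where B=1]) (auto simp: norm_power)
  then have ct: "(\<lambda>x. (- of_real (r ^ k / real k)) * cnj (w x ^ k)) \<in> L" for k
    by (intro Lp_scale)
  have cnj_eq: "(\<lambda>x. cnj (log_sum r j x)) = (\<lambda>x. \<Sum>k<j. (- of_real (r ^ k / real k)) * cnj (w x ^ k))"
    by (simp add: log_sum_def)
  show "log_sum r j \<in> L"
    unfolding log_sum_def[abs_def] by (intro Lp_sum t)
  show "(\<lambda>x. cnj (log_sum r j x)) \<in> L"
    unfolding cnj_eq by (intro Lp_sum ct)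
  show "F (log_sum r j) (\<phi> ^ n) = - of_real (r ^ n / real n) * z ^ n" if "n < j"
  proof -
    have "F (log_sum r j) (\<phi> ^ n) = (\<Sum>k<j. (- of_real (r ^ k / real k)) * (if k = n then z ^ n else 0))"
      unfolding log_sum_def[abs_def] fourier_sum[OF t \<phi>_power_char] fourier_scale fourier_w_power ..
    also have "\<dots> = (\<Sum>k<j. if k = n then - of_real (r ^ n / real n) * z ^ n else 0)"
      by (rule sum.cong) auto
    also have "\<dots> = - of_real (r ^ n / real n) * z ^ n"
      using that by (subst sum.delta) auto
    finally show ?thesis .
  qed
  \<comment> \<open>For k = 0 the conjugate power is the constant 1, which does have a coefficient
    at n = 0; its factor 1/0 is 0.\<close>
  have "F (\<lambda>x. (- of_real (r ^ k / real k)) * cnj (w x ^ k)) (\<phi> ^ n) = 0" for k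
    unfolding fourier_scale using fourier_cnj_w_power[of k n] by (cases "k = 0") auto
  then show "F (\<lambda>x. cnj (log_sum r j x)) (\<phi> ^ n) = 0"
    unfolding cnj_eq fourier_sum[OF ct \<phi>_power_char] by simp
qed

text \<open>Since 1/k \<le> 1 the partial sums are dominated by the geometric series, which gives a
  majorant independent of j and x.\<close>

lemma log_sum_tendsto:
  assumes "0 \<le> r" "r < 1"
  shows "(\<lambda>j. log_sum r j x) \<longlonglongrightarrow> Ln (1 - of_real r * w x)" "cmod (log_sum r j x) \<le> 1 / (1 - r)"
proof -
  have "cmod (- (of_real r * w x)) < 1"
    using assms by (simp add: norm_mult)
  from Ln_series'[OF this] show "(\<lambda>j. log_sum r j x) \<longlonglongrightarrow> Ln (1 - of_real r * w x)"
    by (simp add: sums_def log_sum_def power_mult_distrib)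
  have "cmod (log_sum r j x) \<le> (\<Sum>k<j. cmod ((- of_real (r ^ k / real k)) * w x ^ k))"
    unfolding log_sum_def by (rule norm_sum)
  also have "\<dots> \<le> (\<Sum>k<j. r ^ k)"
  proof (rule sum_mono)
    fix k
    show "cmod ((- of_real (r ^ k / real k)) * w x ^ k) \<le> r ^ k"
    proof (cases "k = 0")
      case False
      then have "r ^ k * 1 \<le> r ^ k * real k"
        using assms by (intro mult_left_mono) auto
      then show ?thesis
        using assms False by (simp add: norm_mult norm_power norm_divide divide_le_eq)
    qed simp
  qed
  also have "\<dots> \<le> 1 / (1 - r)"
    using assms by (simp add: sum_gp_strict divide_right_mono)
  finally show "cmod (log_sum r j x) \<le> 1 / (1 - r)" .
qed

text \<open>Taking Im u = (u - cnj u)/(2i) for the logarithm, the conjugate part does not contribute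
  at \<phi>^n, and the factor i/2 is -1/(2i), the minus sign coming from the logarithm
  series.\<close>

lemma fourier_sawtooth_approx:
  assumes r: "0 \<le> r" "r < 1"
  shows "F (sawtooth_approx r) (\<phi> ^ n) = (\<i> / 2) * of_real (r ^ n / real n) * z ^ n"
proof -
  let ?s = "\<lambda>j x. (1 / (2 * \<i>)) * (log_sum r j x - cnj (log_sum r j x))"
  note bs = fourier_log_sum[where r=r]
  have s_eq: "?s j x = of_real (Im (log_sum r j x))" for j x
    by (simp add: complex_eq_iff)
  have sL: "?s j \<in> L" for j
    by (intro Lp_scale Lp_diff bs)
  have "(\<lambda>j. N (\<lambda>x. sawtooth_approx r x - ?s j x)) \<longlonglongrightarrow> 0"
  proof (rule Lp_norm_dominated_convergence[OF Lp_measurable[OF sL] Lp_measurable[OF sawtooth_approx_Lp[OF r]]])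
    show "(\<lambda>_. of_real (pi + 1 / (1 - r))) \<in> L"
      by (rule Lp_bounded(1)) auto
    show "AE x in m. (\<lambda>j. ?s j x) \<longlonglongrightarrow> sawtooth_approx r x"
      unfolding s_eq sawtooth_approx_def by (intro AE_I2 tendsto_intros log_sum_tendsto(1)[OF r])
    show "AE x in m. cmod (sawtooth_approx r x - ?s j x) \<le> cmod (of_real (pi + 1 / (1 - r)))" for j
    proof (rule AE_I2)
      fix x
      have "cmod (sawtooth_approx r x) \<le> pi"
        by (rule sawtooth_approx_bounded[OF r])
      moreover have "cmod (?s j x) \<le> 1 / (1 - r)"
        unfolding s_eq norm_of_real
        using abs_Im_le_cmod[of "log_sum r j x"] log_sum_tendsto(2)[OF r, of j x] by linarith
      ultimately have "cmod (sawtooth_approx r x - ?s j x) \<le> pi + 1 / (1 - r)"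
        using norm_triangle_ineq4[of "sawtooth_approx r x" "?s j x"] by linarith
      also have "\<dots> \<le> cmod (of_real (pi + 1 / (1 - r)))"
        unfolding norm_of_real by (rule abs_ge_self)
      finally show "cmod (sawtooth_approx r x - ?s j x) \<le> cmod (of_real (pi + 1 / (1 - r)))" .
    qed
  qed
  from fourier_tendsto[OF \<phi>_power_char sawtooth_approx_Lp[OF r] sL this]
  have "(\<lambda>j. F (?s j) (\<phi> ^ n)) \<longlonglongrightarrow> F (sawtooth_approx r) (\<phi> ^ n)" .
  \<comment> \<open>The coefficient is constant in j as soon as the partial sum includes index n,
    that is from j = n + 1 on.\<close>
  moreover have "(\<lambda>j. F (?s j) (\<phi> ^ n)) \<longlonglongrightarrow> (\<i> / 2) * of_real (r ^ n / real n) * z ^ n"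
  proof (rule tendsto_eventually, rule eventually_sequentiallyI[of "Suc n"])
    fix j assume "Suc n \<le> j"
    then have "F (?s j) (\<phi> ^ n) = (1 / (2 * \<i>)) * (- of_real (r ^ n / real n) * z ^ n - 0)"
      unfolding fourier_scale fourier_diff[OF bs(1) bs(2) \<phi>_power_char] bs(4)
      by (subst bs(3)) auto
    moreover have "1 / (2 * \<i>) = - (\<i> / 2)"
      by (simp add: field_simps)
    ultimately show "F (?s j) (\<phi> ^ n) = (\<i> / 2) * of_real (r ^ n / real n) * z ^ n"
      by (simp only: diff_0_right mult_minus_left mult_minus_right minus_minus mult.assoc)
  qed
  ultimately show ?thesis
    by (rule LIMSEQ_unique)
qed

text \<open>Let r tend to 1: the approximants converge at every point and are bounded by pi
  uniformly in r, so their coefficients converge too.\<close>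

lemma sawtooth_Lp: "sawtooth \<in> L"
  and fourier_sawtooth: "F sawtooth (\<phi> ^ n) = (\<i> / 2) * of_real (1 / real n) * z ^ n"
proof -
  define r where "r n = real n / real (Suc n)" for n
  have r: "0 \<le> r n" "r n < 1" for n
    by (auto simp: r_def)
  have r1: "r \<longlonglongrightarrow> 1"
    unfolding r_def by (rule LIMSEQ_n_over_Suc_n)
  have lim: "(\<lambda>n. sawtooth_approx (r n) x) \<longlonglongrightarrow> sawtooth x" for x
  proof (cases "w x = 1")
    case True
    \<comment> \<open>At w = 1 the argument is a positive real with real logarithm; this matches the
      value 0 assigned to \<open>sawtooth\<close> there.\<close>
    have "Im (Ln (1 - complex_of_real (r n))) = 0" for n
    proof -
      have "1 - complex_of_real (r n) = of_real (1 - r n)"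
        by simp
      moreover have "Ln (of_real (1 - r n)) = of_real (ln (1 - r n))"
        using r(2)[of n] by (intro Ln_of_real) simp
      ultimately show ?thesis
        by (simp only: Im_complex_of_real)
    qed
    then show ?thesis
      using True by (simp add: sawtooth_approx_def sawtooth_def)
  next
    case False
    \<comment> \<open>On the circle only w = 1 has real part 1, so elsewhere 1 - w lies off the
      branch cut and the logarithm is continuous there.\<close>
    have "Re (w x) < 1"
    proof (rule ccontr)
      assume "\<not> Re (w x) < 1"
      moreover have "(Re (w x))\<^sup>2 + (Im (w x))\<^sup>2 = 1"
        using cmod_power2[of "w x"] by simp
      moreover have "Re (w x) \<le> 1"
        using complex_Re_le_cmod[of "w x"] by simp
      ultimately have "Re (w x) = 1" "Im (w x) = 0"
        by (auto simp: not_less)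
      then show False
        using False by (simp add: complex_eq_iff)
    qed
    then have "1 - of_real 1 * w x \<notin> \<real>\<^sub>\<le>\<^sub>0"
      by (auto simp: complex_nonpos_Reals_iff)
    then have "(\<lambda>n. sawtooth_approx (r n) x) \<longlonglongrightarrow> of_real (Im (Ln (1 - of_real 1 * w x)))"
      unfolding sawtooth_approx_def by (intro tendsto_intros r1)
    then show ?thesis
      using False by (simp add: sawtooth_def)
  qed
  have meas: "sawtooth \<in> borel_measurable m"
    by (rule borel_measurable_LIMSEQ_metric[OF Lp_measurable[OF sawtooth_approx_Lp[OF r]] lim])
  show bL: "sawtooth \<in> L"
    by (rule Lp_bounded[OF meas sawtooth_bounded])
  have "(\<lambda>n. N (\<lambda>x. sawtooth x - sawtooth_approx (r n) x)) \<longlonglongrightarrow> 0"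
  proof (rule Lp_norm_dominated_convergence[OF Lp_measurable[OF sawtooth_approx_Lp[OF r]] meas])
    show "(\<lambda>_. of_real (2 * pi)) \<in> L"
      by (rule Lp_bounded(1)) auto
    show "AE x in m. cmod (sawtooth x - sawtooth_approx (r n) x) \<le> cmod (of_real (2 * pi))" for n
    proof (rule AE_I2)
      fix x
      show "cmod (sawtooth x - sawtooth_approx (r n) x) \<le> cmod (of_real (2 * pi))"
        using norm_triangle_ineq4[of "sawtooth x" "sawtooth_approx (r n) x"] sawtooth_bounded[of x] sawtooth_approx_bounded[OF r, of n x] pi_ge_zero unfolding norm_of_real by linarith
    qed
  qed (intro AE_I2 lim)
  from fourier_tendsto[OF \<phi>_power_char bL sawtooth_approx_Lp[OF r] this]
  have "(\<lambda>k. (\<i> / 2) * of_real (r k ^ n / real n) * z ^ n) \<longlonglongrightarrow> F sawtooth (\<phi> ^ n)"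
    by (simp only: fourier_sawtooth_approx[OF r])
  moreover have "(\<lambda>k. (\<i> / 2) * of_real (r k ^ n / real n) * z ^ n) \<longlonglongrightarrow> (\<i> / 2) * of_real (1 ^ n / real n) * z ^ n"
    unfolding divide_inverse by (intro tendsto_intros r1)
  ultimately show "F sawtooth (\<phi> ^ n) = (\<i> / 2) * of_real (1 / real n) * z ^ n"
    using LIMSEQ_unique by fastforce
qed

text \<open>At the powers of \<phi> its coefficients are those of -(i/2) Ln (1 - w). Obtaining it as
  a projection of a bounded function yields membership in H without estimating the unbounded real
  part of the logarithm.\<close>

definition sawtooth_proj :: "'g \<Rightarrow> complex" where
  "sawtooth_proj = P sawtooth"

lemma sawtooth_proj_Hp: "sawtooth_proj \<in> H"
  unfolding sawtooth_proj_def by (rule P_Hp[OF sawtooth_Lp])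

text \<open>Covers n = 0 as well: 1/0 is 0, in agreement with the missing constant term of the
  logarithm series.\<close>

lemma fourier_sawtooth_proj: "F sawtooth_proj (\<phi> ^ n) = (\<i> / 2) * of_real (1 / real n) * z ^ n"
  using fourier_P[OF sawtooth_Lp \<phi>_power_char] T_power[OF \<phi>_T] fourier_sawtooth by (simp add: sawtooth_proj_def)

section \<open>Failure of closed range on the unit circle\<close>

lemma z_nonzero: "z \<noteq> 0"
  using z_circle by auto

text \<open>If the range were closed, density would give a preimage g of
  \<open>sawtooth_proj\<close>. Its coefficients along the powers of \<phi>, rotated by powers of z,
  are bounded yet have increments proportional to 1/n.\<close>

lemma toeplitz_minus_positive_not_fredholm_circle: "\<not> fredholm_operator N H (toeplitz_minus \<phi> (1 / z))"
proof
  assume fred: "fredholm_operator N H (toeplitz_minus \<phi> (1 / z))"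
  have "\<exists>g\<in>H. N (\<lambda>x. sawtooth_proj x - toeplitz_minus \<phi> (1 / z) g x) < \<epsilon>" if \<epsilon>: "0 < \<epsilon>" for \<epsilon>
  proof -
    obtain g where g: "g \<in> H" "N (\<lambda>x. sawtooth_proj x - (1 - w x) * g x) < \<epsilon>"
      using Hp_approximation[OF sawtooth_proj_Hp \<epsilon>] by blast
    \<comment> \<open>The factor -z turns \<phi> - 1/z into 1 - z\<phi>.\<close>
    let ?g = "\<lambda>x. - z * g x"
    have gH: "?g \<in> H"
      by (rule Hp_scale[OF g(1)])
    note [measurable] = sawtooth_proj_Hp g(1) toeplitz_minus_Hp[OF \<phi>_char gH]
    have "(\<phi> x - 1 / z) * ?g x = (1 - w x) * g x" for x
      using z_nonzero by (simp add: w_def field_simps)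
    with toeplitz_minus_positive[OF \<phi>_T gH, of "1 / z"]
    have eq: "AE x in m. sawtooth_proj x - toeplitz_minus \<phi> (1 / z) ?g x = sawtooth_proj x - (1 - w x) * g x"
      by simp
    have "N (\<lambda>x. sawtooth_proj x - toeplitz_minus \<phi> (1 / z) ?g x) = N (\<lambda>x. sawtooth_proj x - (1 - w x) * g x)"
      by (rule Lp_norm_cong_AE[OF _ _ eq]) measurable
    then show ?thesis
      using g(2) gH by (intro bexI[of _ ?g]) auto
  qed
  from fredholm_operator_closed_range[OF fred sawtooth_proj_Hp this]
  obtain g where g: "g \<in> H" "AE x in m. toeplitz_minus \<phi> (1 / z) g x = sawtooth_proj x"
    by blast
  define a where "a n = F g (\<phi> ^ n)" for n
  \<comment> \<open>The shift by one makes the increment from n to n + 1 carry the denominator n. At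
    n = 0 truncated subtraction repeats the value at 1, outside the range of the increment
    formula.\<close>
  define s where "s n = a (n - 1) / z ^ (n - 1)" for n
  have "cmod (s n) \<le> 2 * N g" for n
    using fourier_bound[OF Hp_Lp[OF g(1)] \<phi>_power_char] z_circle
    by (simp add: s_def a_def norm_divide norm_power)
  moreover have "s (Suc n) - s n = (- (\<i> / 2) * z) / of_nat n" if n: "1 \<le> n" for n
  proof -
    note gL = Hp_Lp[OF g(1)]
    have AE: "AE x in m. sawtooth_proj x = \<phi> x * g x - (1 / z) * g x"
      using g(2) toeplitz_minus_positive[OF \<phi>_T g(1), of "1 / z"] by eventually_elim (simp add: left_diff_distrib)
    note \<phi>g = Lp_mult_character(1)[OF gL \<phi>_char] and zg = Lp_scale(1)[OF gL, of "1 / z"]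
    have "F sawtooth_proj (\<phi> ^ n) = F (\<lambda>x. \<phi> x * g x - (1 / z) * g x) (\<phi> ^ n)"
      by (rule fourier_cong_AE[OF Lp_measurable[OF Hp_Lp[OF sawtooth_proj_Hp]] Lp_measurable[OF Lp_diff(1)[OF \<phi>g zg]] AE \<phi>_power_char])
    also have "\<dots> = F g (\<phi> ^ n * inverse \<phi>) - (1 / z) * a n"
      by (simp only: fourier_diff[OF \<phi>g zg \<phi>_power_char] fourier_mult_character[OF \<phi>_char \<phi>_power_char]
          fourier_scale a_def)
    also have "\<phi> ^ n * inverse \<phi> = \<phi> ^ (n - 1)"
    proof
      fix x
      show "(\<phi> ^ n * inverse \<phi>) x = (\<phi> ^ (n - 1)) x"
        using n characters_nonzero[OF \<phi>_char, of x] by (cases n) (simp_all add: power_fun_apply)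
    qed
    finally have eq: "a (n - 1) - (1 / z) * a n = (\<i> / 2) * of_real (1 / real n) * z ^ n"
      by (simp add: fourier_sawtooth_proj a_def)
    have zn: "z ^ n = z * z ^ (n - 1)"
      using n by (cases n) auto
    have "a n = z * a (n - 1) - z * ((\<i> / 2) * of_real (1 / real n) * z ^ n)"
      unfolding eq[symmetric] using z_nonzero by (simp add: field_simps)
    then have "a n / z ^ n = a (n - 1) / z ^ (n - 1) - z * ((\<i> / 2) * of_real (1 / real n))"
      using z_nonzero by (simp add: zn diff_divide_distrib)
    then show ?thesis
      by (simp add: s_def)
  qed
  ultimately have "- (\<i> / 2) * z = 0"
    by (rule harmonic_increments_unbounded)
  then show False
    using z_nonzero by simp
qed

text \<open>The same contradiction with the recursion reversed: here the coefficient at \<phi>^(n+1)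
  is determined by the one at \<phi>^n.\<close>

lemma toeplitz_minus_negative_not_fredholm_circle: "\<not> fredholm_operator N H (toeplitz_minus (inverse \<phi>) z)"
proof
  note \<psi> = characters_inverse[OF \<phi>_char]
  assume fred: "fredholm_operator N H (toeplitz_minus (inverse \<phi>) z)"
  have "\<exists>g\<in>H. N (\<lambda>x. sawtooth_proj x - toeplitz_minus (inverse \<phi>) z g x) < \<epsilon>" if \<epsilon>: "0 < \<epsilon>" for \<epsilon>
  proof -
    obtain g where g: "g \<in> H" "N (\<lambda>x. sawtooth_proj x - (1 - w x) * g x) < \<epsilon>"
      using Hp_approximation[OF sawtooth_proj_Hp \<epsilon>] by blast
    \<comment> \<open>The extra \<phi> cancels the factor 1/\<phi>, so the operator maps this
      function to (1 - w) g, on which P acts as the identity.\<close>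
    let ?g = "\<lambda>x. \<phi> x * g x"
    have gH: "?g \<in> H"
      by (rule Hp_mult_character[OF g(1) \<phi>_T])
    have "(\<lambda>x. g x - z * (\<phi> x * g x)) \<in> H"
      by (intro Hp_diff Hp_scale g(1) gH)
    then have kH: "(\<lambda>x. (1 - w x) * g x) \<in> H"
      by (simp add: w_def algebra_simps)
    note [measurable] = sawtooth_proj_Hp g(1) toeplitz_minus_Hp[OF \<psi> gH]
    have e: "(\<lambda>x. inverse \<phi> x * ((1 - z * \<phi> x) * ?g x)) = (\<lambda>x. inverse \<phi> x * (\<phi> x * ((1 - w x) * g x)))"
      by (simp add: w_def mult_ac)
    have eq: "AE x in m. sawtooth_proj x - toeplitz_minus (inverse \<phi>) z ?g x = sawtooth_proj x - (1 - w x) * g x"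
      using toeplitz_minus_negative[OF \<phi>_T gH, of z] P_inverse_mult_cancel[OF \<phi>_T kH] unfolding e
      by eventually_elim (simp only:)
    have "N (\<lambda>x. sawtooth_proj x - toeplitz_minus (inverse \<phi>) z ?g x) = N (\<lambda>x. sawtooth_proj x - (1 - w x) * g x)"
      by (rule Lp_norm_cong_AE[OF _ _ eq]) measurable
    then show ?thesis
      using g(2) gH by (intro bexI[of _ ?g]) auto
  qed
  from fredholm_operator_closed_range[OF fred sawtooth_proj_Hp this]
  obtain g where g: "g \<in> H" "AE x in m. toeplitz_minus (inverse \<phi>) z g x = sawtooth_proj x"
    by blast
  note gL = Hp_Lp[OF g(1)]
  define a where "a n = F g (\<phi> ^ n)" for n
  \<comment> \<open>Dividing by z^n, of modulus 1, removes the ratio z from the recursion and leaves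
    pure increments.\<close>
  define s where "s n = a n / z ^ n" for n
  have "cmod (s n) \<le> 2 * N g" for n
    using fourier_bound[OF gL \<phi>_power_char] z_circle
    by (simp add: s_def a_def norm_divide norm_power)
  moreover have "s (Suc n) - s n = ((\<i> / 2) / z) / of_nat n" if n: "1 \<le> n" for n
  proof -
    note \<psi>g = Lp_mult_character(1)[OF gL \<psi>]
    have "F sawtooth_proj (\<phi> ^ n) = F (toeplitz_minus (inverse \<phi>) z g) (\<phi> ^ n)"
    proof (rule fourier_cong_AE[OF _ _ _ \<phi>_power_char])
      show "AE x in m. sawtooth_proj x = toeplitz_minus (inverse \<phi>) z g x"
        using g(2) by eventually_elim simp
    qed (intro Lp_measurable Hp_Lp sawtooth_proj_Hp toeplitz_minus_Hp \<psi> g(1))+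
    also have "\<dots> = F (P (\<lambda>x. inverse \<phi> x * g x)) (\<phi> ^ n) - z * a n"
      unfolding toeplitz_minus_eq by (simp only: fourier_diff[OF P_Lp[OF \<psi>g] Lp_scale(1)[OF gL] \<phi>_power_char] fourier_scale a_def)
    also have "F (P (\<lambda>x. inverse \<phi> x * g x)) (\<phi> ^ n) = F g (\<phi> ^ n * \<phi>)"
      using T_power[OF \<phi>_T]
      by (simp only: fourier_P[OF \<psi>g \<phi>_power_char] fourier_mult_character[OF \<psi> \<phi>_power_char]
          fun_inverse_inverse if_True)
    also have "F g (\<phi> ^ n * \<phi>) = a (Suc n)"
      by (simp only: a_def power_Suc2)
    finally have "a (Suc n) = z * a n + (\<i> / 2) * of_real (1 / real n) * z ^ n"
      by (simp add: fourier_sawtooth_proj)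
    then have "s (Suc n) = z * a n / z ^ Suc n + (\<i> / 2) * of_real (1 / real n) * z ^ n / z ^ Suc n"
      by (simp only: s_def add_divide_distrib)
    also have "\<dots> = s n + ((\<i> / 2) / z) / of_nat n"
      using z_nonzero by (simp add: s_def)
    finally show ?thesis
      by simp
  qed
  ultimately have "(\<i> / 2) / z = 0"
    by (rule harmonic_increments_unbounded)
  then show False
    using z_nonzero by simp
qed

end

section \<open>Spectra\<close>

text \<open>The minimum \<open>a\<close> of \<open>Re \<kappa>\<close> satisfies \<open>a \<le> 2a\<^sup>2 - 1\<close> by doubling, hence \<open>a \<le> -1/2\<close>. So \<open>Re \<kappa>\<close>
  vanishes somewhere, and doubling once more shows that it takes the value \<open>-1\<close>.\<close>

lemma range_character:
  fixes \<kappa> :: "'g::topological_ab_group_add \<Rightarrow> complex"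
  assumes "compact (UNIV :: 'g set)" "connected (UNIV :: 'g set)" and \<kappa>: "\<kappa> \<in> characters" "\<kappa> \<noteq> 1"
  shows "range \<kappa> = sphere 0 1"
proof
  show "range \<kappa> \<subseteq> sphere 0 1"
    using \<kappa>(1) by (auto simp: characters_norm)
  have cont: "continuous_on UNIV (\<lambda>x. Re (\<kappa> x))"
    by (intro continuous_intros characters_continuous \<kappa>)
  have sq: "(Re (\<kappa> x))\<^sup>2 + (Im (\<kappa> x))\<^sup>2 = 1" for x
    using cmod_power2[of "\<kappa> x"] characters_norm[OF \<kappa>(1)] by simp
  have double: "Re (\<kappa> (x + x)) = 2 * (Re (\<kappa> x))\<^sup>2 - 1" for x
    using sq[of x] by (simp add: characters_add[OF \<kappa>(1)] power2_eq_square)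
  have le1: "Re (\<kappa> x) \<le> 1" for x
    using complex_Re_le_cmod[of "\<kappa> x"] characters_norm[OF \<kappa>(1)] by simp
  obtain x0 where x0: "\<And>x. Re (\<kappa> x0) \<le> Re (\<kappa> x)"
    using continuous_attains_inf[OF assms(1) _ cont] by auto
  have lt1: "Re (\<kappa> x0) < 1"
  proof (rule ccontr)
    assume "\<not> Re (\<kappa> x0) < 1"
    then have re: "Re (\<kappa> x) = 1" for x
      using x0[of x] le1[of x] by linarith
    have "\<kappa> x = 1" for x
      using sq[of x] re[of x] by (simp add: complex_eq_iff)
    then show False
      using \<kappa>(2) by (auto simp: fun_eq_iff)
  qed
  have "0 \<le> (2 * Re (\<kappa> x0) + 1) * (Re (\<kappa> x0) - 1)"
    using x0[of "x0 + x0"] double[of x0] by (simp add: algebra_simps power2_eq_square)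
  then have "Re (\<kappa> x0) \<le> 0"
    using lt1 by (auto simp: zero_le_mult_iff)
  have conn: "connected (range (\<lambda>x. Re (\<kappa> x)))"
    by (rule connected_continuous_image[OF cont assms(2)])
  have one: "Re (\<kappa> 0) = 1"
    using characters_at_zero[OF \<kappa>(1)] by simp
  have "{Re (\<kappa> x0)..Re (\<kappa> 0)} \<subseteq> range (\<lambda>x. Re (\<kappa> x))"
    by (rule connected_contains_Icc[OF conn]) auto
  moreover have "0 \<in> {Re (\<kappa> x0)..Re (\<kappa> 0)}"
    using \<open>Re (\<kappa> x0) \<le> 0\<close> one by simp
  ultimately obtain x1 where "Re (\<kappa> x1) = 0"
    by (metis (no_types, lifting) imageE subsetD)
  then have m1: "Re (\<kappa> (x1 + x1)) = - 1"
    using double[of x1] by simp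
  have Icc: "{Re (\<kappa> (x1 + x1))..Re (\<kappa> 0)} \<subseteq> range (\<lambda>x. Re (\<kappa> x))"
    by (rule connected_contains_Icc[OF conn]) auto
  show "sphere 0 1 \<subseteq> range \<kappa>"
  proof
    fix v :: complex assume v: "v \<in> sphere 0 1"
    then have "\<bar>Re v\<bar> \<le> 1"
      using abs_Re_le_cmod[of v] by simp
    then have "Re v \<in> {Re (\<kappa> (x1 + x1))..Re (\<kappa> 0)}"
      using m1 one by (simp add: abs_le_iff)
    then obtain x where x: "Re (\<kappa> x) = Re v"
      using Icc by (metis (no_types, lifting) imageE subsetD)
    have "(Re v)\<^sup>2 + (Im v)\<^sup>2 = 1"
      using cmod_power2[of v] v by simp
    then have "(Im (\<kappa> x))\<^sup>2 = (Im v)\<^sup>2"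
      using sq[of x] x by simp
    then consider "Im (\<kappa> x) = Im v" | "Im (\<kappa> x) = - Im v"
      using power2_eq_iff by blast
    then show "v \<in> range \<kappa>"
    proof cases
      case 1
      then have "v = \<kappa> x"
        using x by (simp add: complex_eq_iff)
      then show ?thesis
        by blast
    next
      case 2
      \<comment> \<open>The real part fixes a point of the circle only up to conjugation; the
        conjugate value is attained at -x.\<close>
      have "\<kappa> (- x) = cnj (\<kappa> x)"
        by (simp only: characters_uminus[OF \<kappa>(1)] characters_cnj[OF \<kappa>(1)])
      then have "v = \<kappa> (- x)"
        using x 2 by (simp add: complex_eq_iff)
      then show ?thesis
        by blast
    qed
  qed
qed

section \<open>Characters with an index, and the case distinction over |z|\<close>

context riesz_setting
begin

text \<open>Multiplication by \<beta> embeds the gap of \<alpha>/\<beta> into T - \<alpha>T: if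
  \<beta>\<eta> = \<alpha>\<xi> with \<xi> in T, then \<eta> = (\<alpha>/\<beta>)\<xi> would not be
  in the gap.\<close>

lemma finite_gap_quotient:
  assumes "\<alpha> \<in> T" "\<beta> \<in> T" "finite (T - (\<lambda>\<xi>. \<alpha> * \<xi>) ` T)"
  shows "finite (gap (\<alpha> * inverse \<beta>))"
proof -
  note nz = characters_nonzero[OF T_characters[OF assms(2)]]
  have inj: "inj_on (\<lambda>\<eta>. \<beta> * \<eta>) (gap (\<alpha> * inverse \<beta>))"
    using characters_mult_eq_iff[OF T_characters[OF assms(2)]] by (simp add: inj_on_def)
  have "(\<lambda>\<eta>. \<beta> * \<eta>) ` gap (\<alpha> * inverse \<beta>) \<subseteq> T - (\<lambda>\<xi>. \<alpha> * \<xi>) ` T"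
  proof
    fix \<zeta> assume "\<zeta> \<in> (\<lambda>\<eta>. \<beta> * \<eta>) ` gap (\<alpha> * inverse \<beta>)"
    then obtain \<eta> where \<eta>: "\<eta> \<in> gap (\<alpha> * inverse \<beta>)" "\<zeta> = \<beta> * \<eta>"
      by blast
    have "\<zeta> \<notin> (\<lambda>\<xi>. \<alpha> * \<xi>) ` T"
    proof
      assume "\<zeta> \<in> (\<lambda>\<xi>. \<alpha> * \<xi>) ` T"
      then obtain \<xi> where \<xi>: "\<xi> \<in> T" "\<zeta> = \<alpha> * \<xi>"
        by blast
      have "\<eta> = \<alpha> * inverse \<beta> * \<xi>"
      proof
        fix x
        have "\<beta> x * \<eta> x = \<alpha> x * \<xi> x"
          using fun_cong[OF \<eta>(2), of x] fun_cong[OF \<xi>(2), of x] by simp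
        then have "\<eta> x = \<alpha> x * \<xi> x / \<beta> x"
          using nz[of x] by (simp add: nonzero_eq_divide_eq mult.commute)
        then show "\<eta> x = (\<alpha> * inverse \<beta> * \<xi>) x"
          by (simp add: divide_inverse)
      qed
      then show False
        using \<eta>(1) \<xi>(1) by (auto simp: gap_def)
    qed
    moreover have "\<zeta> \<in> T"
      using \<eta> assms(2) by (auto intro: T_mult gap_T)
    ultimately show "\<zeta> \<in> T - (\<lambda>\<xi>. \<alpha> * \<xi>) ` T"
      by blast
  qed
  then show ?thesis
    using assms(3) inj finite_imageD finite_subset by blast
qed

text \<open>The definition allows any representation as a quotient. The trivial ones, with 1 as
  denominator or numerator, give one direction, and \<open>finite_gap_quotient\<close> shows that no
  other representation admits more characters. For the inverse the roles of \<alpha> and \<beta> are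
  exchanged.\<close>

lemma indexed_characters_iff:
  assumes "\<phi> \<in> T"
  shows "\<phi> \<in> indexed_characters T \<longleftrightarrow> finite (gap \<phi>)"
    and "inverse \<phi> \<in> indexed_characters T \<longleftrightarrow> finite (gap \<phi>)"
proof -
  have one: "finite (T - (\<lambda>\<xi>. 1 * \<xi>) ` T)"
    by simp
  show "\<phi> \<in> indexed_characters T \<longleftrightarrow> finite (gap \<phi>)"
  proof
    assume "\<phi> \<in> indexed_characters T"
    then show "finite (gap \<phi>)"
      by (auto simp: indexed_characters_def intro: finite_gap_quotient)
  next
    assume fin: "finite (gap \<phi>)"
    have "\<phi> = \<phi> * inverse 1"
      by (simp add: fun_eq_iff)
    then show "\<phi> \<in> indexed_characters T"
      unfolding indexed_characters_def mem_Collect_eq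
      by (intro exI[of _ \<phi>] exI[of _ 1] conjI assms T_one one fin[unfolded gap_def])
  qed
  show "inverse \<phi> \<in> indexed_characters T \<longleftrightarrow> finite (gap \<phi>)"
  proof
    assume "inverse \<phi> \<in> indexed_characters T"
    then obtain \<alpha> \<beta> where \<alpha>\<beta>: "inverse \<phi> = \<alpha> * inverse \<beta>" "\<alpha> \<in> T" "\<beta> \<in> T" "finite (T - (\<lambda>\<xi>. \<beta> * \<xi>) ` T)"
      by (auto simp: indexed_characters_def)
    have "\<phi> = inverse (\<alpha> * inverse \<beta>)"
      by (simp only: \<alpha>\<beta>(1)[symmetric] fun_inverse_inverse)
    also have "\<dots> = \<beta> * inverse \<alpha>"
      by (simp add: fun_eq_iff)
    finally show "finite (gap \<phi>)"
      using finite_gap_quotient[OF \<alpha>\<beta>(3,2,4)] by simp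
  next
    assume fin: "finite (gap \<phi>)"
    have "inverse \<phi> = 1 * inverse \<phi>"
      by (simp add: fun_eq_iff)
    then show "inverse \<phi> \<in> indexed_characters T"
      unfolding indexed_characters_def mem_Collect_eq
      by (intro exI[of _ 1] exI[of _ \<phi>] conjI assms T_one one fin[unfolded gap_def])
  qed
qed

text \<open>Linearity of the order makes \<psi> or its inverse positive, so two signs and three
  ranges of |z| exhaust all cases. On the circle invertibility fails because an invertible operator
  would be Fredholm.\<close>

lemma toeplitz_minus_spectral_cases:
  assumes "\<psi> \<in> characters" "\<psi> \<noteq> 1"
  shows "invertible_operator N H (toeplitz_minus \<psi> z) \<longleftrightarrow> 1 < cmod z"
    and "fredholm_operator N H (toeplitz_minus \<psi> z) \<longleftrightarrow> 1 < cmod z \<or> cmod z < 1 \<and> \<psi> \<in> indexed_characters T"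
proof -
  have facts: "(1 < cmod z \<longrightarrow> invertible_operator N H (toeplitz_minus \<psi> z)) \<and>
    (cmod z < 1 \<longrightarrow> \<not> invertible_operator N H (toeplitz_minus \<psi> z)) \<and>
    (cmod z < 1 \<longrightarrow> (fredholm_operator N H (toeplitz_minus \<psi> z) \<longleftrightarrow> \<psi> \<in> indexed_characters T)) \<and>
    (cmod z = 1 \<longrightarrow> \<not> fredholm_operator N H (toeplitz_minus \<psi> z))"
    using assms(1)
  proof (cases rule: T_cases)
    case 1
    have "\<not> fredholm_operator N H (toeplitz_minus \<psi> z)" if "cmod z = 1"
    proof -
      \<comment> \<open>For a positive symbol the locale parameter is the reciprocal of the spectral
        point.\<close>
      interpret circle_point m p T P \<psi> "1 / z"
        by unfold_locales (use 1 assms(2) that in \<open>auto simp: norm_divide\<close>)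
      show ?thesis
        using toeplitz_minus_positive_not_fredholm_circle by simp
    qed
    then show ?thesis
      using toeplitz_minus_positive_invertible[OF 1, of z] toeplitz_minus_positive_not_invertible[OF 1 assms(2), of z]
        toeplitz_minus_positive_fredholm[OF 1, of z] toeplitz_minus_positive_fredholm_finite_gap[OF 1, of z]
      unfolding indexed_characters_iff(1)[OF 1] by blast
  next
    case (2 \<phi>)
    have neq: "\<phi> \<noteq> 1"
      using 2(2) assms(2) by (auto simp: fun_eq_iff)
    have "\<not> fredholm_operator N H (toeplitz_minus (inverse \<phi>) z)" if "cmod z = 1"
    proof -
      interpret circle_point m p T P \<phi> z
        by unfold_locales (use 2 neq that in auto)
      show ?thesis
        by (rule toeplitz_minus_negative_not_fredholm_circle)
    qed
    then show ?thesis
      using toeplitz_minus_negative_invertible[OF 2(1), of z] toeplitz_minus_negative_not_invertible[OF 2(1) neq, of z]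
        toeplitz_minus_negative_fredholm[OF 2(1), of z] toeplitz_minus_negative_fredholm_finite_gap[OF 2(1), of z]
      unfolding 2(2) indexed_characters_iff(2)[OF 2(1)] by blast
  qed
  consider "cmod z < 1" | "cmod z = 1" | "1 < cmod z"
    by linarith
  then show "invertible_operator N H (toeplitz_minus \<psi> z) \<longleftrightarrow> 1 < cmod z"
    using facts fredholm_operator_of_invertible by cases auto
  show "fredholm_operator N H (toeplitz_minus \<psi> z) \<longleftrightarrow> 1 < cmod z \<or> cmod z < 1 \<and> \<psi> \<in> indexed_characters T"
    using facts fredholm_operator_of_invertible by (cases "cmod z" "1 :: real" rule: linorder_cases) auto
qed

end

theorem corollary11:
  fixes m :: "'g::{topological_ab_group_add, t2_space} measure"
    and T :: "('g \<Rightarrow> complex) set"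
    and p :: real
    and P :: "('g \<Rightarrow> complex) \<Rightarrow> 'g \<Rightarrow> complex"
    and \<psi> :: "'g \<Rightarrow> complex"
  assumes "compact (UNIV :: 'g set)" and "connected (UNIV :: 'g set)" and "\<exists>x::'g. x \<noteq> 0"
    and "normalized_haar m"
    and "positive_cone T" and "linearly_ordered_by T"
    and "1 < p" and "riesz_projection m T p P"
    and "\<psi> \<in> characters" and "\<psi> \<noteq> 1"
  shows "operator_spectrum (Lp_norm m p) (Hp m T p) (toeplitz P \<psi>) = cball 0 1 \<and>
    (\<psi> \<in> indexed_characters T \<longrightarrow>
       essential_spectrum (Lp_norm m p) (Hp m T p) (toeplitz P \<psi>) = range \<psi> \<and>
       range \<psi> = sphere 0 1) \<and>
    (\<psi> \<notin> indexed_characters T \<longrightarrow>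
       essential_spectrum (Lp_norm m p) (Hp m T p) (toeplitz P \<psi>) = cball 0 1)"
proof -
  interpret riesz_setting m p T P
    by unfold_locales (use assms in auto)
  have spectrum: "operator_spectrum N H (toeplitz P \<psi>) = cball 0 1"
    using toeplitz_minus_spectral_cases(1)[OF assms(9,10)]
    by (auto simp: operator_spectrum_def toeplitz_minus_def not_less)
  have essential: "essential_spectrum N H (toeplitz P \<psi>)
      = {z. \<not> (1 < cmod z \<or> cmod z < 1 \<and> \<psi> \<in> indexed_characters T)}"
    using toeplitz_minus_spectral_cases(2)[OF assms(9,10)] by (simp add: essential_spectrum_def toeplitz_minus_def)
  have "range \<psi> = sphere 0 1"
    by (rule range_character[OF assms(1,2,9,10)])
  moreover have "{z. \<not> (1 < cmod z \<or> cmod z < 1)} = sphere 0 1" "{z. \<not> 1 < cmod z} = cball 0 1"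
    by auto
  ultimately show ?thesis
    using spectrum essential by simp
qed

end
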